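(* Let $K$ be a field equipped with a henselian topology $\tau$, let $C\subseteq K$ be a subfield, and let $A\subseteq K$ be a subset defined by an existential formula of the language of rings with parameters from $C$. Then exactly one of (i) or (ii) holds: (i) $A$ is a finite subset of the relative algebraic closure of $\Lambda_K C$ in $K$; (ii) $A$ is infinite and there is a definable injection $g:U_1^\circ\to A$, perhaps involving extra parameters, where $U_1^\circ$ is a nonempty Zariski open subset of a $\tau$-neighbourhood $U_1\subseteq K$, such that each element of $U_1^\circ$ is interalgebraic with its image under $g$ over the parameters. Moreover, if $C\subseteq K^{(p^\infty)}$, then exactly one of (i) and (ii') holds, where (ii') there exist $m<\omega$ and a $\tau$-open set $O\subseteq K$ with $O\cap K^{(p^m)}\neq\emptyset$ such that $O\cap K^{(p^m)}\subseteq A$.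
   Context: $p$ is the characteristic exponent of $K$ (the characteristic if positive, else $1$); $K^{(p^m)}=\{x^{p^m}:x\in K\}$ and $K^{(p^\infty)}=\bigcap_{m}K^{(p^m)}$. An extension $F/C$ is separable if $F$ is linearly disjoint from $C^{1/p}$ over $C$. For a field extension $F/D$, $\Lambda_F D$ denotes the smallest subfield $E$ with $D\subseteq E\subseteq F$ such that $F/E$ is separable (it exists by a theorem of Deveney and Mordeson). "Definable" refers to first-order definability with parameters in the field $K$ equipped with its topology $\tau$ (e.g. the two-sorted structure consisting of the field $K$, the $\tau$-open sets, and membership). If $E$ is the subfield of $K$ generated by $C$ together with the extra field parameters used, $u$ and $g(u)$ are interalgebraic over the parameters if $u$ is algebraic over $E(g(u))$ and $g(u)$ is algebraic over $E(u)$. Henselian topology: a V-topology on $K$ (a field topology induced by a nontrivial absolute value or a nontrivial valuation) that is locally equivalent, in the sense of Prestel and Ziegler, to the topology induced by a nontrivial henselian valuation on some field. Equivalently, a V-topology satisfying the Implicit Function Theorem for polynomials: for every $f\in K[X_0,\dots,X_{m-1},Y]$ and $(e,d)\in K^{m}\times K$ with $f(e,d)=0$ and $\frac{\partial f}{\partial Y}(e,d)\neq0$ there are $\tau$-open $U\ni e$, $V\ni d$ such that $\{f=0\}\cap(U\times V)$ is the graph of a continuous function $U\to V$. *)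

theory Defs
  imports
    "HOL-Analysis.Analysis"
    "HOL-Library.Poly_Mapping"
    "HOL-Algebra.Algebraic_Closure_Type"
begin

section \<open>Subfields, separability and the operator $\Lambda$\<close>

text \<open>The ambient field $K$ is a type of class \<^class>\<open>field\<close>; its subfields are sets.\<close>

definition is_subfield :: "'a::field set \<Rightarrow> bool" where
  "is_subfield F \<longleftrightarrow>
     0 \<in> F \<and> 1 \<in> F \<and>
     (\<forall>x\<in>F. \<forall>y\<in>F. x + y \<in> F \<and> x - y \<in> F \<and> x * y \<in> F) \<and>
     (\<forall>x\<in>F. inverse x \<in> F)"

abbreviation generated_subfield :: "'a::field set \<Rightarrow> 'a set" where
  "generated_subfield S \<equiv> is_subfield hull S"

definition algebraic_over :: "'a::field set \<Rightarrow> 'a \<Rightarrow> bool" where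
  "algebraic_over F x \<longleftrightarrow>
     (\<exists>q::'a poly. q \<noteq> 0 \<and> (\<forall>i. Polynomial.coeff q i \<in> F) \<and> poly q x = 0)"

definition char_exponent :: "'a::field itself \<Rightarrow> nat" where
  "char_exponent T = (if CHAR('a) = 0 then 1 else CHAR('a))"

text \<open>$K^{(p^m)}$ and $K^{(p^\infty)}$, where $p$ is the characteristic exponent of $K$.\<close>

definition K_pow :: "nat \<Rightarrow> 'a::field set" where
  "K_pow m = {x ^ (char_exponent TYPE('a) ^ m) |x. True}"

definition K_pow_inf :: "'a::field set" where
  "K_pow_inf = (\<Inter>m. K_pow m)"

definition lin_indep_over :: "'b::field set \<Rightarrow> 'b set \<Rightarrow> bool" where
  "lin_indep_over E S \<longleftrightarrow>
     (\<forall>T c. finite T \<and> T \<subseteq> S \<and> c ` T \<subseteq> E \<and> (\<Sum>t\<in>T. c t * t) = 0 \<longrightarrow> (\<forall>t\<in>T. c t = 0))"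

text \<open>Linear disjointness of the subfields \<open>F\<close> and \<open>L\<close> of a common field over a common
  subfield \<open>E\<close>.\<close>

definition linearly_disjoint :: "'b::field set \<Rightarrow> 'b set \<Rightarrow> 'b set \<Rightarrow> bool" where
  "linearly_disjoint E F L \<longleftrightarrow> (\<forall>S\<subseteq>F. lin_indep_over E S \<longrightarrow> lin_indep_over L S)"

text \<open>$E^{1/p}$, formed inside the algebraic closure of $K$.\<close>

definition p_roots :: "'a::field set \<Rightarrow> 'a alg_closure set" where
  "p_roots E = {z. z ^ char_exponent TYPE('a) \<in> to_ac ` E}"

definition separable_extension :: "'a::field set \<Rightarrow> 'a set \<Rightarrow> bool" where
  "separable_extension F E \<longleftrightarrow> linearly_disjoint (to_ac ` E) (to_ac ` F) (p_roots E)"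

definition Lambda :: "'a::field set \<Rightarrow> 'a set \<Rightarrow> 'a set" where
  "Lambda F D = (LEAST E. is_subfield E \<and> D \<subseteq> E \<and> E \<subseteq> F \<and> separable_extension F E)"


section \<open>Henselian topologies\<close>

definition absolute_value :: "('a::field \<Rightarrow> real) \<Rightarrow> bool" where
  "absolute_value a \<longleftrightarrow>
     (\<forall>x. a x \<ge> 0) \<and> (\<forall>x. a x = 0 \<longleftrightarrow> x = 0) \<and>
     (\<forall>x y. a (x * y) = a x * a y) \<and> (\<forall>x y. a (x + y) \<le> a x + a y)"

definition nontrivial_abs :: "('a::field \<Rightarrow> real) \<Rightarrow> bool" where
  "nontrivial_abs a \<longleftrightarrow> (\<exists>x. x \<noteq> 0 \<and> a x \<noteq> 1)"

definition induced_by_abs :: "'a::field topology \<Rightarrow> ('a \<Rightarrow> real) \<Rightarrow> bool" where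
  "induced_by_abs \<tau> a \<longleftrightarrow>
     (\<forall>U. openin \<tau> U \<longleftrightarrow> (\<forall>x\<in>U. \<exists>\<epsilon>>0. {y. a (y - x) < \<epsilon>} \<subseteq> U))"

text \<open>Valuations are written additively; only the values at nonzero elements matter, the value
  at \<open>0\<close> being thought of as $\infty$.  The value group is the image of the nonzero elements,
  not necessarily all of the type \<open>'g\<close>.\<close>

definition valuation :: "('a::field \<Rightarrow> 'g::linordered_ab_group_add) \<Rightarrow> bool" where
  "valuation v \<longleftrightarrow>
     (\<forall>x y. x \<noteq> 0 \<and> y \<noteq> 0 \<longrightarrow> v (x * y) = v x + v y) \<and>
     (\<forall>x y. x \<noteq> 0 \<and> y \<noteq> 0 \<and> x + y \<noteq> 0 \<longrightarrow> min (v x) (v y) \<le> v (x + y))"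

definition nontrivial_val :: "('a::field \<Rightarrow> 'g::linordered_ab_group_add) \<Rightarrow> bool" where
  "nontrivial_val v \<longleftrightarrow> (\<exists>x. x \<noteq> 0 \<and> v x \<noteq> 0)"

definition induced_by_val :: "'a::field topology \<Rightarrow> ('a \<Rightarrow> 'g::linordered_ab_group_add) \<Rightarrow> bool" where
  "induced_by_val \<tau> v \<longleftrightarrow>
     (\<forall>U. openin \<tau> U \<longleftrightarrow>
        (\<forall>x\<in>U. \<exists>\<gamma> \<in> v ` (- {0}). {y. y = x \<or> v (y - x) > \<gamma>} \<subseteq> U))"

text \<open>A definition cannot quantify over types, so the type \<open>'g\<close> in which value groups live is an
  argument.  In a hypothesis with a type variable \<open>'g\<close> that does not occur in the conclusion this
  amounts to asking for a valuation with an arbitrary value group.\<close>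

definition V_topology :: "'g::linordered_ab_group_add itself \<Rightarrow> 'a::field topology \<Rightarrow> bool" where
  "V_topology T \<tau> \<longleftrightarrow>
     (\<exists>a. absolute_value a \<and> nontrivial_abs a \<and> induced_by_abs \<tau> a) \<or>
     (\<exists>v::'a \<Rightarrow> 'g. valuation v \<and> nontrivial_val v \<and> induced_by_val \<tau> v)"

text \<open>Polynomials in the variables $X_0, X_1, \ldots$ are finitely supported families of
  coefficients, indexed by the exponents \<open>\<alpha>\<close>.  An element of $K[X_0,\ldots,X_{m-1},Y]$ is treated as
  a polynomial in $Y$ with coefficients in $K[X_0,\ldots,X_{m-1}]$, so that specialising the $X_i$
  gives a univariate polynomial whose \<^const>\<open>pderiv\<close> is the specialised
  $\partial f/\partial Y$.\<close>

definition mpoly_vars_below :: "nat \<Rightarrow> ((nat \<Rightarrow>\<^sub>0 nat) \<Rightarrow>\<^sub>0 'a::field) \<Rightarrow> bool" where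
  "mpoly_vars_below m q \<longleftrightarrow> (\<forall>\<alpha>\<in>Poly_Mapping.keys q. Poly_Mapping.keys \<alpha> \<subseteq> {..<m})"

definition mpoly_eval :: "(nat \<Rightarrow> 'a) \<Rightarrow> ((nat \<Rightarrow>\<^sub>0 nat) \<Rightarrow>\<^sub>0 'a::field) \<Rightarrow> 'a" where
  "mpoly_eval e q = (\<Sum>\<alpha>\<in>Poly_Mapping.keys q. Poly_Mapping.lookup q \<alpha> * (\<Prod>i\<in>Poly_Mapping.keys \<alpha>. e i ^ Poly_Mapping.lookup \<alpha> i))"

definition specialise ::
    "(nat \<Rightarrow> 'a) \<Rightarrow> ((nat \<Rightarrow>\<^sub>0 nat) \<Rightarrow>\<^sub>0 'a::field) poly \<Rightarrow> 'a poly" where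
  "specialise e f = map_poly (mpoly_eval e) f"

text \<open>$K^m$ is the set of functions \<open>{..<m} \<rightarrow>\<^sub>E UNIV\<close> with the product topology.\<close>

definition polynomial_IFT :: "'a::field topology \<Rightarrow> bool" where
  "polynomial_IFT \<tau> \<longleftrightarrow>
     (\<forall>m (f :: ((nat \<Rightarrow>\<^sub>0 nat) \<Rightarrow>\<^sub>0 'a) poly) e d.
        (\<forall>j. mpoly_vars_below m (Polynomial.coeff f j)) \<and>
        e \<in> {..<m} \<rightarrow>\<^sub>E UNIV \<and>
        poly (specialise e f) d = 0 \<and> poly (pderiv (specialise e f)) d \<noteq> 0 \<longrightarrow>
        (\<exists>U V h.
           openin (product_topology (\<lambda>_. \<tau>) {..<m}) U \<and> e \<in> U \<and> openin \<tau> V \<and> d \<in> V \<and>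
           continuous_map (subtopology (product_topology (\<lambda>_. \<tau>) {..<m}) U) (subtopology \<tau> V) h \<and>
           {(x, y). poly (specialise x f) y = 0} \<inter> U \<times> V = {(x, h x) |x. x \<in> U}))"

definition henselian_topology ::
    "'g::linordered_ab_group_add itself \<Rightarrow> 'a::field topology \<Rightarrow> bool" where
  "henselian_topology T \<tau> \<longleftrightarrow> V_topology T \<tau> \<and> polynomial_IFT \<tau>"


section \<open>First-order formulas\<close>

text \<open>Terms of the language of rings with parameters from $K$, and formulas of the two-sorted
  language of a field together with its open sets.  Both sorts have variables, numbered
  independently, and parameters.  Equality of open sets is not needed as an atomic formula, being
  expressible by extensionality.\<close>

datatype 'a rterm =
    TVar nat | TPar 'a | TZero | TOne
  | TAdd "'a rterm" "'a rterm" | TNeg "'a rterm" | TMul "'a rterm" "'a rterm"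

datatype 'a oterm = OVar nat | OPar "'a set"

datatype 'a fm =
    FEq "'a rterm" "'a rterm" | FIn "'a rterm" "'a oterm"
  | FNot "'a fm" | FAnd "'a fm" "'a fm" | FOr "'a fm" "'a fm"
  | FEx nat "'a fm" | FExOpen nat "'a fm"

primrec tval :: "(nat \<Rightarrow> 'a::field) \<Rightarrow> 'a rterm \<Rightarrow> 'a" where
  "tval e (TVar i) = e i"
| "tval e (TPar c) = c"
| "tval e TZero = 0"
| "tval e TOne = 1"
| "tval e (TAdd s t) = tval e s + tval e t"
| "tval e (TNeg t) = - tval e t"
| "tval e (TMul s t) = tval e s * tval e t"

primrec oval :: "(nat \<Rightarrow> 'a set) \<Rightarrow> 'a oterm \<Rightarrow> 'a set" where
  "oval s (OVar i) = s i"
| "oval s (OPar U) = U"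

primrec sat :: "'a::field topology \<Rightarrow> (nat \<Rightarrow> 'a) \<Rightarrow> (nat \<Rightarrow> 'a set) \<Rightarrow> 'a fm \<Rightarrow> bool" where
  "sat \<tau> e s (FEq t u) \<longleftrightarrow> tval e t = tval e u"
| "sat \<tau> e s (FIn t U) \<longleftrightarrow> tval e t \<in> oval s U"
| "sat \<tau> e s (FNot \<phi>) \<longleftrightarrow> \<not> sat \<tau> e s \<phi>"
| "sat \<tau> e s (FAnd \<phi> \<psi>) \<longleftrightarrow> sat \<tau> e s \<phi> \<and> sat \<tau> e s \<psi>"
| "sat \<tau> e s (FOr \<phi> \<psi>) \<longleftrightarrow> sat \<tau> e s \<phi> \<or> sat \<tau> e s \<psi>"
| "sat \<tau> e s (FEx i \<phi>) \<longleftrightarrow> (\<exists>x. sat \<tau> (e(i := x)) s \<phi>)"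
| "sat \<tau> e s (FExOpen i \<phi>) \<longleftrightarrow> (\<exists>U. openin \<tau> U \<and> sat \<tau> e (s(i := U)) \<phi>)"

primrec tfree :: "'a rterm \<Rightarrow> nat set" where
  "tfree (TVar i) = {i}"
| "tfree (TPar c) = {}"
| "tfree TZero = {}"
| "tfree TOne = {}"
| "tfree (TAdd s t) = tfree s \<union> tfree t"
| "tfree (TNeg t) = tfree t"
| "tfree (TMul s t) = tfree s \<union> tfree t"

primrec ofree :: "'a oterm \<Rightarrow> nat set" where
  "ofree (OVar i) = {i}"
| "ofree (OPar U) = {}"

primrec free_vars :: "'a fm \<Rightarrow> nat set" where
  "free_vars (FEq t u) = tfree t \<union> tfree u"
| "free_vars (FIn t U) = tfree t"
| "free_vars (FNot \<phi>) = free_vars \<phi>"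
| "free_vars (FAnd \<phi> \<psi>) = free_vars \<phi> \<union> free_vars \<psi>"
| "free_vars (FOr \<phi> \<psi>) = free_vars \<phi> \<union> free_vars \<psi>"
| "free_vars (FEx i \<phi>) = free_vars \<phi> - {i}"
| "free_vars (FExOpen i \<phi>) = free_vars \<phi>"

primrec free_open_vars :: "'a fm \<Rightarrow> nat set" where
  "free_open_vars (FEq t u) = {}"
| "free_open_vars (FIn t U) = ofree U"
| "free_open_vars (FNot \<phi>) = free_open_vars \<phi>"
| "free_open_vars (FAnd \<phi> \<psi>) = free_open_vars \<phi> \<union> free_open_vars \<psi>"
| "free_open_vars (FOr \<phi> \<psi>) = free_open_vars \<phi> \<union> free_open_vars \<psi>"
| "free_open_vars (FEx i \<phi>) = free_open_vars \<phi>"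
| "free_open_vars (FExOpen i \<phi>) = free_open_vars \<phi> - {i}"

primrec tparams :: "'a rterm \<Rightarrow> 'a set" where
  "tparams (TVar i) = {}"
| "tparams (TPar c) = {c}"
| "tparams TZero = {}"
| "tparams TOne = {}"
| "tparams (TAdd s t) = tparams s \<union> tparams t"
| "tparams (TNeg t) = tparams t"
| "tparams (TMul s t) = tparams s \<union> tparams t"

primrec oparams :: "'a oterm \<Rightarrow> 'a set set" where
  "oparams (OVar i) = {}"
| "oparams (OPar U) = {U}"

primrec params :: "'a fm \<Rightarrow> 'a set" where
  "params (FEq t u) = tparams t \<union> tparams u"
| "params (FIn t U) = tparams t"
| "params (FNot \<phi>) = params \<phi>"
| "params (FAnd \<phi> \<psi>) = params \<phi> \<union> params \<psi>"
| "params (FOr \<phi> \<psi>) = params \<phi> \<union> params \<psi>"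
| "params (FEx i \<phi>) = params \<phi>"
| "params (FExOpen i \<phi>) = params \<phi>"

primrec open_params :: "'a fm \<Rightarrow> 'a set set" where
  "open_params (FEq t u) = {}"
| "open_params (FIn t U) = oparams U"
| "open_params (FNot \<phi>) = open_params \<phi>"
| "open_params (FAnd \<phi> \<psi>) = open_params \<phi> \<union> open_params \<psi>"
| "open_params (FOr \<phi> \<psi>) = open_params \<phi> \<union> open_params \<psi>"
| "open_params (FEx i \<phi>) = open_params \<phi>"
| "open_params (FExOpen i \<phi>) = open_params \<phi>"

text \<open>The quantifier-free and the (prenex) existential formulas of the language of rings: open
  sets do not occur in them.\<close>

primrec ring_qf :: "'a fm \<Rightarrow> bool" where
  "ring_qf (FEq t u) \<longleftrightarrow> True"
| "ring_qf (FIn t U) \<longleftrightarrow> False"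
| "ring_qf (FNot \<phi>) \<longleftrightarrow> ring_qf \<phi>"
| "ring_qf (FAnd \<phi> \<psi>) \<longleftrightarrow> ring_qf \<phi> \<and> ring_qf \<psi>"
| "ring_qf (FOr \<phi> \<psi>) \<longleftrightarrow> ring_qf \<phi> \<and> ring_qf \<psi>"
| "ring_qf (FEx i \<phi>) \<longleftrightarrow> False"
| "ring_qf (FExOpen i \<phi>) \<longleftrightarrow> False"

inductive ring_existential :: "'a fm \<Rightarrow> bool" where
  "ring_qf \<phi> \<Longrightarrow> ring_existential \<phi>"
| "ring_existential \<phi> \<Longrightarrow> ring_existential (FEx i \<phi>)"

text \<open>Values of variables that are not free are irrelevant; they are set to \<open>0\<close> and \<open>{}\<close>.\<close>

definition defines_set :: "'a::field topology \<Rightarrow> 'a fm \<Rightarrow> 'a set \<Rightarrow> bool" where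
  "defines_set \<tau> \<phi> A \<longleftrightarrow>
     free_vars \<phi> \<subseteq> {0} \<and> free_open_vars \<phi> = {} \<and> open_params \<phi> \<subseteq> {U. openin \<tau> U} \<and>
     A = {x. sat \<tau> ((\<lambda>_. 0)(0 := x)) (\<lambda>_. {}) \<phi>}"

definition defines_relation :: "'a::field topology \<Rightarrow> 'a fm \<Rightarrow> ('a \<times> 'a) set \<Rightarrow> bool" where
  "defines_relation \<tau> \<phi> R \<longleftrightarrow>
     free_vars \<phi> \<subseteq> {0, 1} \<and> free_open_vars \<phi> = {} \<and> open_params \<phi> \<subseteq> {U. openin \<tau> U} \<and>
     R = {(x, y). sat \<tau> ((\<lambda>_. 0)(0 := x, 1 := y)) (\<lambda>_. {}) \<phi>}"

definition existentially_defined :: "'a::field topology \<Rightarrow> 'a set \<Rightarrow> 'a set \<Rightarrow> bool" where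
  "existentially_defined \<tau> C A \<longleftrightarrow>
     (\<exists>\<phi>. ring_existential \<phi> \<and> params \<phi> \<subseteq> C \<and> defines_set \<tau> \<phi> A)"


section \<open>The alternatives of the dichotomy\<close>

definition interalgebraic :: "'a::field set \<Rightarrow> 'a \<Rightarrow> 'a \<Rightarrow> bool" where
  "interalgebraic E u w \<longleftrightarrow>
     algebraic_over (generated_subfield (E \<union> {w})) u \<and>
     algebraic_over (generated_subfield (E \<union> {u})) w"

definition zariski_open :: "'a::field set \<Rightarrow> bool" where
  "zariski_open W \<longleftrightarrow> (\<exists>P :: 'a poly set. W = {x. \<exists>q\<in>P. poly q x \<noteq> 0})"

definition finite_algebraic :: "'a::field set \<Rightarrow> 'a set \<Rightarrow> bool" where
  "finite_algebraic C A \<longleftrightarrow> finite A \<and> A \<subseteq> {x. algebraic_over (Lambda UNIV C) x}"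

text \<open>The graph of \<open>g\<close> restricted to \<open>U\<^sub>1 \<inter> W\<close> is definable by \<open>\<phi>\<close>; the formula may use both field
  elements and open sets as parameters, but only the field elements contribute to the base field
  over which interalgebraicity is required.\<close>

definition infinite_with_injection :: "'a::field topology \<Rightarrow> 'a set \<Rightarrow> 'a set \<Rightarrow> bool" where
  "infinite_with_injection \<tau> C A \<longleftrightarrow>
     infinite A \<and>
     (\<exists>U\<^sub>1 W g \<phi>.
        (\<exists>x N. openin \<tau> N \<and> x \<in> N \<and> N \<subseteq> U\<^sub>1) \<and>
        zariski_open W \<and> U\<^sub>1 \<inter> W \<noteq> {} \<and>
        inj_on g (U\<^sub>1 \<inter> W) \<and> g ` (U\<^sub>1 \<inter> W) \<subseteq> A \<and>
        defines_relation \<tau> \<phi> {(u, g u) |u. u \<in> U\<^sub>1 \<inter> W} \<and>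
        (\<forall>u\<in>U\<^sub>1 \<inter> W. interalgebraic (generated_subfield (C \<union> params \<phi>)) u (g u)))"

definition contains_open_powers :: "'a::field topology \<Rightarrow> 'a set \<Rightarrow> bool" where
  "contains_open_powers \<tau> A \<longleftrightarrow>
     (\<exists>m O'. openin \<tau> O' \<and> O' \<inter> K_pow m \<noteq> {} \<and> O' \<inter> K_pow m \<subseteq> A)"

definition exactly_one :: "bool \<Rightarrow> bool \<Rightarrow> bool" where
  "exactly_one P Q \<longleftrightarrow> (P \<or> Q) \<and> \<not> (P \<and> Q)"

end

theory Submission
  imports Defs
begin

text \<open>Let $F$ be $\Lambda_K C$ or, if $C \subseteq K^{(p^\infty)}$, the perfect closure of $C$ in $K$.
  If $A$ is infinite or contains an element that is not algebraic over $F$, then some ultrafilter on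
  the points witnessing membership in $A$ behaves like a point over an elementary extension of $K$
  whose first coordinate is transcendental over $F$. Since $K^p$ and $F$ are linearly disjoint over
  $F^p$, a polynomial relation over $F$ of minimal degree between the coordinates has a nonzero
  partial derivative. Hence a separating transcendence basis can be chosen among the coordinates, and
  the implicit function theorem yields a curve of points through almost every witness, along which one
  basis coordinate varies and every relation valid at the generic point persists. The first coordinate
  of the curve is the required injection. In the perfect case, $K^{p^m}$-rational values of the first
  coordinate come from parameters in $K$, because a simple root of a polynomial over $K^{p^m}$ lies in
  $K^{p^m}$.\<close>

section \<open>Linear disjointness and the operator $\Lambda$\<close>

text \<open>A transcendental point in an elementary extension would force the topology to be
  extended as well. With an ultrafilter, finitely many polynomial conditions that hold almost
  everywhere hold together at an actual witness \<open>x\<close> over K, and the implicit function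
  theorem is applied there.

  Separability is used in one place only: a relation whose exponents are all divisible by p must
  split into p-th powers of relations over F.

  The remaining obstacle is coordinate 0. If it is not in the basis, it is separable over the basis,
  but a basis coordinate may be inseparable over it. The exponent p^m is the largest power of p
  dividing all exponents of basis variables in the relation q, and i is a basis variable with an
  exponent that no higher power divides. In terms of T = X_i^(p^m) the derivative by T is nonzero,
  so X_0 and T are locally functions of each other. This m is the one in (ii'). Since m depends on
  q, the coefficients there have to be p^m-th powers for all m at once, which the perfect closure of
  C guarantees.\<close>

lemma is_subfieldD:
  assumes "is_subfield F"
  shows "0 \<in> F" "1 \<in> F" "\<And>x y. x \<in> F \<Longrightarrow> y \<in> F \<Longrightarrow> x + y \<in> F"
    "\<And>x y. x \<in> F \<Longrightarrow> y \<in> F \<Longrightarrow> x - y \<in> F" "\<And>x y. x \<in> F \<Longrightarrow> y \<in> F \<Longrightarrow> x * y \<in> F"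
    "\<And>x. x \<in> F \<Longrightarrow> inverse x \<in> F" "\<And>x. x \<in> F \<Longrightarrow> - x \<in> F"
    "\<And>x y. x \<in> F \<Longrightarrow> y \<in> F \<Longrightarrow> x / y \<in> F"
proof -
  show *: "0 \<in> F" "1 \<in> F" "\<And>x y. x \<in> F \<Longrightarrow> y \<in> F \<Longrightarrow> x + y \<in> F"
    "\<And>x y. x \<in> F \<Longrightarrow> y \<in> F \<Longrightarrow> x - y \<in> F" "\<And>x y. x \<in> F \<Longrightarrow> y \<in> F \<Longrightarrow> x * y \<in> F"
    "\<And>x. x \<in> F \<Longrightarrow> inverse x \<in> F"
    using assms unfolding is_subfield_def by blast+
  show "- x \<in> F" if "x \<in> F" for x using *(4)[OF *(1) that] by simp
  show "x / y \<in> F" if "x \<in> F" "y \<in> F" for x y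
    using *(5)[OF that(1) *(6)[OF that(2)]] by (simp add: divide_inverse)
qed

lemma is_subfield_sum:
  "is_subfield F \<Longrightarrow> (\<And>i. i \<in> I \<Longrightarrow> f i \<in> F) \<Longrightarrow> sum f I \<in> F"
  by (induction I rule: infinite_finite_induct) (auto intro: is_subfieldD)

lemma is_subfield_power: "is_subfield F \<Longrightarrow> x \<in> F \<Longrightarrow> x ^ n \<in> F"
  by (induction n) (auto intro: is_subfieldD)

lemma is_subfield_of_nat: "is_subfield F \<Longrightarrow> of_nat n \<in> F"
  by (induction n) (auto intro: is_subfieldD)

lemma is_subfield_prod:
  "is_subfield F \<Longrightarrow> (\<And>i. i \<in> I \<Longrightarrow> f i \<in> F) \<Longrightarrow> prod f I \<in> F"
  by (induction I rule: infinite_finite_induct) (auto intro: is_subfieldD)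

lemma is_subfield_Inter: "(\<And>F. F \<in> \<F> \<Longrightarrow> is_subfield F) \<Longrightarrow> is_subfield (\<Inter>\<F>)"
  unfolding is_subfield_def by blast

lemma is_subfield_generated: "is_subfield (generated_subfield S)"
  by (rule hull_in) (auto intro: is_subfield_Inter)

lemma is_subfield_UNIV [simp]: "is_subfield UNIV"
  by (simp add: is_subfield_def)

lemma is_subfield_image:
  fixes \<phi> :: "'a::field \<Rightarrow> 'b::field"
  assumes "is_subfield F" "\<phi> 0 = 0" "\<phi> 1 = 1" "\<And>x y. \<phi> (x + y) = \<phi> x + \<phi> y"
    "\<And>x y. \<phi> (x * y) = \<phi> x * \<phi> y"
  shows "is_subfield (\<phi> ` F)"
proof -
  have uminus: "\<phi> (- x) = - \<phi> x" for x
    using assms(4)[of x "- x"] assms(2) by (simp add: eq_neg_iff_add_eq_0 add.commute)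
  have "\<phi> x - \<phi> y = \<phi> (x - y)" for x y
    using assms(4)[of x "- y"] uminus by simp
  moreover have "inverse (\<phi> x) = \<phi> (inverse x)" for x
  proof (cases "x = 0")
    case False
    have "\<phi> x * \<phi> (inverse x) = 1"
      using False assms(3,5) by (metis right_inverse)
    then show ?thesis by (rule inverse_unique)
  qed (simp add: assms(2))
  ultimately show ?thesis
    using is_subfieldD[OF assms(1)] assms(2-5) unfolding is_subfield_def
    by (auto simp: assms(4,5)[symmetric] intro: rev_image_eqI)
qed

section \<open>Linear independence, finite bases and linear disjointness\<close>

lemma lin_indep_overI:
  assumes "\<And>T c. finite T \<Longrightarrow> T \<subseteq> S \<Longrightarrow> (\<forall>t\<in>T. c t \<in> E) \<Longrightarrow> (\<Sum>t\<in>T. c t * t) = 0 \<Longrightarrow>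
    (\<forall>t\<in>T. c t = 0)"
  shows "lin_indep_over E S"
  unfolding lin_indep_over_def image_subset_iff by (intro allI impI assms) auto

lemma lin_indep_overD:
  assumes "lin_indep_over E S" "finite T" "T \<subseteq> S" "\<And>t. t \<in> T \<Longrightarrow> c t \<in> E"
    "(\<Sum>t\<in>T. c t * t) = 0" "t \<in> T"
  shows "c t = 0"
  using assms(1)[unfolded lin_indep_over_def, rule_format, of T c t] assms(2-) by auto

lemma lin_indep_over_finiteI:
  assumes "0 \<in> E" "finite S"
    and *: "\<And>c. (\<forall>t\<in>S. c t \<in> E) \<Longrightarrow> (\<Sum>t\<in>S. c t * t) = 0 \<Longrightarrow> (\<forall>t\<in>S. c t = 0)"
  shows "lin_indep_over E S"
proof (rule lin_indep_overI)
  fix T c assume T: "finite T" "T \<subseteq> S" "\<forall>t\<in>T. c t \<in> E" "(\<Sum>t\<in>T. c t * t) = 0"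
  define d where "d t = (if t \<in> T then c t else 0)" for t
  have "(\<Sum>t\<in>S. d t * t) = (\<Sum>t\<in>T. c t * t)"
    using T \<open>finite S\<close> by (intro sum.mono_neutral_cong_right) (auto simp: d_def)
  moreover have "\<forall>t\<in>S. d t \<in> E" using T assms(1) by (auto simp: d_def)
  ultimately have d0: "\<forall>t\<in>S. d t = 0" using T(4) by (intro *) simp_all
  show "\<forall>t\<in>T. c t = 0"
  proof
    fix t assume "t \<in> T"
    then show "c t = 0" using bspec[OF d0, of t] T(2) by (simp add: d_def subset_iff)
  qed
qed

lemma lin_indep_over_subset: "lin_indep_over E S \<Longrightarrow> T \<subseteq> S \<Longrightarrow> lin_indep_over E T"
  unfolding lin_indep_over_def by blast

lemma lin_indep_over_antimono: "lin_indep_over E S \<Longrightarrow> D \<subseteq> E \<Longrightarrow> lin_indep_over D S"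
  unfolding lin_indep_over_def by (meson subset_trans)

definition span_over :: "'a::field set \<Rightarrow> 'a set \<Rightarrow> 'a set" where
  "span_over E T = {s. \<exists>c. (\<forall>t\<in>T. c t \<in> E) \<and> s = (\<Sum>t\<in>T. c t * t)}"

lemma span_overE:
  assumes "s \<in> span_over E T"
  obtains c where "\<And>t. t \<in> T \<Longrightarrow> c t \<in> E" "s = (\<Sum>t\<in>T. c t * t)"
  using assms unfolding span_over_def by auto

lemma span_overI: "(\<And>t. t \<in> T \<Longrightarrow> c t \<in> E) \<Longrightarrow> s = (\<Sum>t\<in>T. c t * t) \<Longrightarrow> s \<in> span_over E T"
  unfolding span_over_def by auto

lemma span_over_dependent:
  assumes E: "is_subfield E" and T: "finite T" "s \<notin> T" and "s \<in> span_over E T"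
  shows "\<not> lin_indep_over E (insert s T)"
proof
  assume ind: "lin_indep_over E (insert s T)"
  obtain c where c: "\<And>t. t \<in> T \<Longrightarrow> c t \<in> E" "s = (\<Sum>t\<in>T. c t * t)"
    using assms(4) by (rule span_overE) blast
  define d where "d = c(s := -1)"
  have "(\<Sum>t\<in>T. d t * t) = (\<Sum>t\<in>T. c t * t)"
    using T by (intro sum.cong) (auto simp: d_def)
  then have "(\<Sum>t\<in>insert s T. d t * t) = 0" using T c(2) by (simp add: d_def)
  moreover have "d t \<in> E" if "t \<in> insert s T" for t
    using that c(1) is_subfieldD(2,7)[OF E] by (auto simp: d_def)
  ultimately have "d s = 0" using T by (intro lin_indep_overD[OF ind, of "insert s T" d]) auto
  then show False by (simp add: d_def)
qed

lemma lin_indep_over_insert: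
  assumes E: "is_subfield E" and T: "finite T" "lin_indep_over E T" "s \<notin> T"
    and ns: "s \<notin> span_over E T"
  shows "lin_indep_over E (insert s T)"
proof -
  note E' = is_subfieldD[OF E]
  show ?thesis
  proof (rule lin_indep_over_finiteI)
    fix c assume c: "\<forall>t\<in>insert s T. c t \<in> E" "(\<Sum>t\<in>insert s T. c t * t) = 0"
    then have sum: "c s * s + (\<Sum>t\<in>T. c t * t) = 0" using T by simp
    have "c s = 0"
    proof (rule ccontr)
      assume "c s \<noteq> 0"
      have "s = inverse (c s) * (c s * s)" using \<open>c s \<noteq> 0\<close> by simp
      also have "c s * s = - (\<Sum>t\<in>T. c t * t)" using sum by (simp add: eq_neg_iff_add_eq_0)
      also have "inverse (c s) * \<dots> = (\<Sum>t\<in>T. (- inverse (c s) * c t) * t)"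
        by (simp add: sum_distrib_left sum_negf mult.assoc)
      finally have "s \<in> span_over E T"
        using c(1) E'(5,6,7) by (intro span_overI[of T "\<lambda>t. - inverse (c s) * c t"]) auto
      then show False using ns by simp
    qed
    moreover from this have "c t = 0" if "t \<in> T" for t
      using sum c that T by (intro lin_indep_overD[OF T(2), of T c]) auto
    ultimately show "\<forall>t\<in>insert s T. c t = 0" by simp
  qed (use T E' in auto)
qed

lemma finite_basis:
  assumes E: "is_subfield E" and "finite S"
  obtains T where "T \<subseteq> S" "lin_indep_over E T" "S \<subseteq> span_over E T"
proof -
  note E' = is_subfieldD[OF E]
  have "\<exists>T\<subseteq>S. lin_indep_over E T \<and> S \<subseteq> span_over E T"
    using \<open>finite S\<close>
  proof induction
    case empty
    show ?case by (auto simp: lin_indep_over_def)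
  next
    case (insert s S)
    obtain T where T: "T \<subseteq> S" "lin_indep_over E T" "S \<subseteq> span_over E T"
      using insert.IH by blast
    have "finite T" using T(1) insert.hyps(1) by (rule finite_subset)
    show ?case
    proof (cases "s \<in> span_over E T")
      case True
      then show ?thesis using T by (intro exI[of _ T]) auto
    next
      case False
      have "s \<notin> T" using T insert.hyps by blast
      have "s \<in> span_over E (insert s T)"
        using \<open>s \<notin> T\<close> \<open>finite T\<close> E'
        by (intro span_overI[of _ "\<lambda>t. if t = s then 1 else 0"])
          (auto simp: if_distrib[of "\<lambda>c. c * _"] cong: if_cong)
      moreover have "x \<in> span_over E (insert s T)" if "x \<in> span_over E T" for x
        using that
      proof (rule span_overE)
        fix c assume c: "\<And>t. t \<in> T \<Longrightarrow> c t \<in> E" "x = (\<Sum>t\<in>T. c t * t)"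
        have "(\<Sum>t\<in>T. c t * t) = (\<Sum>t\<in>T. (c(s := 0)) t * t)"
          using \<open>s \<notin> T\<close> by (intro sum.cong) auto
        then show ?thesis using c \<open>s \<notin> T\<close> \<open>finite T\<close> E'
          by (intro span_overI[of _ "c(s := 0)"]) auto
      qed
      ultimately have "insert s S \<subseteq> span_over E (insert s T)" using T(3) by blast
      then show ?thesis
        using lin_indep_over_insert[OF E \<open>finite T\<close> T(2) \<open>s \<notin> T\<close> False] T(1)
        by (intro exI[of _ "insert s T"]) auto
    qed
  qed
  then show thesis using that by blast
qed

lemma linearly_disjointI:
  assumes "\<And>S. finite S \<Longrightarrow> S \<subseteq> F \<Longrightarrow> lin_indep_over E S \<Longrightarrow> lin_indep_over L S"
  shows "linearly_disjoint E F L"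
  unfolding linearly_disjoint_def
proof (intro allI impI)
  fix S assume S: "S \<subseteq> F" "lin_indep_over E S"
  have L: "lin_indep_over L T" if "finite T" "T \<subseteq> S" for T
    using assms[of T] S that lin_indep_over_subset by blast
  show "lin_indep_over L S"
  proof (rule lin_indep_overI, intro ballI)
    fix T c t
    assume "finite T" "T \<subseteq> S" "\<forall>t\<in>T. c t \<in> L" "(\<Sum>t\<in>T. c t * t) = 0" "t \<in> T"
    then show "c t = 0" using lin_indep_overD[OF L, of T T c t] by auto
  qed
qed

text \<open>In a relation on \<open>S\<close> over \<open>F\<close>, expand the coefficients in an
  \<open>E\<close>-basis \<open>T\<close> of their span. Reordering gives a relation on
  \<open>T\<close> over \<open>L\<close>, whose coefficients vanish by disjointness; these
  coefficients are relations on \<open>S\<close> over \<open>E\<close>.\<close>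

lemma linearly_disjoint_commute_aux:
  assumes E: "is_subfield E" and F: "is_subfield F" and L: "is_subfield L"
    and sub: "E \<subseteq> F" "E \<subseteq> L" and ld: "linearly_disjoint E F L"
  shows "linearly_disjoint E L F"
proof (rule linearly_disjointI)
  fix S assume S: "finite S" "S \<subseteq> L" "lin_indep_over E S"
  show "lin_indep_over F S"
  proof (rule lin_indep_over_finiteI)
    fix a assume a: "\<forall>s\<in>S. a s \<in> F" "(\<Sum>s\<in>S. a s * s) = 0"
    obtain T where T: "T \<subseteq> a ` S" "lin_indep_over E T" "a ` S \<subseteq> span_over E T"
      using finite_basis[OF E, of "a ` S"] S(1) by auto
    have "\<exists>e. (\<forall>t\<in>T. e t \<in> E) \<and> a s = (\<Sum>t\<in>T. e t * t)" if "s \<in> S" for s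
      using T(3) that unfolding span_over_def by blast
    then obtain e where e: "\<And>s t. s \<in> S \<Longrightarrow> t \<in> T \<Longrightarrow> e s t \<in> E"
      "\<And>s. s \<in> S \<Longrightarrow> a s = (\<Sum>t\<in>T. e s t * t)"
      by metis
    have finT: "finite T" using T(1) S(1) by (meson finite_imageI finite_subset)
    have TF: "T \<subseteq> F" using T(1) a(1) by auto
    have LT: "lin_indep_over L T" using ld T(2) TF unfolding linearly_disjoint_def by blast
    define d where "d t = (\<Sum>s\<in>S. e s t * s)" for t
    have "(\<Sum>t\<in>T. d t * t) = (\<Sum>s\<in>S. \<Sum>t\<in>T. e s t * s * t)"
      unfolding d_def by (subst sum.swap) (simp add: sum_distrib_right)
    also have "\<dots> = (\<Sum>s\<in>S. a s * s)"
    proof (rule sum.cong)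
      show "(\<Sum>t\<in>T. e s t * s * t) = a s * s" if "s \<in> S" for s
        unfolding e(2)[OF that] sum_distrib_right by (simp add: mult_ac)
    qed simp
    also have "\<dots> = 0" by fact
    finally have "(\<Sum>t\<in>T. d t * t) = 0" .
    moreover have "d t \<in> L" if "t \<in> T" for t
      unfolding d_def using e(1) sub S(2) that
      by (intro is_subfield_sum[OF L] is_subfieldD(5)[OF L]) auto
    ultimately have d0: "d t = 0" if "t \<in> T" for t
      using that finT by (intro lin_indep_overD[OF LT, of T d]) auto
    have "e s t = 0" if "t \<in> T" "s \<in> S" for s t
      using d0[OF that(1)] e(1) that S(1) unfolding d_def
      by (intro lin_indep_overD[OF S(3), of S "\<lambda>s. e s t"]) auto
    then show "\<forall>s\<in>S. a s = 0" using e(2) by simp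
  qed (use S is_subfieldD[OF F] in auto)
qed

lemma linearly_disjoint_commute:
  assumes "is_subfield E" "is_subfield F" "is_subfield L" "E \<subseteq> F" "E \<subseteq> L"
  shows "linearly_disjoint E F L \<longleftrightarrow> linearly_disjoint E L F"
  using linearly_disjoint_commute_aux assms by blast

text \<open>An injective homomorphism transports relations in both directions. It is applied to the
  Frobenius map of the algebraic closure and to \<open>to_ac\<close>.\<close>

lemma linearly_disjoint_image:
  fixes \<phi> :: "'a::field \<Rightarrow> 'b::field"
  assumes inj: "inj \<phi>" and "\<phi> 0 = 0" and "\<And>x y. \<phi> (x + y) = \<phi> x + \<phi> y"
    and "\<And>x y. \<phi> (x * y) = \<phi> x * \<phi> y"
  shows "linearly_disjoint (\<phi> ` E) (\<phi> ` F) (\<phi> ` L) \<longleftrightarrow> linearly_disjoint E F L"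
proof -
  have sum: "\<phi> (sum f A) = (\<Sum>x\<in>A. \<phi> (f x))" for f and A :: "'a set"
    by (induction A rule: infinite_finite_induct) (auto simp: assms)
  have ind: "lin_indep_over (\<phi> ` E) (\<phi> ` S) \<longleftrightarrow> lin_indep_over E S" for E S
  proof
    assume L: "lin_indep_over (\<phi> ` E) (\<phi> ` S)"
    show "lin_indep_over E S"
    proof (rule lin_indep_overI, intro ballI)
      fix T c t
      assume T: "finite T" "T \<subseteq> S" "\<forall>t\<in>T. c t \<in> E" "(\<Sum>t\<in>T. c t * t) = 0" "t \<in> T"
      define c' where "c' t = \<phi> (c (inv_into UNIV \<phi> t))" for t
      have c': "c' (\<phi> t) = \<phi> (c t)" for t using inj by (simp add: c'_def)
      have "(\<Sum>t\<in>\<phi> ` T. c' t * t) = (\<Sum>t\<in>T. \<phi> (c t) * \<phi> t)"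
        using inj by (subst sum.reindex) (auto simp: c' intro: inj_on_subset)
      also have "\<dots> = \<phi> (\<Sum>t\<in>T. c t * t)" by (simp add: sum assms(4))
      also have "\<dots> = 0" using T(4) assms(2) by simp
      finally have "(\<Sum>t\<in>\<phi> ` T. c' t * t) = 0" .
      then have "c' (\<phi> t) = 0"
        using T by (intro lin_indep_overD[OF L, of "\<phi> ` T" c']) (auto simp: c')
      then have "\<phi> (c t) = \<phi> 0" using c' assms(2) by simp
      then show "c t = 0" using inj by (simp add: inj_eq)
    qed
  next
    assume R: "lin_indep_over E S"
    show "lin_indep_over (\<phi> ` E) (\<phi> ` S)"
    proof (rule lin_indep_overI, intro ballI)
      fix T' c t'
      assume T': "finite T'" "T' \<subseteq> \<phi> ` S" "\<forall>t\<in>T'. c t \<in> \<phi> ` E" "(\<Sum>t\<in>T'. c t * t) = 0" "t' \<in> T'"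
      obtain T where T: "T \<subseteq> S" "T' = \<phi> ` T" using T'(2) by (auto simp: subset_image_iff)
      obtain t where t: "t \<in> T" "t' = \<phi> t" using T' T by auto
      have fin: "finite T" using T'(1) T(2) inj finite_imageD inj_on_subset by blast
      have "\<exists>d. \<forall>t\<in>T. \<phi> (d t) = c (\<phi> t) \<and> d t \<in> E"
        by (rule bchoice) (use T' T in \<open>force simp: image_iff\<close>)
      then obtain d where d: "\<And>t. t \<in> T \<Longrightarrow> \<phi> (d t) = c (\<phi> t)" "\<And>t. t \<in> T \<Longrightarrow> d t \<in> E" by blast
      have "(\<Sum>t\<in>T'. c t * t) = (\<Sum>t\<in>T. c (\<phi> t) * \<phi> t)"
        unfolding T(2) using inj by (subst sum.reindex) (auto intro: inj_on_subset)
      also have "\<dots> = \<phi> (\<Sum>t\<in>T. d t * t)" by (simp add: sum assms(4) d)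
      finally have "\<phi> (\<Sum>t\<in>T. d t * t) = \<phi> 0" using T'(4) assms(2) by simp
      then have "(\<Sum>t\<in>T. d t * t) = 0" using inj by (simp add: inj_eq)
      then have "d t = 0" using d(2) fin T(1) t by (intro lin_indep_overD[OF R, of T d]) auto
      then show "c t' = 0" using d(1)[OF t(1)] t(2) assms(2) by simp
    qed
  qed
  show ?thesis
    unfolding linearly_disjoint_def by (simp add: all_subset_image ind)
qed

section \<open>Frobenius maps, separability and the existence of the least separable
  subfield\<close>

definition frob :: "nat \<Rightarrow> 'a::field \<Rightarrow> 'a" where
  "frob m x = x ^ (char_exponent TYPE('a) ^ m)"

lemma CHAR_cases: "CHAR('a::field) = 0 \<or> Factorial_Ring.prime CHAR('a)"
  using prime_CHAR_semidom[where 'a='a] by auto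

lemma char_exponent_pos: "char_exponent TYPE('a::field) > 0"
  by (auto simp: char_exponent_def)

lemma frob_add: "frob m (x + y :: 'a::field) = frob m x + frob m y"
  using CHAR_cases[where 'a='a] by (auto simp: frob_def char_exponent_def freshmans_dream')

lemma frob_mult: "frob m (x * y :: 'a::field) = frob m x * frob m y"
  by (simp add: frob_def power_mult_distrib)

lemma frob_0 [simp]: "frob m (0 :: 'a::field) = 0"
  by (simp add: frob_def char_exponent_pos)

lemma frob_1 [simp]: "frob m (1 :: 'a::field) = 1"
  by (simp add: frob_def)

lemma frob_eq_0_iff [simp]: "frob m (x :: 'a::field) = 0 \<longleftrightarrow> x = 0"
  by (simp add: frob_def char_exponent_pos)

lemma frob_uminus: "frob m (- x :: 'a::field) = - frob m x"
  using frob_add[of m x "- x"] by (simp add: eq_neg_iff_add_eq_0 add.commute)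

lemma frob_diff: "frob m (x - y :: 'a::field) = frob m x - frob m y"
  using frob_add[of m x "- y"] by (simp add: frob_uminus)

lemma inj_frob: "inj (frob m :: 'a::field \<Rightarrow> 'a)"
proof (rule injI)
  fix x y :: 'a assume "frob m x = frob m y"
  then have "frob m (x - y) = 0" by (simp add: frob_diff)
  then show "x = y" by simp
qed

lemma frob_sum: "frob m (sum f A :: 'a::field) = (\<Sum>x\<in>A. frob m (f x))"
  by (induction A rule: infinite_finite_induct) (auto simp: frob_add)

lemma frob_power: "frob m (x ^ n :: 'a::field) = frob m x ^ n"
  by (simp add: frob_def flip: power_mult) (simp add: mult.commute)

lemma frob_frob: "frob m (frob n x :: 'a::field) = frob (m + n) x"
  by (simp add: frob_def power_add mult.commute flip: power_mult)

lemma is_subfield_frob: "is_subfield F \<Longrightarrow> is_subfield (frob m ` F)"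
  by (rule is_subfield_image) (auto simp: frob_add frob_mult)

lemma K_pow_eq: "K_pow m = range (frob m)"
  by (auto simp: K_pow_def frob_def)

definition p_disjoint :: "'a::field set \<Rightarrow> bool" where
  "p_disjoint F \<longleftrightarrow> linearly_disjoint (frob 1 ` F) F (range (frob 1))"

lemma frob_subset: "is_subfield F \<Longrightarrow> frob m ` F \<subseteq> F"
  by (auto simp: frob_def is_subfield_power)

text \<open>Linear disjointness of $K$ and $E^{1/p}$ over $E$ becomes linear disjointness of $K^p$ and
  $E$ over $E^p$ under the Frobenius map of the algebraic closure, so that no roots occur.\<close>

lemma separable_extension_iff:
  assumes E: "is_subfield (E :: 'a::field set)"
  shows "separable_extension UNIV E \<longleftrightarrow> p_disjoint E"
proof -
  have to: "is_subfield (to_ac ` F)" if "is_subfield F" for F :: "'a set"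
    using that by (rule is_subfield_image) auto
  have ce: "char_exponent TYPE('a alg_closure) = char_exponent TYPE('a)"
    by (simp add: char_exponent_def)
  have toP: "frob 1 ` to_ac ` F = to_ac ` frob 1 ` F" for F :: "'a set"
    by (auto simp: frob_def ce image_iff)
  have root: "\<exists>z :: 'a alg_closure. frob 1 z = y" for y
    using nth_root_exists[of "char_exponent TYPE('a)" y] char_exponent_pos[where 'a='a]
    by (auto simp: frob_def ce)
  have roots: "frob 1 ` p_roots E = to_ac ` E"
  proof
    show "frob 1 ` p_roots E \<subseteq> to_ac ` E" by (auto simp: p_roots_def frob_def ce)
    show "to_ac ` E \<subseteq> frob 1 ` p_roots E"
    proof
      fix y assume y: "y \<in> to_ac ` E"
      obtain z where "frob 1 z = y" using root by blast
      then show "y \<in> frob 1 ` p_roots E" using y by (auto simp: p_roots_def frob_def ce)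
    qed
  qed
  have sub: "to_ac ` E \<subseteq> p_roots E"
    using is_subfield_power[OF E] by (auto simp: p_roots_def simp flip: to_ac_power)
  have "is_subfield (p_roots E)"
  proof -
    have e: "z \<in> p_roots E \<longleftrightarrow> frob 1 z \<in> to_ac ` E" for z
      by (simp add: p_roots_def frob_def ce)
    note s = is_subfieldD[OF to[OF E]]
    have "frob 1 (inverse z) = inverse (frob 1 z)" for z :: "'a alg_closure"
      by (simp add: frob_def power_inverse)
    then show ?thesis
      unfolding is_subfield_def by (simp only: e frob_add frob_diff frob_mult frob_0 frob_1 s
        simp_thms ball_simps) (use s in \<open>simp add: Ball_def e\<close>)
  qed
  then have "separable_extension UNIV E \<longleftrightarrow>
      linearly_disjoint (to_ac ` E) (p_roots E) (to_ac ` UNIV)"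
    unfolding separable_extension_def
    by (intro linearly_disjoint_commute to E sub) auto
  also have "\<dots> \<longleftrightarrow> linearly_disjoint (frob 1 ` to_ac ` E) (frob 1 ` p_roots E) (frob 1 ` to_ac ` UNIV)"
    by (rule linearly_disjoint_image[symmetric]) (auto simp: inj_frob frob_add frob_mult)
  also have "\<dots> \<longleftrightarrow> linearly_disjoint (to_ac ` frob 1 ` E) (to_ac ` E) (to_ac ` range (frob 1))"
    by (simp only: roots toP)
  also have "\<dots> \<longleftrightarrow> p_disjoint E"
    unfolding p_disjoint_def by (rule linearly_disjoint_image) (auto simp: inj_to_ac)
  finally show ?thesis .
qed

text \<open>The coefficients expressing an element in terms of a basis over $K^p$ are unique, hence
  they lie in $E^p$ for every member $E$ of the family.\<close>

lemma p_disjoint_Inter: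
  assumes ne: "\<E> \<noteq> {}" and sf: "\<And>E. E \<in> \<E> \<Longrightarrow> is_subfield E"
    and pd: "\<And>E. E \<in> \<E> \<Longrightarrow> p_disjoint E"
  shows "p_disjoint (\<Inter>\<E>)"
  unfolding p_disjoint_def
proof (rule linearly_disjointI)
  fix S assume S: "finite S" "S \<subseteq> \<Inter>\<E>" "lin_indep_over (frob 1 ` \<Inter>\<E>) S"
  let ?P = "range (frob 1) :: 'a set"
  have P: "is_subfield ?P" by (simp add: is_subfield_frob)
  obtain T where T: "T \<subseteq> S" "lin_indep_over ?P T" "S \<subseteq> span_over ?P T"
    using finite_basis[OF P S(1)] by blast
  have finT: "finite T" using T(1) S(1) finite_subset by blast
  \<comment> \<open>\<open>T\<close> spans \<open>S\<close> over K^p. An element of \<open>S\<close>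
    outside \<open>T\<close> would be a combination of \<open>T\<close> over K^p, hence over the
    p-th powers of the intersection, against the independence of \<open>S\<close>.\<close>
  have "S \<subseteq> T"
  proof (rule ccontr)
    assume "\<not> S \<subseteq> T"
    then obtain s where s: "s \<in> S" "s \<notin> T" by blast
    then have sT: "s \<in> span_over ?P T" using T(3) by blast
    then obtain c where c: "\<And>t. t \<in> T \<Longrightarrow> c t \<in> ?P" "s = (\<Sum>t\<in>T. c t * t)"
      by (rule span_overE) blast
    have cE: "c t \<in> frob 1 ` E" if "E \<in> \<E>" "t \<in> T" for E t
    proof -
      have E: "is_subfield (frob 1 ` E)" using is_subfield_frob[OF sf[OF that(1)]] .
      have "insert s T \<subseteq> E" using S(2) T(1) s that by auto
      then have "\<not> lin_indep_over (frob 1 ` E) (insert s T)"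
        using pd[OF that(1)] span_over_dependent[OF P finT s(2) sT]
        unfolding p_disjoint_def linearly_disjoint_def by blast
      moreover have "lin_indep_over (frob 1 ` E) T"
        using T(2) by (rule lin_indep_over_antimono) auto
      ultimately have "s \<in> span_over (frob 1 ` E) T"
        using lin_indep_over_insert[OF E finT _ s(2)] by blast
      then obtain d where d: "\<And>t. t \<in> T \<Longrightarrow> d t \<in> frob 1 ` E" "s = (\<Sum>t\<in>T. d t * t)"
        by (rule span_overE) blast
      have "(\<Sum>t\<in>T. (c t - d t) * t) = 0" using c d by (simp add: left_diff_distrib sum_subtractf)
      moreover have "c t - d t \<in> ?P" if "t \<in> T" for t
        using c(1)[OF that] d(1)[OF that] by (intro is_subfieldD(4)[OF P]) auto
      ultimately have "c t - d t = 0"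
        using finT that by (intro lin_indep_overD[OF T(2), of T "\<lambda>t. c t - d t"]) auto
      then show ?thesis using d(1)[OF that(2)] by simp
    qed
    \<comment> \<open>Frobenius is injective, so all members of the family contain the same p-th
      root of \<open>c t\<close>.\<close>
    have "c t \<in> frob 1 ` \<Inter>\<E>" if "t \<in> T" for t
    proof -
      obtain z where z: "c t = frob 1 z" using c(1)[OF \<open>t \<in> T\<close>] by blast
      have "z \<in> E" if "E \<in> \<E>" for E
        using cE[OF that \<open>t \<in> T\<close>] z inj_frob[of 1, where 'a='a] by (auto simp: inj_eq)
      then show ?thesis using z by blast
    qed
    then have "s \<in> span_over (frob 1 ` \<Inter>\<E>) T" using c(2) by (intro span_overI[of T c]) auto
    moreover have "is_subfield (frob 1 ` \<Inter>\<E>)" using sf by (intro is_subfield_frob is_subfield_Inter)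
    ultimately have "\<not> lin_indep_over (frob 1 ` \<Inter>\<E>) (insert s T)"
      using span_over_dependent finT s(2) by blast
    moreover have "insert s T \<subseteq> S" using s T by blast
    ultimately show False using S(3) lin_indep_over_subset by blast
  qed
  then show "lin_indep_over ?P S" using T(1,2) by (simp add: subset_antisym)
qed

lemma p_disjoint_UNIV: "p_disjoint UNIV"
  by (simp add: p_disjoint_def linearly_disjoint_def)

text \<open>Separable subfields above \<open>C\<close> are closed under intersection and include
  \<open>UNIV\<close>, so the \<open>LEAST\<close> in \<open>Lambda\<close> is attained by their
  intersection.\<close>

lemma Lambda_UNIV:
  assumes C: "is_subfield C"
  shows "is_subfield (Lambda UNIV C)" "C \<subseteq> Lambda UNIV C" "p_disjoint (Lambda UNIV C)"
proof -
  define \<E> where "\<E> = {E. is_subfield E \<and> C \<subseteq> E \<and> p_disjoint E}"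
  have "UNIV \<in> \<E>" by (auto simp: \<E>_def p_disjoint_UNIV)
  then have "\<E> \<noteq> {}" by blast
  then have *: "is_subfield (\<Inter>\<E>)" "C \<subseteq> \<Inter>\<E>" "p_disjoint (\<Inter>\<E>)"
    by (intro is_subfield_Inter p_disjoint_Inter Inter_greatest; simp add: \<E>_def)+
  have "Lambda UNIV C = \<Inter>\<E>"
    unfolding Lambda_def
  proof (rule Least_equality)
    show "is_subfield (\<Inter>\<E>) \<and> C \<subseteq> \<Inter>\<E> \<and> \<Inter>\<E> \<subseteq> UNIV \<and> separable_extension UNIV (\<Inter>\<E>)"
      using * by (simp add: separable_extension_iff)
    show "\<Inter>\<E> \<le> E" if "is_subfield E \<and> C \<subseteq> E \<and> E \<subseteq> UNIV \<and> separable_extension UNIV E" for E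
      using that separable_extension_iff[of E] by (auto simp: \<E>_def)
  qed
  then show "is_subfield (Lambda UNIV C)" "C \<subseteq> Lambda UNIV C" "p_disjoint (Lambda UNIV C)"
    using * by simp_all
qed

section \<open>The perfect closure inside the ground field\<close>

definition perfect_closure_in :: "'a::field set \<Rightarrow> 'a set" where
  "perfect_closure_in C = {x. \<exists>n. frob n x \<in> C}"

text \<open>If \<open>frob n x\<close> is in \<open>C\<close>, it is also a p^(n+m)-th power, and
  injectivity of \<open>frob n\<close> makes \<open>x\<close> a p^m-th power of an element that is
  again in the closure. So the closure equals its own field of p-th powers, and disjointness is only
  asked over that field.\<close>

lemma perfect_closure_in_props:
  assumes C: "is_subfield C" and inf: "C \<subseteq> K_pow_inf"
  shows "is_subfield (perfect_closure_in C)" "C \<subseteq> perfect_closure_in C"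
    "p_disjoint (perfect_closure_in C)" "perfect_closure_in C \<subseteq> K_pow m"
proof -
  let ?D = "perfect_closure_in C"
  note C' = is_subfieldD[OF C]
  have up: "frob (m + n) x \<in> C" if "frob n x \<in> C" for m n x
    using that is_subfield_power[OF C] by (simp flip: frob_frob) (simp add: frob_def[of m])
  have two: "\<exists>n. frob n x \<in> C \<and> frob n y \<in> C" if xy: "x \<in> ?D" "y \<in> ?D" for x y
  proof -
    obtain k l where "frob k x \<in> C" "frob l y \<in> C"
      using xy unfolding perfect_closure_in_def by auto
    then have "frob (k + l) x \<in> C" "frob (k + l) y \<in> C"
      using up[of k x l] up[of l y k] by (simp_all add: add.commute)
    then show ?thesis by blast
  qed
  show D: "is_subfield ?D"
    unfolding is_subfield_def
  proof (intro conjI ballI)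
    show "0 \<in> ?D" "1 \<in> ?D" using C' by (auto simp: perfect_closure_in_def)
    fix x y assume xy: "x \<in> ?D" "y \<in> ?D"
    then obtain n where n: "frob n x \<in> C" "frob n y \<in> C" using two by blast
    then show "x + y \<in> ?D" "x - y \<in> ?D" "x * y \<in> ?D"
      using C' unfolding perfect_closure_in_def
      by (auto simp: frob_add frob_diff frob_mult intro!: exI[of _ n])
  next
    fix x assume "x \<in> ?D"
    then show "inverse x \<in> ?D" using C'(6)
      by (auto simp: perfect_closure_in_def frob_def power_inverse)
  qed
  show "C \<subseteq> ?D" unfolding perfect_closure_in_def
    by (auto intro!: exI[of _ 0] simp: frob_def)
  have root: "\<exists>z\<in>?D. x = frob m z" if "x \<in> ?D" for x m
  proof -
    obtain n where n: "frob n x \<in> C" using \<open>x \<in> ?D\<close> by (auto simp: perfect_closure_in_def)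
    then have "frob n x \<in> K_pow (n + m)" using inf by (auto simp: K_pow_inf_def)
    then obtain z where z: "frob n x = frob n (frob m z)" by (auto simp: K_pow_eq frob_frob)
    then have "x = frob m z" using inj_frob by (auto dest: injD)
    moreover have "z \<in> ?D" using n z unfolding perfect_closure_in_def by (auto simp: frob_frob)
    ultimately show ?thesis by blast
  qed
  show "?D \<subseteq> K_pow m" using root[of _ m] by (auto simp: K_pow_eq)
  have eq: "frob 1 ` ?D = ?D" using root[of _ 1] frob_subset[OF D] by blast
  show "p_disjoint ?D" unfolding p_disjoint_def eq
  proof (rule linearly_disjointI)
    fix S assume S: "finite S" "S \<subseteq> ?D" "lin_indep_over ?D S"
    have "is_subfield (range (frob 1) :: 'a set)" by (simp add: is_subfield_frob)
    note zero = is_subfieldD(1)[OF this] is_subfieldD[OF D]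
    have ne: "s \<noteq> 0" if "s \<in> S" for s
      using lin_indep_overD[OF S(3), of "{s}" "\<lambda>_. 1" s] that zero by auto
    \<comment> \<open>Distinct elements of \<open>S\<close> satisfy t * s - s * t = 0 with
      coefficients in the field itself, so an independent set has at most one element.\<close>
    have "s = t" if "s \<in> S" "t \<in> S" for s t
    proof (rule ccontr)
      assume "s \<noteq> t"
      then have "(if s = s then t else - s) = 0"
        using lin_indep_overD[OF S(3), of "{s, t}" "\<lambda>x. if x = s then t else - s" s]
          that zero S(2) by (auto simp: subset_iff mult.commute)
      then show False using ne[OF that(2)] by simp
    qed
    then have "S = {} \<or> (\<exists>s. S = {s})" by blast
    then show "lin_indep_over (range (frob 1)) S"
      using ne S(1) by (intro lin_indep_over_finiteI zero) auto
  qed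
qed

lemma algebraic_over_mono: "algebraic_over E x \<Longrightarrow> E \<subseteq> F \<Longrightarrow> algebraic_over F x"
  unfolding algebraic_over_def by blast

text \<open>One Frobenius power moves all coefficients into \<open>C\<close>; substituting X^(p^M)
  in the resulting polynomial makes \<open>x\<close> a root again.\<close>

lemma algebraic_over_perfect_closure_in:
  assumes C: "is_subfield C" and alg: "algebraic_over (perfect_closure_in C) (x::'a::field)"
  shows "algebraic_over C x"
proof -
  obtain q :: "'a poly" where q: "q \<noteq> 0" "\<And>i. Polynomial.coeff q i \<in> perfect_closure_in C" "poly q x = 0"
    using alg by (auto simp: algebraic_over_def)
  have up: "frob (m + n) x \<in> C" if "frob n x \<in> C" for m n x
    using that is_subfield_power[OF C] by (simp flip: frob_frob) (simp add: frob_def[of m])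
  obtain n where n: "frob (n i) (Polynomial.coeff q i) \<in> C" for i
    using q(2) unfolding perfect_closure_in_def by simp metis
  define M where "M = Max (n ` {..Polynomial.degree q})"
  have M: "frob M (Polynomial.coeff q i) \<in> C" for i
  proof (cases "i \<le> Polynomial.degree q")
    case True
    then have "n i \<le> M" unfolding M_def by (intro Max_ge) auto
    then show ?thesis using up[OF n[of i], of "M - n i"] by simp
  qed (simp add: coeff_eq_0 is_subfieldD[OF C])
  define e where "e = char_exponent TYPE('a) ^ M"
  have e: "e > 0" by (simp add: e_def char_exponent_pos)
  define r where "r = pcompose (map_poly (frob M) q) (Polynomial.monom 1 e)"
  have "poly (map_poly (frob M) q) (frob M y) = frob M (poly q y)" for y
    by (simp add: poly_altdef frob_sum frob_mult frob_power degree_map_poly coeff_map_poly)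
  then have "poly r x = 0" using q(3)
    by (simp add: r_def poly_pcompose poly_monom e_def frob_def[of M x, symmetric])
  moreover have "r \<noteq> 0"
  proof
    assume "r = 0"
    then have "map_poly (frob M) q = 0" using e
      by (auto simp: r_def pcompose_eq_0_iff degree_monom_eq)
    then show False using q(1) by (simp add: map_poly_eq_0_iff)
  qed
  moreover have "Polynomial.coeff r i \<in> C" for i
  proof -
    have "r = (\<Sum>j\<le>Polynomial.degree q. Polynomial.monom (frob M (Polynomial.coeff q j)) (e * j))"
      unfolding r_def pcompose_altdef
      by (simp add: degree_map_poly coeff_map_poly monom_power smult_monom poly_altdef flip: of_nat_mult)
    then show ?thesis using M is_subfieldD(1)[OF C]
      by (auto simp: coeff_sum intro!: is_subfield_sum[OF C])
  qed
  ultimately show ?thesis unfolding algebraic_over_def by blast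
qed

section \<open>Field topologies\<close>

text \<open>The last axiom is continuity of the inverse Frobenius map on its image. It turns control
  of p^m-th powers into control of the elements themselves.\<close>

locale field_topology =
  fixes \<tau> :: "'a::field topology"
  assumes topspace_UNIV [simp]: "topspace \<tau> = UNIV"
    and plus_continuous: "filterlim (\<lambda>x. fst x + snd x) (nhdsin \<tau> (a + b)) (nhdsin \<tau> a \<times>\<^sub>F nhdsin \<tau> b)"
    and times_continuous: "filterlim (\<lambda>x. fst x * snd x) (nhdsin \<tau> (a * b)) (nhdsin \<tau> a \<times>\<^sub>F nhdsin \<tau> b)"
    and eventually_neq: "a \<noteq> b \<Longrightarrow> eventually (\<lambda>x. x \<noteq> b) (nhdsin \<tau> a)"
    and infinite_open: "openin \<tau> U \<Longrightarrow> U \<noteq> {} \<Longrightarrow> infinite U"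
    and eventually_frob_inverse: "eventually P (nhdsin \<tau> w) \<Longrightarrow>
      eventually (\<lambda>y. \<forall>z. frob m z = y \<longrightarrow> P z) (nhdsin \<tau> (frob m w))"

context field_topology
begin

lemma filterlim_plus:
  assumes "filterlim f (nhdsin \<tau> a) F" "filterlim g (nhdsin \<tau> b) F"
  shows "filterlim (\<lambda>x. f x + g x) (nhdsin \<tau> (a + b)) F"
  using filterlim_compose[OF plus_continuous filterlim_Pair[OF assms]] by simp

lemma filterlim_times:
  assumes "filterlim f (nhdsin \<tau> a) F" "filterlim g (nhdsin \<tau> b) F"
  shows "filterlim (\<lambda>x. f x * g x) (nhdsin \<tau> (a * b)) F"
  using filterlim_compose[OF times_continuous filterlim_Pair[OF assms]] by simp

end

text \<open>Both kinds of V-topology come from a family of neighbourhoods of 0. The condition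
  \<open>root\<close> yields continuity of inverse Frobenius because a difference of p^m-th powers
  is the p^m-th power of the difference.\<close>

lemma field_topologyI:
  fixes \<tau> :: "'a::field topology" and \<B> :: "'a set set"
  assumes op: "\<And>U. openin \<tau> U \<longleftrightarrow> (\<forall>x\<in>U. \<exists>B\<in>\<B>. \<forall>b\<in>B. x + b \<in> U)"
    and ne: "\<B> \<noteq> {}"
    and zero: "\<And>B. B \<in> \<B> \<Longrightarrow> 0 \<in> B"
    and inter: "\<And>B B'. B \<in> \<B> \<Longrightarrow> B' \<in> \<B> \<Longrightarrow> \<exists>B''\<in>\<B>. B'' \<subseteq> B \<inter> B'"
    and add: "\<And>B. B \<in> \<B> \<Longrightarrow> \<exists>B'\<in>\<B>. \<forall>x\<in>B'. \<forall>y\<in>B'. x + y \<in> B"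
    and mult: "\<And>B. B \<in> \<B> \<Longrightarrow> \<exists>B'\<in>\<B>. \<forall>x\<in>B'. \<forall>y\<in>B'. x * y \<in> B"
    and scale: "\<And>B c. B \<in> \<B> \<Longrightarrow> \<exists>B'\<in>\<B>. \<forall>x\<in>B'. c * x \<in> B"
    and t1: "\<And>c. c \<noteq> 0 \<Longrightarrow> \<exists>B\<in>\<B>. c \<notin> B"
    and nontriv: "\<And>B. B \<in> \<B> \<Longrightarrow> \<exists>c\<in>B. c \<noteq> 0"
    and root: "\<And>B n. B \<in> \<B> \<Longrightarrow> n > 0 \<Longrightarrow> \<exists>B'\<in>\<B>. \<forall>x. x ^ n \<in> B' \<longrightarrow> x \<in> B"
  shows "field_topology \<tau>"
proof -
  have top: "topspace \<tau> = UNIV"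
  proof -
    have "openin \<tau> UNIV" unfolding op using ne by auto
    then show ?thesis using openin_subset by blast
  qed
  have ev: "eventually P (nhdsin \<tau> a) \<longleftrightarrow> (\<exists>B\<in>\<B>. \<forall>b\<in>B. P (a + b))" for P a
  proof
    assume "eventually P (nhdsin \<tau> a)"
    then obtain S where S: "openin \<tau> S" "a \<in> S" "\<forall>x\<in>S. P x"
      by (auto simp: eventually_nhdsin top)
    from S(1,2) obtain B where "B \<in> \<B>" "\<forall>b\<in>B. a + b \<in> S" unfolding op by blast
    then show "\<exists>B\<in>\<B>. \<forall>b\<in>B. P (a + b)" using S(3) by blast
  next
    assume P: "\<exists>B\<in>\<B>. \<forall>b\<in>B. P (a + b)"
    \<comment> \<open>\<open>S\<close> is the interior of the set where \<open>P\<close> holds;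
      splitting a neighbourhood by \<open>add\<close> shows that it is open.\<close>
    define S where "S = {x. \<exists>B\<in>\<B>. \<forall>b\<in>B. P (x + b)}"
    have "openin \<tau> S" unfolding op
    proof
      fix x assume "x \<in> S"
      then obtain B where B: "B \<in> \<B>" "\<forall>b\<in>B. P (x + b)" unfolding S_def by blast
      obtain B' where B': "B' \<in> \<B>" "\<forall>x\<in>B'. \<forall>y\<in>B'. x + y \<in> B" using add[OF B(1)] by blast
      have "x + b \<in> S" if "b \<in> B'" for b
        unfolding S_def using B B' that by (auto simp: add.assoc intro!: bexI[of _ B'])
      then show "\<exists>B\<in>\<B>. \<forall>b\<in>B. x + b \<in> S" using B'(1) by blast
    qed
    moreover have "a \<in> S" using P by (simp add: S_def)
    moreover have "P x" if "x \<in> S" for x using that zero unfolding S_def by force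
    ultimately show "eventually P (nhdsin \<tau> a)" by (auto simp: eventually_nhdsin)
  qed
  have lim: "filterlim f (nhdsin \<tau> a) F \<longleftrightarrow> (\<forall>B\<in>\<B>. eventually (\<lambda>x. f x - a \<in> B) F)"
    for f :: "'a \<times> 'a \<Rightarrow> 'a" and a F
  proof
    assume L: "filterlim f (nhdsin \<tau> a) F"
    show "\<forall>B\<in>\<B>. eventually (\<lambda>x. f x - a \<in> B) F"
    proof
      fix B assume "B \<in> \<B>"
      then have "eventually (\<lambda>y. y - a \<in> B) (nhdsin \<tau> a)" unfolding ev by (intro bexI[of _ B]) auto
      then show "eventually (\<lambda>x. f x - a \<in> B) F" using L by (auto simp: filterlim_iff)
    qed
  next
    assume R: "\<forall>B\<in>\<B>. eventually (\<lambda>x. f x - a \<in> B) F"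
    show "filterlim f (nhdsin \<tau> a) F" unfolding filterlim_iff
    proof (intro allI impI)
      fix P assume "eventually P (nhdsin \<tau> a)"
      then obtain B where B: "B \<in> \<B>" "\<forall>b\<in>B. P (a + b)" unfolding ev by blast
      show "eventually (\<lambda>x. P (f x)) F"
        using bspec[OF R B(1)]
      proof eventually_elim
        case (elim x)
        then have "P (a + (f x - a))" using B(2) by blast
        then show ?case by simp
      qed
    qed
  qed
  show ?thesis
  proof
    show "topspace \<tau> = UNIV" by (rule top)
  next
    fix a b :: 'a
    define F where "F = nhdsin \<tau> a \<times>\<^sub>F nhdsin \<tau> b"
    define f g :: "'a \<times> 'a \<Rightarrow> 'a" where "f = fst" "g = snd"
    have fg: "filterlim f (nhdsin \<tau> a) F" "filterlim g (nhdsin \<tau> b) F"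
      unfolding f_g_def F_def by (rule filterlim_fst filterlim_snd)+
    have "filterlim (\<lambda>x. f x + g x) (nhdsin \<tau> (a + b)) F"
      unfolding lim
    proof
      fix B assume "B \<in> \<B>"
      then obtain B' where B': "B' \<in> \<B>" "\<forall>x\<in>B'. \<forall>y\<in>B'. x + y \<in> B" using add by blast
      have "eventually (\<lambda>x. f x - a \<in> B') F" "eventually (\<lambda>x. g x - b \<in> B') F"
        using fg B' unfolding lim by auto
      then show "eventually (\<lambda>x. f x + g x - (a + b) \<in> B) F"
      proof eventually_elim
        case (elim x)
        then have "(f x - a) + (g x - b) \<in> B" using B'(2) by blast
        then show ?case by (simp add: algebra_simps)
      qed
    qed
    then show "filterlim (\<lambda>x. fst x + snd x) (nhdsin \<tau> (a + b)) (nhdsin \<tau> a \<times>\<^sub>F nhdsin \<tau> b)"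
      by (simp add: f_g_def F_def)
    have "filterlim (\<lambda>x. f x * g x) (nhdsin \<tau> (a * b)) F"
      unfolding lim
    proof
      fix B assume "B \<in> \<B>"
      then obtain B1 where B1: "B1 \<in> \<B>" "\<forall>x\<in>B1. \<forall>y\<in>B1. x + y \<in> B" using add by blast
      obtain B2 where B2: "B2 \<in> \<B>" "\<forall>x\<in>B2. \<forall>y\<in>B2. x + y \<in> B1" using add[OF B1(1)] by blast
      obtain B3 where B3: "B3 \<in> \<B>" "\<forall>x\<in>B3. \<forall>y\<in>B3. x * y \<in> B1" using mult[OF B1(1)] by blast
      obtain B4 where B4: "B4 \<in> \<B>" "\<forall>x\<in>B4. a * x \<in> B2" using scale[OF B2(1)] by blast
      obtain B5 where B5: "B5 \<in> \<B>" "\<forall>x\<in>B5. b * x \<in> B2" using scale[OF B2(1)] by blast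
      have "eventually (\<lambda>x. f x - a \<in> B3) F" "eventually (\<lambda>x. g x - b \<in> B3) F"
        "eventually (\<lambda>x. f x - a \<in> B5) F" "eventually (\<lambda>x. g x - b \<in> B4) F"
        using fg B3 B4 B5 unfolding lim by auto
      then show "eventually (\<lambda>x. f x * g x - a * b \<in> B) F"
      proof eventually_elim
        case (elim x)
        then have "(f x - a) * (g x - b) + (a * (g x - b) + b * (f x - a)) \<in> B"
          using B1(2) B2(2) B3(2) B4(2) B5(2) by blast
        then show ?case by (simp add: algebra_simps)
      qed
    qed
    then show "filterlim (\<lambda>x. fst x * snd x) (nhdsin \<tau> (a * b)) (nhdsin \<tau> a \<times>\<^sub>F nhdsin \<tau> b)"
      by (simp add: f_g_def F_def)
  next
    fix a b :: 'a assume "a \<noteq> b"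
    then have "b - a \<noteq> 0" by simp
    then obtain B where B: "B \<in> \<B>" "b - a \<notin> B" using t1 by blast
    then have "\<forall>c\<in>B. a + c \<noteq> b" by auto
    then show "eventually (\<lambda>x. x \<noteq> b) (nhdsin \<tau> a)" unfolding ev using B(1) by blast
  next
    fix U assume U: "openin \<tau> U" "U \<noteq> {}"
    then obtain x B where B: "B \<in> \<B>" "\<forall>b\<in>B. x + b \<in> U" unfolding op by blast
    show "infinite U"
    proof
      assume "finite U"
      \<comment> \<open>Finitely many nonzero elements can be excluded one at a time. Excluding
        those of a finite \<open>B\<close> leaves a member of the family inside {0}, against
        \<open>nontriv\<close>.\<close>
      have *: "\<exists>B'\<in>\<B>. B' \<subseteq> B \<and> (\<forall>c\<in>S. c \<noteq> 0 \<longrightarrow> c \<notin> B')" if "finite S" for S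
        using that
      proof induction
        case empty
        then show ?case using B(1) by auto
      next
        case (insert c S)
        obtain B' where B': "B' \<in> \<B>" "B' \<subseteq> B" "\<forall>c\<in>S. c \<noteq> 0 \<longrightarrow> c \<notin> B'"
          using insert.IH by (elim bexE conjE)
        show ?case
        proof (cases "c = 0")
          case False
          then obtain B1 where B1: "B1 \<in> \<B>" "c \<notin> B1" using t1[of c] by auto
          obtain B2 where B2: "B2 \<in> \<B>" "B2 \<subseteq> B' \<inter> B1" using inter[OF B'(1) B1(1)] by auto
          show ?thesis
          proof (rule bexI[OF _ B2(1)])
            show "B2 \<subseteq> B \<and> (\<forall>d\<in>insert c S. d \<noteq> 0 \<longrightarrow> d \<notin> B2)"
              using B2(2) B'(2,3) B1(2) by auto
          qed
        qed (use B' in auto)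
      qed
      have "(+) x ` B \<subseteq> U" using B(2) by auto
      then have "finite ((+) x ` B)" using \<open>finite U\<close> finite_subset by auto
      then have "finite B" by (rule finite_imageD) auto
      then obtain B' where B': "B' \<in> \<B>" "B' \<subseteq> B" "\<forall>c\<in>B. c \<noteq> 0 \<longrightarrow> c \<notin> B'"
        using *[of B] by auto
      then show False using nontriv[OF B'(1)] by auto
    qed
  next
    fix P w m assume "eventually P (nhdsin \<tau> w)"
    then obtain B where B: "B \<in> \<B>" "\<forall>b\<in>B. P (w + b)" unfolding ev by blast
    have "char_exponent TYPE('a) ^ m > 0" using char_exponent_pos[where 'a='a] by simp
    then obtain B' where B': "B' \<in> \<B>" "\<forall>x :: 'a. x ^ (char_exponent TYPE('a) ^ m) \<in> B' \<longrightarrow> x \<in> B"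
      using root[OF B(1)] by blast
    have "P z" if "b \<in> B'" "frob m z = frob m w + b" for b z
    proof -
      have "frob m (z - w) \<in> B'" using that by (simp add: frob_diff)
      then have "z - w \<in> B" using B'(2) by (simp add: frob_def)
      then have "P (w + (z - w))" using B(2) by blast
      then show ?thesis by simp
    qed
    then show "eventually (\<lambda>y. \<forall>z. frob m z = y \<longrightarrow> P z) (nhdsin \<tau> (frob m w))"
      unfolding ev using B'(1) by blast
  qed
qed

section \<open>Topologies of absolute values and of valuations\<close>

lemma field_topology_abs:
  fixes \<tau> :: "'a::field topology"
  assumes a: "absolute_value a" and nt: "nontrivial_abs a" and ind: "induced_by_abs \<tau> a"
  shows "field_topology \<tau>"
proof -
  define ball where "ball e = {y. a y < e}" for e :: real
  note a' = a[unfolded absolute_value_def]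
  have pos: "a x \<ge> 0" and zero_iff: "a x = 0 \<longleftrightarrow> x = 0" and mult: "a (x * y) = a x * a y"
    and tri: "a (x + y) \<le> a x + a y" for x y
    using a' by blast+
  have a1: "a 1 = 1" using mult[of 1 1] zero_iff[of 1] by simp
  have power: "a (x ^ n) = a x ^ n" for x n by (induction n) (auto simp: a1 mult)
  \<comment> \<open>Powers of such an element provide nonzero elements in every ball around
    0.\<close>
  have "\<exists>x. x \<noteq> 0 \<and> a x < 1"
  proof -
    obtain x where x: "x \<noteq> 0" "a x \<noteq> 1" using nt by (auto simp: nontrivial_abs_def)
    have "a x * a (inverse x) = 1" using mult[of x "inverse x"] x a1 by simp
    then have "\<not> (a x > 1 \<and> a (inverse x) \<ge> 1)"
      using mult_left_mono[of 1 "a (inverse x)" "a x"] pos[of x] by linarith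
    then have "a x < 1 \<or> a (inverse x) < 1" using x(2) by linarith
    then show ?thesis using x(1) by (meson nonzero_imp_inverse_nonzero)
  qed
  then obtain x0 where x0: "x0 \<noteq> 0" "a x0 < 1" by blast
  show ?thesis
  proof (rule field_topologyI[where \<B> = "ball ` {0<..}"])
    fix U
    have "(\<exists>e>0. {y. a (y - x) < e} \<subseteq> U) \<longleftrightarrow> (\<exists>B\<in>ball ` {0<..}. \<forall>b\<in>B. x + b \<in> U)" for x
    proof -
      have "{y. a (y - x) < e} \<subseteq> U \<longleftrightarrow> (\<forall>b\<in>ball e. x + b \<in> U)" for e
      proof
        assume "\<forall>b\<in>ball e. x + b \<in> U"
        then have "x + (y - x) \<in> U" if "a (y - x) < e" for y using that unfolding ball_def by blast
        then show "{y. a (y - x) < e} \<subseteq> U" by auto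
      qed (auto simp: ball_def)
      then show ?thesis by auto
    qed
    then show "openin \<tau> U \<longleftrightarrow> (\<forall>x\<in>U. \<exists>B\<in>ball ` {0<..}. \<forall>b\<in>B. x + b \<in> U)"
      using ind unfolding induced_by_abs_def by simp
  next
    show "ball ` {0<..} \<noteq> {}" by (simp add: ex_in_conv[symmetric])
  next
    fix B assume "B \<in> ball ` {0<..}"
    then obtain e where e: "e > 0" "B = ball e" by auto
    show "0 \<in> B" using e zero_iff[of 0] by (simp add: ball_def)
    have "\<forall>x\<in>ball (e/2). \<forall>y\<in>ball (e/2). x + y \<in> B"
    proof (intro ballI)
      fix x y assume "x \<in> ball (e/2)" "y \<in> ball (e/2)"
      then show "x + y \<in> B" using tri[of x y] by (simp add: ball_def e)
    qed
    then show "\<exists>B'\<in>ball ` {0<..}. \<forall>x\<in>B'. \<forall>y\<in>B'. x + y \<in> B"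
      using e(1) by (intro bexI[of _ "ball (e/2)"]) auto
    have "a x * a y < e" if "a x < min e 1" "a y < min e 1" for x y
    proof -
      have "a x * a y \<le> 1 * a y" using that pos[of y] by (intro mult_right_mono) auto
      then show ?thesis using that by simp
    qed
    then show "\<exists>B'\<in>ball ` {0<..}. \<forall>x\<in>B'. \<forall>y\<in>B'. x * y \<in> B"
      using e(1) by (intro bexI[of _ "ball (min e 1)"] imageI) (auto simp: ball_def mult e(2))
    \<comment> \<open>The radius e / (a c + 1) also covers c = 0.\<close>
    show "\<exists>B'\<in>ball ` {0<..}. \<forall>x\<in>B'. c * x \<in> B" for c
    proof -
      have "a c * a x < e" if "a x < e / (a c + 1)" for x
      proof -
        have "a c * a x \<le> (a c + 1) * a x" using pos[of x] by (intro mult_right_mono) auto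
        also have "\<dots> < e" using that pos[of c] by (simp add: field_simps)
        finally show ?thesis .
      qed
      then show ?thesis using e(1) pos[of c]
        by (intro bexI[of _ "ball (e / (a c + 1))"]) (auto simp: ball_def mult e(2))
    qed
    obtain n where "a x0 ^ n < e" using x0(2) e(1) by (meson real_arch_pow_inv)
    then show "\<exists>c\<in>B. c \<noteq> 0" using x0(1)
      by (intro bexI[of _ "x0 ^ n"]) (auto simp: ball_def e(2) power)
    show "\<exists>B'\<in>ball ` {0<..}. \<forall>x. x ^ n \<in> B' \<longrightarrow> x \<in> B" if "n > 0" for n
    proof -
      have "a x < e" if "a x ^ n < e ^ n" for x
        using that e(1) by (meson less_eq_real_def power_less_imp_less_base)
      then show ?thesis using e(1)
        by (intro bexI[of _ "ball (e ^ n)"]) (auto simp: ball_def e(2) power)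
    qed
  next
    fix B B' assume "B \<in> ball ` {0<..}" "B' \<in> ball ` {0<..}"
    then obtain e e' where "e > 0" "B = ball e" "e' > 0" "B' = ball e'" by auto
    then show "\<exists>B''\<in>ball ` {0<..}. B'' \<subseteq> B \<inter> B'"
      by (intro bexI[of _ "ball (min e e')"] imageI) (auto simp: ball_def)
  next
    fix c :: 'a assume "c \<noteq> 0"
    then have "a c > 0" using pos[of c] zero_iff[of c] by simp
    then show "\<exists>B\<in>ball ` {0<..}. c \<notin> B"
      by (intro bexI[of _ "ball (a c)"]) (auto simp: ball_def)
  qed
qed

lemma field_topology_val:
  fixes \<tau> :: "'a::field topology" and v :: "'a \<Rightarrow> 'g::linordered_ab_group_add"
  assumes v: "valuation v" and nt: "nontrivial_val v" and ind: "induced_by_val \<tau> v"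
  shows "field_topology \<tau>"
proof -
  define ball where "ball \<gamma> = {y. y = 0 \<or> v y > \<gamma>}" for \<gamma>
  have mult: "v (x * y) = v x + v y" if "x \<noteq> 0" "y \<noteq> 0" for x y
    using v that unfolding valuation_def by blast
  have tri: "min (v x) (v y) \<le> v (x + y)" if "x \<noteq> 0" "y \<noteq> 0" "x + y \<noteq> 0" for x y
    using v that unfolding valuation_def by blast
  have v1: "v 1 = 0" using mult[of 1 1] by simp
  have inv: "v (inverse x) = - v x" if "x \<noteq> 0" for x
    using mult[of x "inverse x"] that v1 by (simp add: eq_neg_iff_add_eq_0 add.commute)
  have "\<exists>x. x \<noteq> 0 \<and> v x > 0"
  proof -
    obtain x where x: "x \<noteq> 0" "v x \<noteq> 0" using nt by (auto simp: nontrivial_val_def)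
    then consider "v x > 0" | "v (inverse x) > 0" using inv[OF x(1)] by fastforce
    then show ?thesis using x(1) by cases (auto intro: exI[of _ x] exI[of _ "inverse x"])
  qed
  then obtain x0 where x0: "x0 \<noteq> 0" "v x0 > 0" by blast
  have power: "v (x ^ n) \<le> v (z ^ n)" if "x \<noteq> 0" "z \<noteq> 0" "v x \<le> v z" for x z n
    by (induction n) (auto simp: mult that add_mono)
  show ?thesis
  proof (rule field_topologyI[where \<B> = "(\<lambda>z. ball (v z)) ` (- {0})"])
    fix U
    have "(\<exists>\<gamma>\<in>v ` (- {0}). {y. y = x \<or> v (y - x) > \<gamma>} \<subseteq> U) \<longleftrightarrow>
        (\<exists>B\<in>(\<lambda>z. ball (v z)) ` (- {0}). \<forall>b\<in>B. x + b \<in> U)" for x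
    proof -
      have "{y. y = x \<or> v (y - x) > \<gamma>} \<subseteq> U \<longleftrightarrow> (\<forall>b\<in>ball \<gamma>. x + b \<in> U)" for \<gamma>
      proof
        assume "\<forall>b\<in>ball \<gamma>. x + b \<in> U"
        then have "x + (y - x) \<in> U" if "y = x \<or> v (y - x) > \<gamma>" for y
          using that unfolding ball_def by auto
        then show "{y. y = x \<or> v (y - x) > \<gamma>} \<subseteq> U" by auto
      qed (auto simp: ball_def)
      then show ?thesis by auto
    qed
    then show "openin \<tau> U \<longleftrightarrow> (\<forall>x\<in>U. \<exists>B\<in>(\<lambda>z. ball (v z)) ` (- {0}). \<forall>b\<in>B. x + b \<in> U)"
      using ind unfolding induced_by_val_def by simp
  next
    show "(\<lambda>z. ball (v z)) ` (- {0}) \<noteq> {}" by (metis ComplI empty_iff image_is_empty singletonD zero_neq_one)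
  next
    fix B assume "B \<in> (\<lambda>z. ball (v z)) ` (- {0})"
    then obtain z where z: "z \<noteq> 0" "B = ball (v z)" by auto
    show "0 \<in> B" using z by (simp add: ball_def)
    have "x + y \<in> B" if "x \<in> B" "y \<in> B" for x y
    proof (cases "x = 0 \<or> y = 0 \<or> x + y = 0")
      case False
      then have "v z < min (v x) (v y)" "x + y \<noteq> 0" using that by (auto simp: ball_def z)
      then show ?thesis using tri[of x y] False
        by (metis (mono_tags, lifting) ball_def less_le_trans mem_Collect_eq z(2))
    qed (use that in \<open>auto simp: ball_def z\<close>)
    then show "\<exists>B'\<in>(\<lambda>z. ball (v z)) ` (- {0}). \<forall>x\<in>B'. \<forall>y\<in>B'. x + y \<in> B"
      using z by (intro bexI[of _ B]) auto
    \<comment> \<open>The value of \<open>z'\<close> is at least \<open>v z\<close> and nonnegative,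
      so in a product one factor already exceeds \<open>v z\<close> and the other has positive
      value.\<close>
    define z' where "z' = (if v z > 0 then z else 1)"
    have z': "z' \<noteq> 0" "v z \<le> v z'" "0 \<le> v z'" using z v1 by (auto simp: z'_def)
    have "x * y \<in> B" if xy: "x \<in> ball (v z')" "y \<in> ball (v z')" for x y
    proof (cases "x = 0 \<or> y = 0")
      case False
      then have "v z < v x" "0 < v y" using xy z' by (auto simp: ball_def)
      then have "v z + 0 < v x + v y" by (rule add_strict_mono)
      then show ?thesis using False by (simp add: ball_def z mult)
    qed (auto simp: ball_def z)
    then show "\<exists>B'\<in>(\<lambda>z. ball (v z)) ` (- {0}). \<forall>x\<in>B'. \<forall>y\<in>B'. x * y \<in> B"
      using z'(1) by (intro bexI[of _ "ball (v z')"]) auto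
    show "\<exists>B'\<in>(\<lambda>z. ball (v z)) ` (- {0}). \<forall>x\<in>B'. c * x \<in> B" for c
    proof (cases "c = 0")
      case True
      then show ?thesis using z by (intro bexI[of _ B]) (auto simp: ball_def)
    next
      case False
      have "v (z / c) = v z - v c" using mult[of z "inverse c"] inv[of c] False z
        by (simp add: divide_inverse)
      then have "c * x \<in> B" if "x \<in> ball (v (z / c))" for x
        using that z False by (auto simp: ball_def mult diff_less_eq add.commute)
      then show ?thesis using z False by (intro bexI[of _ "ball (v (z / c))"]) auto
    qed
    have "v (z * x0) > v z" using mult[OF z(1) x0(1)] x0(2) by simp
    then show "\<exists>c\<in>B. c \<noteq> 0" using x0(1) z
      by (intro bexI[of _ "z * x0"]) (auto simp: ball_def)
    show "\<exists>B'\<in>(\<lambda>z. ball (v z)) ` (- {0}). \<forall>x. x ^ n \<in> B' \<longrightarrow> x \<in> B" if "n > 0" for n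
    proof -
      have "x \<in> B" if "x ^ n \<in> ball (v (z ^ n))" for x
      proof (rule ccontr)
        assume "x \<notin> B"
        then have "x \<noteq> 0" "v x \<le> v z" by (auto simp: ball_def z)
        then show False using power[of x z n] z that by (auto simp: ball_def)
      qed
      then show ?thesis using z by (intro bexI[of _ "ball (v (z ^ n))"]) auto
    qed
  next
    fix B B' assume "B \<in> (\<lambda>z. ball (v z)) ` (- {0})" "B' \<in> (\<lambda>z. ball (v z)) ` (- {0})"
    then obtain z z' where z: "z \<noteq> 0" "B = ball (v z)" "z' \<noteq> 0" "B' = ball (v z')" by auto
    then show "\<exists>B''\<in>(\<lambda>z. ball (v z)) ` (- {0}). B'' \<subseteq> B \<inter> B'"
      by (intro bexI[of _ "ball (v (if v z \<le> v z' then z' else z))"]) (auto simp: ball_def)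
  next
    fix c :: 'a assume "c \<noteq> 0"
    then show "\<exists>B\<in>(\<lambda>z. ball (v z)) ` (- {0}). c \<notin> B"
      by (intro bexI[of _ "ball (v c)"]) (auto simp: ball_def)
  qed
qed

lemma field_topology_henselian:
  "henselian_topology TYPE('g::linordered_ab_group_add) \<tau> \<Longrightarrow> field_topology \<tau>"
  unfolding henselian_topology_def V_topology_def
  using field_topology_abs field_topology_val by blast

section \<open>Polynomials in several variables\<close>

type_synonym 'a mp = "(nat \<Rightarrow>\<^sub>0 nat) \<Rightarrow>\<^sub>0 'a"

abbreviation "lkp \<equiv> Poly_Mapping.lookup"
abbreviation "ks \<equiv> Poly_Mapping.keys"
abbreviation "sgl \<equiv> Poly_Mapping.single"
abbreviation "upd \<equiv> Poly_Mapping.update"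
abbreviation "cf \<equiv> Polynomial.coeff"
abbreviation "mnm \<equiv> Polynomial.monom"

section \<open>Monomials, evaluation and rings of polynomials\<close>

definition mono_eval :: "(nat \<Rightarrow> 'a::field) \<Rightarrow> (nat \<Rightarrow>\<^sub>0 nat) \<Rightarrow> 'a" where
  "mono_eval x \<alpha> = (\<Prod>i\<in>ks \<alpha>. x i ^ lkp \<alpha> i)"

lemma mono_eval_superset:
  "finite S \<Longrightarrow> ks \<alpha> \<subseteq> S \<Longrightarrow> mono_eval x \<alpha> = (\<Prod>i\<in>S. x i ^ lkp \<alpha> i)"
  unfolding mono_eval_def by (rule prod.mono_neutral_left) (auto simp: in_keys_iff)

lemma mono_eval_add: "mono_eval x (\<alpha> + \<beta>) = mono_eval x \<alpha> * mono_eval x \<beta>"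
proof -
  let ?S = "ks \<alpha> \<union> ks \<beta>"
  have "mono_eval x (\<alpha> + \<beta>) = (\<Prod>i\<in>?S. x i ^ lkp (\<alpha> + \<beta>) i)"
    by (rule mono_eval_superset) (simp_all add: Poly_Mapping.keys_add)
  also have "\<dots> = (\<Prod>i\<in>?S. x i ^ lkp \<alpha> i) * (\<Prod>i\<in>?S. x i ^ lkp \<beta> i)"
    by (simp add: lookup_add power_add prod.distrib)
  also have "\<dots> = mono_eval x \<alpha> * mono_eval x \<beta>"
    by (simp add: mono_eval_superset[of ?S])
  finally show ?thesis .
qed

lemma mono_eval_0 [simp]: "mono_eval x 0 = 1"
  by (simp add: mono_eval_def)

lemma mono_eval_single [simp]: "mono_eval x (sgl i n) = x i ^ n"
  by (cases "n = 0") (auto simp: mono_eval_def)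

lemma mono_eval_cong: "(\<And>i. i \<in> ks \<alpha> \<Longrightarrow> x i = y i) \<Longrightarrow> mono_eval x \<alpha> = mono_eval y \<alpha>"
  by (simp add: mono_eval_def)

lemma lookup_upd: "lkp (upd i k \<alpha>) j = (if j = i then k else lkp \<alpha> j)"
  by (simp add: lookup_update)

lemma upd_self [simp]: "upd i (lkp \<alpha> i) \<alpha> = \<alpha>"
  by (rule poly_mapping_eqI) (simp add: lookup_upd)

lemma keys_upd: "ks (upd i k \<alpha>) \<subseteq> insert i (ks \<alpha>)"
  by (auto simp: in_keys_iff lookup_upd split: if_splits)

text \<open>Evaluating at 1 in place \<open>i\<close> deletes the X_i-factor of a monomial, so later
  sums can separate the powers of X_i.\<close>

lemma mono_eval_upd: "mono_eval x (upd i k \<alpha>) = mono_eval (x(i := 1)) \<alpha> * x i ^ k"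
proof -
  let ?S = "insert i (ks \<alpha>)"
  have "mono_eval x (upd i k \<alpha>) = (\<Prod>j\<in>?S. x j ^ lkp (upd i k \<alpha>) j)"
    by (intro mono_eval_superset keys_upd) simp
  also have "\<dots> = x i ^ k * (\<Prod>j\<in>?S - {i}. (x(i := 1)) j ^ lkp \<alpha> j)"
    by (subst prod.remove[of _ i]) (auto simp: lookup_upd intro!: prod.cong)
  also have "(\<Prod>j\<in>?S - {i}. (x(i := 1)) j ^ lkp \<alpha> j) = mono_eval (x(i := 1)) \<alpha>"
    by (subst mono_eval_superset[of ?S]) (auto intro!: prod.mono_neutral_cong_left split: if_splits)
  finally show ?thesis by simp
qed

lemma mono_eval_fun_upd: "mono_eval (x(i := t)) \<alpha> = mono_eval (x(i := 1)) \<alpha> * t ^ lkp \<alpha> i"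
  using mono_eval_upd[of "x(i := t)" i "lkp \<alpha> i" \<alpha>] by simp

definition mdeg :: "(nat \<Rightarrow>\<^sub>0 nat) \<Rightarrow> nat" where
  "mdeg \<alpha> = (\<Sum>i\<in>ks \<alpha>. lkp \<alpha> i)"

lemma mdeg_superset: "finite S \<Longrightarrow> ks \<alpha> \<subseteq> S \<Longrightarrow> mdeg \<alpha> = (\<Sum>i\<in>S. lkp \<alpha> i)"
  unfolding mdeg_def by (rule sum.mono_neutral_left) (auto simp: in_keys_iff)

lemma mdeg_upd: "mdeg (upd i k \<alpha>) + lkp \<alpha> i = mdeg \<alpha> + k"
proof -
  let ?S = "insert i (ks \<alpha>)"
  have "mdeg (upd i k \<alpha>) = (\<Sum>j\<in>?S. lkp (upd i k \<alpha>) j)"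
    by (intro mdeg_superset keys_upd) simp
  also have "\<dots> = k + (\<Sum>j\<in>?S - {i}. lkp \<alpha> j)"
    by (subst sum.remove[of _ i]) (auto simp: lookup_upd intro!: sum.cong)
  finally have "mdeg (upd i k \<alpha>) = k + (\<Sum>j\<in>?S - {i}. lkp \<alpha> j)" .
  moreover have "mdeg \<alpha> = lkp \<alpha> i + (\<Sum>j\<in>?S - {i}. lkp \<alpha> j)"
    by (subst mdeg_superset[of ?S]) (auto simp: sum.remove[of "insert i (ks \<alpha>)" i])
  ultimately show ?thesis by simp
qed

lemma mdeg_eq_0_iff: "mdeg \<alpha> = 0 \<longleftrightarrow> \<alpha> = 0"
proof
  assume "mdeg \<alpha> = 0"
  then show "\<alpha> = 0" by (intro poly_mapping_eqI) (auto simp: mdeg_def in_keys_iff)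
qed (simp add: mdeg_def)

lemma mpoly_eval_alt: "mpoly_eval x q = (\<Sum>\<alpha>\<in>ks q. lkp q \<alpha> * mono_eval x \<alpha>)"
  by (simp add: mpoly_eval_def mono_eval_def)

lemma mpoly_eval_superset:
  "finite S \<Longrightarrow> ks q \<subseteq> S \<Longrightarrow> mpoly_eval x q = (\<Sum>\<alpha>\<in>S. lkp q \<alpha> * mono_eval x \<alpha>)"
  unfolding mpoly_eval_alt by (rule sum.mono_neutral_left) (auto simp: in_keys_iff)

lemma mpoly_eval_0 [simp]: "mpoly_eval x 0 = 0"
  by (simp add: mpoly_eval_alt)

lemma mpoly_eval_single [simp]: "mpoly_eval x (sgl \<alpha> c) = c * mono_eval x \<alpha>"
  by (subst mpoly_eval_superset[of "{\<alpha>}"]) auto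

lemma mpoly_eval_1 [simp]: "mpoly_eval x 1 = 1"
  using mpoly_eval_single[of x 0 1] by (simp del: mpoly_eval_single)

lemma mpoly_eval_add: "mpoly_eval x (q + r) = mpoly_eval x q + mpoly_eval x r"
proof -
  let ?S = "ks q \<union> ks r"
  have "mpoly_eval x (q + r) = (\<Sum>\<alpha>\<in>?S. lkp (q + r) \<alpha> * mono_eval x \<alpha>)"
    by (rule mpoly_eval_superset) (simp_all add: Poly_Mapping.keys_add)
  then show ?thesis
    by (simp add: mpoly_eval_superset[of ?S] lookup_add distrib_right sum.distrib)
qed

lemma mpoly_eval_uminus: "mpoly_eval x (- q) = - mpoly_eval x q"
  using mpoly_eval_add[of x q "- q"] by (simp add: eq_neg_iff_add_eq_0 add.commute)

lemma mpoly_eval_diff: "mpoly_eval x (q - r) = mpoly_eval x q - mpoly_eval x r"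
  using mpoly_eval_add[of x q "- r"] by (simp add: mpoly_eval_uminus)

lemma mpoly_eval_sum: "mpoly_eval x (sum f A) = (\<Sum>a\<in>A. mpoly_eval x (f a))"
  by (induction A rule: infinite_finite_induct) (auto simp: mpoly_eval_add)

lemma mp_decompose: "q = (\<Sum>\<alpha>\<in>ks q. sgl \<alpha> (lkp q \<alpha>))"
proof (rule poly_mapping_eqI)
  fix \<alpha>
  have "(\<Sum>\<beta>\<in>ks q. lkp (sgl \<beta> (lkp q \<beta>)) \<alpha>) = (\<Sum>\<beta>\<in>ks q. if \<beta> = \<alpha> then lkp q \<alpha> else 0)"
    by (intro sum.cong) (auto simp: lookup_single)
  then show "lkp q \<alpha> = lkp (\<Sum>\<alpha>\<in>ks q. sgl \<alpha> (lkp q \<alpha>)) \<alpha>"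
    by (simp add: lookup_sum in_keys_iff)
qed

lemma mpoly_eval_mult: "mpoly_eval x (q * r) = mpoly_eval x q * mpoly_eval x r"
proof -
  have "q * r = (\<Sum>\<alpha>\<in>ks q. sgl \<alpha> (lkp q \<alpha>)) * (\<Sum>\<beta>\<in>ks r. sgl \<beta> (lkp r \<beta>))"
    by (simp flip: mp_decompose)
  also have "\<dots> = (\<Sum>\<alpha>\<in>ks q. \<Sum>\<beta>\<in>ks r. sgl (\<alpha> + \<beta>) (lkp q \<alpha> * lkp r \<beta>))"
    by (simp add: sum_product mult_single)
  finally have "mpoly_eval x (q * r) =
      (\<Sum>\<alpha>\<in>ks q. \<Sum>\<beta>\<in>ks r. lkp q \<alpha> * lkp r \<beta> * (mono_eval x \<alpha> * mono_eval x \<beta>))"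
    by (simp only: mpoly_eval_sum mpoly_eval_single mono_eval_add)
  also have "\<dots> = mpoly_eval x q * mpoly_eval x r"
    by (simp add: mpoly_eval_alt sum_product mult_ac)
  finally show ?thesis .
qed

definition polys_in :: "'a::field set \<Rightarrow> nat set \<Rightarrow> 'a mp set" where
  "polys_in F V = {q. (\<forall>\<alpha>. lkp q \<alpha> \<in> F) \<and> (\<forall>\<alpha>\<in>ks q. ks \<alpha> \<subseteq> V)}"

lemma polys_inD: "q \<in> polys_in F V \<Longrightarrow> lkp q \<alpha> \<in> F"
  "q \<in> polys_in F V \<Longrightarrow> \<alpha> \<in> ks q \<Longrightarrow> ks \<alpha> \<subseteq> V"
  by (auto simp: polys_in_def)

lemma polys_in_mono: "q \<in> polys_in F V \<Longrightarrow> V \<subseteq> W \<Longrightarrow> q \<in> polys_in F W"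
  unfolding polys_in_def by blast

context
  fixes F :: "'a::field set" and V :: "nat set"
  assumes F: "is_subfield F"
begin

lemma polys_in_0: "0 \<in> polys_in F V"
  using is_subfieldD[OF F] by (auto simp: polys_in_def)

lemma polys_in_add: "q \<in> polys_in F V \<Longrightarrow> r \<in> polys_in F V \<Longrightarrow> q + r \<in> polys_in F V"
  using is_subfieldD[OF F] Poly_Mapping.keys_add[of q r] by (fastforce simp: polys_in_def lookup_add)

lemma polys_in_diff: "q \<in> polys_in F V \<Longrightarrow> r \<in> polys_in F V \<Longrightarrow> q - r \<in> polys_in F V"
  using is_subfieldD[OF F] keys_diff[of q r] by (fastforce simp: polys_in_def lookup_minus)

lemma polys_in_single: "c \<in> F \<Longrightarrow> ks \<alpha> \<subseteq> V \<Longrightarrow> sgl \<alpha> c \<in> polys_in F V"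
  using is_subfieldD[OF F] by (auto simp: polys_in_def lookup_single when_def split: if_splits)

lemma polys_in_sum: "(\<And>a. a \<in> A \<Longrightarrow> f a \<in> polys_in F V) \<Longrightarrow> sum f A \<in> polys_in F V"
  by (induction A rule: infinite_finite_induct) (auto intro: polys_in_0 polys_in_add)

lemma polys_in_mult:
  assumes q: "q \<in> polys_in F V" and r: "r \<in> polys_in F V"
  shows "q * r \<in> polys_in F V"
proof -
  have "q * r = (\<Sum>\<alpha>\<in>ks q. sgl \<alpha> (lkp q \<alpha>)) * (\<Sum>\<beta>\<in>ks r. sgl \<beta> (lkp r \<beta>))"
    by (simp flip: mp_decompose)
  also have "\<dots> = (\<Sum>\<alpha>\<in>ks q. \<Sum>\<beta>\<in>ks r. sgl (\<alpha> + \<beta>) (lkp q \<alpha> * lkp r \<beta>))"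
    by (simp add: sum_product mult_single)
  also have "\<dots> \<in> polys_in F V"
  proof (intro polys_in_sum polys_in_single)
    show "lkp q \<alpha> * lkp r \<beta> \<in> F" for \<alpha> \<beta>
      using q r is_subfieldD(5)[OF F] polys_inD by blast
    show "ks (\<alpha> + \<beta>) \<subseteq> V" if "\<alpha> \<in> ks q" "\<beta> \<in> ks r" for \<alpha> \<beta>
      using that polys_inD(2)[OF q] polys_inD(2)[OF r] Poly_Mapping.keys_add[of \<alpha> \<beta>] by blast
  qed
  finally show ?thesis .
qed

end

lemma mpoly_eval_cong:
  "q \<in> polys_in F V \<Longrightarrow> (\<And>i. i \<in> V \<Longrightarrow> x i = y i) \<Longrightarrow> mpoly_eval x q = mpoly_eval y q"
  unfolding mpoly_eval_alt by (intro sum.cong refl arg_cong2[of _ _ _ _ "(*)"] mono_eval_cong)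
    (auto dest: polys_inD)

section \<open>Polynomials with one distinguished variable and their derivatives\<close>

lemma cf_specialise [simp]: "cf (specialise x f) k = mpoly_eval x (cf f k)"
  by (simp add: specialise_def coeff_map_poly)

lemma specialise_add: "specialise x (f + g) = specialise x f + specialise x g"
  by (rule poly_eqI) (simp add: mpoly_eval_add)

lemma specialise_0 [simp]: "specialise x 0 = 0"
  by (rule poly_eqI) simp

lemma specialise_diff: "specialise x (f - g) = specialise x f - specialise x g"
  by (rule poly_eqI) (simp add: mpoly_eval_diff)

lemma specialise_smult: "specialise x (Polynomial.smult c f) = Polynomial.smult (mpoly_eval x c) (specialise x f)"
  by (rule poly_eqI) (simp add: mpoly_eval_mult)

lemma specialise_monom: "specialise x (mnm c k) = mnm (mpoly_eval x c) k"
  by (rule poly_eqI) simp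

lemma specialise_monom_mult: "specialise x (mnm c k * f) = mnm (mpoly_eval x c) k * specialise x f"
  by (rule poly_eqI) (simp add: coeff_monom_mult mpoly_eval_mult)

lemma specialise_sum: "specialise x (sum f A) = (\<Sum>a\<in>A. specialise x (f a))"
  by (induction A rule: infinite_finite_induct) (auto simp: specialise_add)

lemma specialise_cong:
  assumes "\<And>k. cf f k \<in> polys_in F V" "\<And>i. i \<in> V \<Longrightarrow> x i = y i"
  shows "specialise x f = specialise y f"
  by (rule poly_eqI) (simp add: mpoly_eval_cong[OF assms])

text \<open>This is \<open>q\<close> as a polynomial in X_i over the remaining variables, the shape
  to which \<open>polynomial_IFT\<close> applies.\<close>

definition sep :: "nat \<Rightarrow> 'a::field mp \<Rightarrow> 'a mp poly" where
  "sep i q = (\<Sum>\<alpha>\<in>ks q. mnm (sgl (upd i 0 \<alpha>) (lkp q \<alpha>)) (lkp \<alpha> i))"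

lemma sep_superset:
  "finite S \<Longrightarrow> ks q \<subseteq> S \<Longrightarrow> sep i q = (\<Sum>\<alpha>\<in>S. mnm (sgl (upd i 0 \<alpha>) (lkp q \<alpha>)) (lkp \<alpha> i))"
  unfolding sep_def by (rule sum.mono_neutral_left) (auto simp: in_keys_iff)

lemma sep_add: "sep i (q + r) = sep i q + sep i r"
proof -
  let ?S = "ks q \<union> ks r"
  have "sep i (q + r) = (\<Sum>\<alpha>\<in>?S. mnm (sgl (upd i 0 \<alpha>) (lkp (q + r) \<alpha>)) (lkp \<alpha> i))"
    by (rule sep_superset) (simp_all add: Poly_Mapping.keys_add)
  then show ?thesis
    by (simp add: sep_superset[of ?S] lookup_add single_add sum.distrib flip: add_monom)
qed

lemma sep_single: "sep i (sgl \<alpha> c) = mnm (sgl (upd i 0 \<alpha>) c) (lkp \<alpha> i)"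
  by (subst sep_superset[of "{\<alpha>}"]) auto

lemma sep_0 [simp]: "sep i 0 = 0"
  by (simp add: sep_def)

lemma sep_sum: "sep i (sum f A) = (\<Sum>a\<in>A. sep i (f a))"
  by (induction A rule: infinite_finite_induct) (auto simp: sep_add)

lemma specialise_sep:
  "specialise x (sep i q) = (\<Sum>\<alpha>\<in>ks q. mnm (lkp q \<alpha> * mono_eval (x(i := 1)) \<alpha>) (lkp \<alpha> i))"
  by (simp add: sep_def specialise_sum specialise_monom mono_eval_upd)

lemma poly_specialise_sep: "poly (specialise x (sep i q)) t = mpoly_eval (x(i := t)) q"
  by (simp add: specialise_sep poly_sum poly_monom mpoly_eval_alt mono_eval_fun_upd[of x i t] mult.assoc)

lemma specialise_sep_cong:
  assumes "q \<in> polys_in F V" "\<And>j. j \<in> V \<Longrightarrow> j \<noteq> i \<Longrightarrow> x j = y j"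
  shows "specialise x (sep i q) = specialise y (sep i q)"
  unfolding specialise_sep
  by (intro sum.cong refl arg_cong2[of _ _ _ _ mnm] arg_cong2[of _ _ _ _ "(*)"] mono_eval_cong)
    (use assms in \<open>auto dest: polys_inD\<close>)

lemma cf_sep_in_polys_in:
  assumes F: "is_subfield F" and q: "q \<in> polys_in F V"
  shows "cf (sep i q) k \<in> polys_in F (V - {i})"
  unfolding sep_def coeff_sum coeff_monom
proof (rule polys_in_sum[OF F])
  fix \<alpha> assume "\<alpha> \<in> ks q"
  then have "ks \<alpha> \<subseteq> V" by (rule polys_inD(2)[OF q])
  then have "ks (upd i 0 \<alpha>) \<subseteq> V - {i}"
    by (auto simp: in_keys_iff lookup_upd subset_iff split: if_splits)
  then show "(if lkp \<alpha> i = k then sgl (upd i 0 \<alpha>) (lkp q \<alpha>) else 0) \<in> polys_in F (V - {i})"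
    using q by (auto intro: polys_in_single[OF F] polys_in_0[OF F] polys_inD)
qed

text \<open>If the exponents of $X_i$ in $q$ are divisible by $n$, then \<open>contract i n q\<close> is the
  polynomial $r$ with $q = r(\ldots,X_i^n,\ldots)$, and \<open>pdiv i n q\<close> is
  $(\partial r/\partial X_i)(\ldots,X_i^n,\ldots)$.\<close>

definition contract :: "nat \<Rightarrow> nat \<Rightarrow> 'a::field mp \<Rightarrow> 'a mp" where
  "contract i n q = (\<Sum>\<alpha>\<in>ks q. sgl (upd i (lkp \<alpha> i div n) \<alpha>) (lkp q \<alpha>))"

definition pdiv :: "nat \<Rightarrow> nat \<Rightarrow> 'a::field mp \<Rightarrow> 'a mp" where
  "pdiv i n q = (\<Sum>\<alpha>\<in>ks q. sgl (upd i (lkp \<alpha> i - n) \<alpha>) (of_nat (lkp \<alpha> i div n) * lkp q \<alpha>))"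

lemma contract_1: "contract i 1 q = q"
  by (simp add: contract_def flip: mp_decompose)

lemma mpoly_eval_contract:
  assumes "\<And>\<alpha>. \<alpha> \<in> ks q \<Longrightarrow> n dvd lkp \<alpha> i"
  shows "mpoly_eval (x(i := x i ^ n)) (contract i n q) = mpoly_eval x q"
proof -
  have "mono_eval (x(i := x i ^ n)) (upd i (lkp \<alpha> i div n) \<alpha>) = mono_eval x \<alpha>" if "\<alpha> \<in> ks q" for \<alpha>
    using assms[OF that] mono_eval_fun_upd[of x i "x i" \<alpha>]
    by (simp add: mono_eval_upd flip: power_mult)
  then show ?thesis by (simp add: contract_def mpoly_eval_sum mpoly_eval_alt[of x q])
qed

lemma specialise_sep_contract:
  assumes "\<And>\<alpha>. \<alpha> \<in> ks q \<Longrightarrow> n dvd lkp \<alpha> i" and "j \<noteq> i"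
  shows "specialise (x(i := x i ^ n)) (sep j (contract i n q)) = specialise x (sep j q)"
proof -
  have "mono_eval (x(i := x i ^ n, j := 1)) (upd i (lkp \<alpha> i div n) \<alpha>) = mono_eval (x(j := 1)) \<alpha>"
    if "\<alpha> \<in> ks q" for \<alpha>
  proof -
    have "x(j := 1, i := x i) = x(j := 1)" using assms(2) by auto
    then show ?thesis
      using assms(1)[OF that] assms(2) mono_eval_fun_upd[of "x(j := 1)" i "x i" \<alpha>]
      by (simp add: mono_eval_upd fun_upd_twist flip: power_mult)
  qed
  then show ?thesis using assms(2)
    by (simp add: contract_def sep_sum sep_single specialise_sum specialise_monom mono_eval_upd[of _ j]
        lookup_upd specialise_sep[of x])
qed

text \<open>X_i^(n e) contracts to Y^e, and e Y^(e-1) at Y = X_i^n is e X_i^(n e - n). The value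
  \<open>t\<close> is arbitrary because the coefficients of \<open>sep i\<close> do not involve
  X_i.\<close>

lemma mpoly_eval_pdiv:
  assumes "\<And>\<alpha>. \<alpha> \<in> ks q \<Longrightarrow> n dvd lkp \<alpha> i"
  shows "mpoly_eval x (pdiv i n q) =
    poly (pderiv (specialise (x(i := t)) (sep i (contract i n q)))) (x i ^ n)"
proof -
  have "of_nat (lkp \<alpha> i div n) * lkp q \<alpha> * mono_eval x (upd i (lkp \<alpha> i - n) \<alpha>) =
      poly (pderiv (mnm (lkp q \<alpha> * mono_eval (x(i := 1)) \<alpha>) (lkp \<alpha> i div n))) (x i ^ n)"
    if "\<alpha> \<in> ks q" for \<alpha>
  proof (cases "lkp \<alpha> i div n = 0")
    case False
    have "n * (lkp \<alpha> i div n - 1) = lkp \<alpha> i - n"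
      using assms[OF that] by (simp add: right_diff_distrib')
    then show ?thesis
      by (simp add: pderiv_monom poly_monom mono_eval_upd mult_ac flip: power_mult)
  qed (simp add: monom_0)
  moreover have "mono_eval (x(i := s)) (upd i k \<alpha>) = mono_eval (x(i := 1)) \<alpha> * s ^ k" for s k \<alpha>
    by (simp add: mono_eval_upd)
  ultimately show ?thesis
    by (simp add: pdiv_def mpoly_eval_sum contract_def sep_sum sep_single specialise_sum
        specialise_monom higher_pderiv_sum[of 1, simplified] poly_sum lookup_upd)
qed

lemma mpoly_eval_pdiv_1:
  "mpoly_eval x (pdiv i 1 q) = poly (pderiv (specialise x (sep i q))) (x i)"
  using mpoly_eval_pdiv[of q 1 i x "x i"] by (simp add: contract_1[unfolded One_nat_def])

lemma polys_in_upd: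
  assumes "\<alpha> \<in> ks q" "q \<in> polys_in F V" "k = 0 \<or> lkp \<alpha> i \<noteq> 0"
  shows "ks (upd i k \<alpha>) \<subseteq> V"
  using polys_inD(2)[OF assms(2,1)] assms(3) by (force simp: in_keys_iff lookup_upd subset_iff split: if_splits)

lemma contract_in_polys_in:
  assumes F: "is_subfield F" and q: "q \<in> polys_in F V"
  shows "contract i n q \<in> polys_in F V"
  unfolding contract_def
  by (intro polys_in_sum[OF F] polys_in_single[OF F] polys_inD[OF q] polys_in_upd[OF _ q]) auto

lemma pdiv_in_polys_in:
  assumes F: "is_subfield F" and q: "q \<in> polys_in F V"
  shows "pdiv i n q \<in> polys_in F V"
  unfolding pdiv_def
  by (intro polys_in_sum[OF F] polys_in_single[OF F] is_subfieldD(5)[OF F] is_subfield_of_nat[OF F]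
      polys_inD[OF q] polys_in_upd[OF _ q]) auto

definition deg_less :: "nat \<Rightarrow> 'a::field mp \<Rightarrow> bool" where
  "deg_less d q \<longleftrightarrow> (\<forall>\<alpha>\<in>ks q. mdeg \<alpha> < d)"

text \<open>Terms with X_i-exponent below \<open>n\<close> get the factor 0, and all others lose n >
  0 degrees. Hence such a derivative falls below the degree of a minimal relation.\<close>

lemma deg_less_pdiv:
  assumes "deg_less d q" "n > 0"
  shows "deg_less (d - 1) (pdiv i n q)"
  unfolding deg_less_def
proof
  fix \<beta> assume "\<beta> \<in> ks (pdiv i n q)"
  from subsetD[OF keys_sum this[unfolded pdiv_def]] obtain \<alpha> where \<alpha>: "\<alpha> \<in> ks q"
    "\<beta> \<in> ks (sgl (upd i (lkp \<alpha> i - n) \<alpha>) (of_nat (lkp \<alpha> i div n) * lkp q \<alpha>))" by auto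
  then have \<beta>: "\<beta> = upd i (lkp \<alpha> i - n) \<alpha>" "lkp \<alpha> i div n \<noteq> 0"
    by (auto split: if_splits intro!: gr0I)
  then have "lkp \<alpha> i \<ge> n" by (metis div_less linorder_not_less)
  moreover have "mdeg \<alpha> < d" using assms(1) \<alpha> by (auto simp: deg_less_def)
  ultimately show "mdeg \<beta> < d - 1" using mdeg_upd[of i "lkp \<alpha> i - n" \<alpha>] \<beta> assms(2) by simp
qed

text \<open>Terms cannot cancel: lowering the X_i-exponent by \<open>n\<close> is injective on the
  monomials that survive, whose exponents are at least \<open>n\<close>.\<close>

lemma pdiv_nonzero:
  fixes q :: "'a::field mp"
  assumes \<alpha>: "\<alpha> \<in> ks q" and n: "of_nat (lkp \<alpha> i div n) \<noteq> (0 :: 'a)"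
  shows "pdiv i n q \<noteq> 0"
proof
  assume "pdiv i n q = 0"
  have inj: "\<beta> = \<alpha>" if "upd i (lkp \<beta> i - n) \<beta> = upd i (lkp \<alpha> i - n) \<alpha>" "lkp \<beta> i div n \<noteq> 0" for \<beta>
  proof (rule poly_mapping_eqI)
    fix j
    have "lkp \<alpha> i div n \<noteq> 0" using n by (metis of_nat_0)
    then have "n \<le> lkp \<alpha> i" "n \<le> lkp \<beta> i" using that(2) by (metis div_less linorder_not_less)+
    then show "lkp \<beta> j = lkp \<alpha> j"
      using arg_cong[OF that(1), of "\<lambda>\<gamma>. lkp \<gamma> j"] by (auto simp: lookup_upd split: if_splits)
  qed
  have "0 = lkp (pdiv i n q) (upd i (lkp \<alpha> i - n) \<alpha>)" using \<open>pdiv i n q = 0\<close> by simp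
  also have "\<dots> = (\<Sum>\<beta>\<in>ks q. if \<beta> = \<alpha> then of_nat (lkp \<alpha> i div n) * lkp q \<alpha> else 0)"
    unfolding pdiv_def lookup_sum
  proof (rule sum.cong)
    fix \<beta>
    show "lkp (sgl (upd i (lkp \<beta> i - n) \<beta>) (of_nat (lkp \<beta> i div n) * lkp q \<beta>)) (upd i (lkp \<alpha> i - n) \<alpha>) =
      (if \<beta> = \<alpha> then of_nat (lkp \<alpha> i div n) * lkp q \<alpha> else 0)"
      using inj[of \<beta>] by (cases "lkp \<beta> i div n = 0") (use n in \<open>auto simp: lookup_single when_def\<close>)
  qed simp
  also have "\<dots> = of_nat (lkp \<alpha> i div n) * lkp q \<alpha>" using \<alpha> by simp
  finally show False using n \<alpha> by (simp add: in_keys_iff)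
qed

lemma polys_in_0_vars:
  assumes "q \<in> polys_in F V" "\<And>\<alpha>. \<alpha> \<in> ks q \<Longrightarrow> \<alpha> = 0"
  shows "mpoly_eval x q = lkp q 0" "lkp q 0 = 0 \<Longrightarrow> q = 0"
proof -
  show "mpoly_eval x q = lkp q 0"
    using assms(2) by (subst mpoly_eval_superset[of "{0}"]) auto
  show "q = 0" if "lkp q 0 = 0"
    by (rule poly_mapping_eqI) (use that assms(2) in \<open>auto simp: in_keys_iff\<close>)
qed

context field_topology
begin

lemma filterlim_const: "filterlim (\<lambda>_. c) (nhdsin \<tau> c) F"
  by (auto simp: filterlim_iff eventually_nhdsin)

lemma filterlim_sum:
  "(\<And>i. i \<in> I \<Longrightarrow> filterlim (f i) (nhdsin \<tau> (a i)) F) \<Longrightarrow>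
    filterlim (\<lambda>x. \<Sum>i\<in>I. f i x) (nhdsin \<tau> (\<Sum>i\<in>I. a i)) F"
  by (induction I rule: infinite_finite_induct) (simp_all add: filterlim_const filterlim_plus)

lemma filterlim_power:
  "filterlim f (nhdsin \<tau> a) F \<Longrightarrow> filterlim (\<lambda>x. f x ^ n) (nhdsin \<tau> (a ^ n)) F"
  by (induction n) (simp_all add: filterlim_const filterlim_times)

lemma filterlim_prod:
  "(\<And>i. i \<in> I \<Longrightarrow> filterlim (f i) (nhdsin \<tau> (a i)) F) \<Longrightarrow>
    filterlim (\<lambda>x. \<Prod>i\<in>I. f i x) (nhdsin \<tau> (\<Prod>i\<in>I. a i)) F"
  by (induction I rule: infinite_finite_induct) (simp_all add: filterlim_const filterlim_times)

end

section \<open>Relations between the coordinates of a generic point\<close>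

text \<open>An ultrafilter on the points plays the role of a point over an elementary extension of the
  ground field: \<open>Z q\<close> says that the polynomial \<open>q\<close> vanishes at it.\<close>

locale generic_point =
  fixes F :: "'a::field set" and \<U> :: "(nat \<Rightarrow> 'a) filter"
  assumes F: "is_subfield F" and p_disjoint: "p_disjoint F"
    and proper: "\<U> \<noteq> bot"
    and ultra: "\<And>P. eventually P \<U> \<or> eventually (\<lambda>x. \<not> P x) \<U>"
begin

definition Z :: "'a mp \<Rightarrow> bool" where
  "Z q \<longleftrightarrow> eventually (\<lambda>x. mpoly_eval x q = 0) \<U>"

definition ZP :: "nat \<Rightarrow> 'a mp poly \<Rightarrow> bool" where
  "ZP j f \<longleftrightarrow> eventually (\<lambda>x. poly (specialise x f) (x j) = 0) \<U>"

definition DZP :: "nat \<Rightarrow> 'a mp poly \<Rightarrow> bool" where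
  "DZP j f \<longleftrightarrow> eventually (\<lambda>x. poly (pderiv (specialise x f)) (x j) = 0) \<U>"

lemma not_Z: "\<not> Z q \<longleftrightarrow> eventually (\<lambda>x. mpoly_eval x q \<noteq> 0) \<U>"
proof
  assume "eventually (\<lambda>x. mpoly_eval x q \<noteq> 0) \<U>"
  show "\<not> Z q"
  proof
    assume "Z q"
    from this[unfolded Z_def] \<open>eventually (\<lambda>x. mpoly_eval x q \<noteq> 0) \<U>\<close>
    have "eventually (\<lambda>x. False) \<U>" by eventually_elim simp
    then show False using proper by simp
  qed
qed (use ultra in \<open>auto simp: Z_def\<close>)

lemma not_DZP: "\<not> DZP j f \<Longrightarrow> eventually (\<lambda>x. poly (pderiv (specialise x f)) (x j) \<noteq> 0) \<U>"
  using ultra by (auto simp: DZP_def)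

definition indep :: "nat set \<Rightarrow> bool" where
  "indep V \<longleftrightarrow> (\<forall>q\<in>polys_in F V. Z q \<longrightarrow> q = 0)"

lemma Z_const:
  assumes "q \<in> polys_in F V" "\<And>\<alpha>. \<alpha> \<in> ks q \<Longrightarrow> \<alpha> = 0" "Z q"
  shows "q = 0"
proof -
  from assms(3) have "eventually (\<lambda>x. lkp q 0 = 0) \<U>"
    unfolding Z_def using polys_in_0_vars(1)[OF assms(1,2)] by simp
  then have "lkp q 0 = 0" using proper by (simp add: eventually_const_iff)
  then show ?thesis using polys_in_0_vars(2)[OF assms(1,2)] by blast
qed

definition shrink :: "nat \<Rightarrow> (nat \<Rightarrow>\<^sub>0 nat) \<Rightarrow> (nat \<Rightarrow>\<^sub>0 nat)" where
  "shrink n \<alpha> = Poly_Mapping.map (\<lambda>k. k div n) \<alpha>"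

lemma lookup_shrink [simp]: "lkp (shrink n \<alpha>) i = lkp \<alpha> i div n"
  by (simp add: shrink_def Poly_Mapping.map.rep_eq when_def)

lemma keys_shrink: "ks (shrink n \<alpha>) \<subseteq> ks \<alpha>"
  by (auto simp: in_keys_iff intro!: gr0I)

lemma mono_eval_shrink:
  assumes "\<And>i. n dvd lkp \<alpha> i"
  shows "mono_eval x (shrink n \<alpha>) ^ n = mono_eval x \<alpha>"
proof -
  have "mono_eval x (shrink n \<alpha>) = (\<Prod>i\<in>ks \<alpha>. x i ^ (lkp \<alpha> i div n))"
    using mono_eval_superset[OF _ keys_shrink] by simp
  then have "mono_eval x (shrink n \<alpha>) ^ n = (\<Prod>i\<in>ks \<alpha>. x i ^ (lkp \<alpha> i div n * n))"
    by (simp add: prod_power_distrib power_mult)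
  then show ?thesis using assms by (simp add: mono_eval_def)
qed

text \<open>Expanding the coefficients of \<open>q\<close> in a basis over $F^p$ that is independent over $K^p$
  splits \<open>q\<close> into $p$-th powers, all of which must vanish.\<close>

lemma frob_root_relation:
  assumes q: "q \<in> polys_in F V" "q \<noteq> 0" "Z q"
    and dvd: "\<And>\<alpha> i. \<alpha> \<in> ks q \<Longrightarrow> char_exponent TYPE('a) dvd lkp \<alpha> i"
  obtains g where "g \<in> polys_in F V" "g \<noteq> 0" "Z g"
    "ks g \<subseteq> shrink (char_exponent TYPE('a)) ` ks q"
proof -
  let ?p = "char_exponent TYPE('a)"
  let ?S = "lkp q ` ks q"
  have frobF: "is_subfield (frob 1 ` F)" using F by (rule is_subfield_frob)
  obtain T where T: "T \<subseteq> ?S" "lin_indep_over (frob 1 ` F) T" "?S \<subseteq> span_over (frob 1 ` F) T"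
    using finite_basis[OF frobF, of ?S] by auto
  have finT: "finite T" using T(1) by (rule finite_subset) simp
  have "T \<subseteq> F" using T(1) polys_inD(1)[OF q(1)] by blast
  then have T': "lin_indep_over (range (frob 1)) T"
    using p_disjoint T(2) unfolding p_disjoint_def linearly_disjoint_def by blast
  have "\<exists>e. (\<forall>t\<in>T. e t \<in> F) \<and> lkp q \<alpha> = (\<Sum>t\<in>T. frob 1 (e t) * t)" if "\<alpha> \<in> ks q" for \<alpha>
  proof -
    have "lkp q \<alpha> \<in> span_over (frob 1 ` F) T" using T(3) that by blast
    then obtain c where c: "\<And>t. t \<in> T \<Longrightarrow> c t \<in> frob 1 ` F" "lkp q \<alpha> = (\<Sum>t\<in>T. c t * t)"
      by (rule span_overE) blast
    have "\<exists>e. \<forall>t\<in>T. c t = frob 1 (e t) \<and> e t \<in> F"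
      by (rule bchoice) (use c(1) in auto)
    then obtain e where "\<forall>t\<in>T. c t = frob 1 (e t) \<and> e t \<in> F" by blast
    then show ?thesis using c(2) by (intro exI[of _ e]) simp
  qed
  then obtain e where e: "\<And>\<alpha> t. \<alpha> \<in> ks q \<Longrightarrow> t \<in> T \<Longrightarrow> e \<alpha> t \<in> F"
    "\<And>\<alpha>. \<alpha> \<in> ks q \<Longrightarrow> lkp q \<alpha> = (\<Sum>t\<in>T. frob 1 (e \<alpha> t) * t)"
    by metis
  define g where "g t = (\<Sum>\<alpha>\<in>ks q. sgl (shrink ?p \<alpha>) (e \<alpha> t))" for t
  have g_in: "g t \<in> polys_in F V" if "t \<in> T" for t
    unfolding g_def using that e(1) keys_shrink polys_inD(2)[OF q(1)]
    by (intro polys_in_sum[OF F] polys_in_single[OF F]) blast+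
  have eval: "mpoly_eval x q = (\<Sum>t\<in>T. frob 1 (mpoly_eval x (g t)) * t)" for x
  proof -
    have "frob 1 (mpoly_eval x (g t)) = (\<Sum>\<alpha>\<in>ks q. frob 1 (e \<alpha> t) * mono_eval x \<alpha>)" for t
    proof -
      have "frob 1 (mono_eval x (shrink ?p \<alpha>)) = mono_eval x \<alpha>" if "\<alpha> \<in> ks q" for \<alpha>
        using mono_eval_shrink[of ?p \<alpha> x] dvd[OF that] by (simp add: frob_def)
      then show ?thesis by (simp add: g_def mpoly_eval_sum frob_sum frob_mult)
    qed
    then have "(\<Sum>t\<in>T. frob 1 (mpoly_eval x (g t)) * t) =
        (\<Sum>\<alpha>\<in>ks q. \<Sum>t\<in>T. frob 1 (e \<alpha> t) * mono_eval x \<alpha> * t)"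
      by (subst sum.swap) (simp add: sum_distrib_right)
    also have "\<dots> = mpoly_eval x q"
      unfolding mpoly_eval_alt
      by (intro sum.cong refl) (simp add: e(2) sum_distrib_left mult_ac)
    finally show ?thesis by simp
  qed
  have Zg: "Z (g t)" if "t \<in> T" for t
    unfolding Z_def using q(3)[unfolded Z_def]
  proof eventually_elim
    case (elim x)
    then have "frob 1 (mpoly_eval x (g t)) = 0"
      using finT that eval[of x] by (intro lin_indep_overD[OF T', of T "\<lambda>t. frob 1 (mpoly_eval x (g t))"]) auto
    then show ?case by simp
  qed
  \<comment> \<open>A nonzero coefficient of \<open>q\<close> has a nonzero component
    \<open>e \<alpha> t\<close>. As \<open>shrink\<close> is injective on exponents divisible by p,
    this component remains a coefficient of \<open>g t\<close>.\<close>
  obtain \<alpha> where \<alpha>: "\<alpha> \<in> ks q" using q(2) by (metis ex_in_conv keys_eq_empty)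
  then have "lkp q \<alpha> \<noteq> 0" by (simp add: in_keys_iff)
  then obtain t where t: "t \<in> T" "e \<alpha> t \<noteq> 0"
    using e(2)[OF \<alpha>] by (metis (no_types, lifting) frob_0 mult_zero_left sum.neutral)
  have "lkp (g t) (shrink ?p \<alpha>) = (\<Sum>\<beta>\<in>ks q. if \<beta> = \<alpha> then e \<alpha> t else 0)"
    unfolding g_def lookup_sum
  proof (rule sum.cong)
    fix \<beta> assume \<beta>: "\<beta> \<in> ks q"
    have "\<beta> = \<alpha>" if eq: "shrink ?p \<beta> = shrink ?p \<alpha>"
    proof (rule poly_mapping_eqI)
      fix i
      have "lkp \<beta> i div ?p = lkp \<alpha> i div ?p" using arg_cong[OF eq, of "\<lambda>\<gamma>. lkp \<gamma> i"] by simp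
      then show "lkp \<beta> i = lkp \<alpha> i" using dvd[OF \<alpha>, of i] dvd[OF \<beta>, of i] by (metis dvd_div_mult_self)
    qed
    then show "lkp (sgl (shrink ?p \<beta>) (e \<beta> t)) (shrink ?p \<alpha>) = (if \<beta> = \<alpha> then e \<alpha> t else 0)"
      by (auto simp: lookup_single when_def)
  qed simp
  then have "lkp (g t) (shrink ?p \<alpha>) \<noteq> 0" using \<alpha> t by simp
  then have "g t \<noteq> 0" by auto
  moreover have "ks (g t) \<subseteq> shrink ?p ` ks q"
    unfolding g_def by (rule order.trans[OF keys_sum]) (auto split: if_splits)
  ultimately show thesis using that[of "g t"] g_in Zg t(1) by blast
qed

text \<open>Since \<open>deg_less\<close> is a strict bound, a nonzero \<open>q\<close> has total
  degree d - 1, the least degree of a nonzero relation in \<open>V\<close>.\<close>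

definition minimal_relation :: "nat set \<Rightarrow> nat \<Rightarrow> 'a mp \<Rightarrow> bool" where
  "minimal_relation V d q \<longleftrightarrow> q \<in> polys_in F V \<and> deg_less d q \<and> Z q \<and>
     (\<forall>r\<in>polys_in F V. deg_less (d - 1) r \<longrightarrow> Z r \<longrightarrow> r = 0)"

text \<open>A relation of minimal degree has a nonvanishing partial derivative, because otherwise all its
  exponents are divisible by $p$ and it is not minimal.\<close>

lemma minimal_relation_exists:
  assumes "\<not> indep V"
  obtains d q i where "minimal_relation V d q" "i \<in> V" "\<not> Z (pdiv i 1 q)"
proof -
  let ?p = "char_exponent TYPE('a)"
  define Q where "Q d \<longleftrightarrow> (\<exists>q\<in>polys_in F V. deg_less d q \<and> Z q \<and> q \<noteq> 0)" for d
  have "\<exists>d. Q d"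
  proof -
    obtain q where q: "q \<in> polys_in F V" "Z q" "q \<noteq> 0" using assms by (auto simp: indep_def)
    have "deg_less (Suc (Max (mdeg ` ks q))) q" by (auto simp: deg_less_def less_Suc_eq_le)
    then show ?thesis using q unfolding Q_def by blast
  qed
  define d where "d = (LEAST d. Q d)"
  have "Q d" unfolding d_def using \<open>\<exists>d. Q d\<close> by (rule LeastI_ex)
  then obtain q where q: "q \<in> polys_in F V" "deg_less d q" "Z q" "q \<noteq> 0" unfolding Q_def by blast
  obtain \<alpha> where \<alpha>: "\<alpha> \<in> ks q" "\<alpha> \<noteq> 0" using Z_const[OF q(1) _ q(3)] q(4) by blast
  \<comment> \<open>Nonzero constants are not relations, so the least degree d - 1 is
    positive.\<close>
  have d2: "d \<ge> 2"
  proof -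
    have "0 < mdeg \<alpha>" "mdeg \<alpha> < d" using \<alpha> q(2) mdeg_eq_0_iff[of \<alpha>] by (auto simp: deg_less_def)
    then show ?thesis by simp
  qed
  have "\<not> Q (d - 1)" using not_less_Least[of "d - 1" Q] d2 unfolding d_def by simp
  then have min: "r = 0" if "r \<in> polys_in F V" "deg_less (d - 1) r" "Z r" for r
    using that unfolding Q_def by blast
  have "\<exists>i\<in>V. \<not> Z (pdiv i 1 q)"
  proof (rule ccontr)
    assume "\<not> ?thesis"
    then have "pdiv i 1 q = 0" if "i \<in> V" for i
      using that q pdiv_in_polys_in[OF F q(1)] deg_less_pdiv[OF q(2)] min by simp
    then have "of_nat (lkp \<beta> i) = (0 :: 'a)" if "\<beta> \<in> ks q" "i \<in> V" for \<beta> i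
      using pdiv_nonzero[of \<beta> q i 1] that by auto
    then have char: "CHAR('a) dvd lkp \<beta> i" if "\<beta> \<in> ks q" for \<beta> i
    proof (cases "i \<in> V")
      case False
      then have "i \<notin> ks \<beta>" using polys_inD(2)[OF q(1) that] by blast
      then show ?thesis by (simp add: in_keys_iff)
    qed (use that in \<open>simp add: of_nat_eq_0_iff_char_dvd\<close>)
    show False
    proof (cases "CHAR('a) = 0")
      case True
      then have "\<alpha> = 0" using char[OF \<alpha>(1)] by (intro poly_mapping_eqI) simp
      then show False using \<alpha> by simp
    next
      case False
      then have p: "?p = CHAR('a)" by (simp add: char_exponent_def)
      have "CHAR('a) \<ge> 2" using CHAR_cases[where 'a='a] False prime_ge_2_nat by blast
      obtain g where g: "g \<in> polys_in F V" "g \<noteq> 0" "Z g" "ks g \<subseteq> shrink ?p ` ks q"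
        using frob_root_relation[OF q(1,4,3)] char unfolding p by blast
      \<comment> \<open>Passing to a p-th root at least halves the degree; with d \<ge> 2 the result
        is below d - 1.\<close>
      have "deg_less (d - 1) g" unfolding deg_less_def
      proof
        fix \<beta> assume "\<beta> \<in> ks g"
        then obtain \<gamma> where \<gamma>: "\<gamma> \<in> ks q" "\<beta> = shrink ?p \<gamma>" using g(4) by blast
        have "mdeg \<beta> = (\<Sum>i\<in>ks \<gamma>. lkp \<gamma> i div ?p)"
          unfolding \<gamma>(2) using mdeg_superset[OF _ keys_shrink] by simp
        then have "2 * mdeg \<beta> \<le> ?p * (\<Sum>i\<in>ks \<gamma>. lkp \<gamma> i div ?p)"
          using \<open>CHAR('a) \<ge> 2\<close> p by simp
        also have "\<dots> = mdeg \<gamma>"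
          unfolding mdeg_def sum_distrib_left using char[OF \<gamma>(1)] p by (intro sum.cong) auto
        also have "\<dots> < d" using q(2) \<gamma>(1) by (auto simp: deg_less_def)
        finally show "mdeg \<beta> < d - 1" using d2 by linarith
      qed
      then show False using min g by blast
    qed
  qed
  then show thesis using that[of d q] q min unfolding minimal_relation_def by blast
qed

section \<open>Separable steps, pseudo-division and towers\<close>

definition coeffs_in :: "nat set \<Rightarrow> 'a mp poly \<Rightarrow> bool" where
  "coeffs_in V f \<longleftrightarrow> (\<forall>k. cf f k \<in> polys_in F V)"

text \<open>\<open>step V j P\<close>: the \<open>j\<close>-th coordinate is separable over the field generated by the coordinates
  in \<open>V\<close>, and \<open>P\<close> is its minimal polynomial with denominators cleared.\<close>

definition step :: "nat set \<Rightarrow> nat \<Rightarrow> 'a mp poly \<Rightarrow> bool" where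
  "step V j P \<longleftrightarrow> j \<notin> V \<and> coeffs_in V P \<and> ZP j P \<and> \<not> DZP j P \<and> \<not> Z (Polynomial.lead_coeff P) \<and>
     (\<forall>Q. coeffs_in V Q \<longrightarrow> Polynomial.degree Q < Polynomial.degree P \<longrightarrow> ZP j Q \<longrightarrow> (\<forall>k. Z (cf Q k)))"

text \<open>Pseudo-division by \<open>P\<close> works without denominators and lowers the degree,
  until minimality of \<open>P\<close> forces all coefficients to vanish generically. A property is
  pulled back through each reduction, because the leading coefficient of \<open>P\<close> is
  generically nonzero. This serves both for derivatives and for vanishing along curves.\<close>

lemma pseudo_division_induct:
  assumes P: "coeffs_in V P" "ZP j P" "\<not> Z (Polynomial.lead_coeff P)"
    and min: "\<And>Q. coeffs_in V Q \<Longrightarrow> Polynomial.degree Q < Polynomial.degree P \<Longrightarrow> ZP j Q \<Longrightarrow> \<forall>k. Z (cf Q k)"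
    and Q: "coeffs_in V Q" "ZP j Q"
    and base: "\<And>Q. coeffs_in V Q \<Longrightarrow> (\<And>k. Z (cf Q k)) \<Longrightarrow> R Q"
    and reduce: "\<And>Q a k. coeffs_in V Q \<Longrightarrow> a \<in> polys_in F V \<Longrightarrow>
      R (Polynomial.smult (Polynomial.lead_coeff P) Q - mnm a k * P) \<Longrightarrow> R Q"
  shows "R Q"
  using Q
proof (induction "Polynomial.degree Q" arbitrary: Q rule: less_induct)
  case less
  show ?case
  proof (cases "Polynomial.degree Q < Polynomial.degree P")
    case True
    then show ?thesis using base min less.prems by blast
  next
    case False
    \<comment> \<open>A constant \<open>P\<close> would make its leading coefficient vanish.
      Positivity ensures that the reduction lowers the degree strictly.\<close>
    have "Polynomial.degree P > 0"
    proof (rule ccontr)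
      assume "\<not> Polynomial.degree P > 0"
      then have "poly (specialise x P) t = mpoly_eval x (Polynomial.lead_coeff P)" for x t
      proof -
        have "specialise x P = [:mpoly_eval x (cf P 0):]"
          using \<open>\<not> Polynomial.degree P > 0\<close> by (intro poly_eqI) (auto simp: coeff_pCons coeff_eq_0 split: nat.split)
        then show ?thesis using \<open>\<not> Polynomial.degree P > 0\<close> by simp
      qed
      then show False using P(2,3) by (simp add: ZP_def Z_def)
    qed
    define k where "k = Polynomial.degree Q - Polynomial.degree P"
    define Q' where "Q' = Polynomial.smult (Polynomial.lead_coeff P) Q - mnm (Polynomial.lead_coeff Q) k * P"
    have k: "Polynomial.degree Q = k + Polynomial.degree P" using False by (simp add: k_def)
    have cf_Q': "cf Q' n = Polynomial.lead_coeff P * cf Q n - (if n < k then 0 else Polynomial.lead_coeff Q * cf P (n - k))" for n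
      by (simp add: Q'_def coeff_monom_mult)
    have "Polynomial.degree Q' \<le> Polynomial.degree Q - 1"
    proof (rule degree_le, intro allI impI)
      fix n assume n: "Polynomial.degree Q - 1 < n"
      show "cf Q' n = 0"
      proof (cases "n = Polynomial.degree Q")
        case True
        then show ?thesis using k by (simp add: cf_Q' mult.commute)
      next
        case False
        then have "n > Polynomial.degree Q" "n - k > Polynomial.degree P" using n k by auto
        then show ?thesis by (simp add: cf_Q' coeff_eq_0)
      qed
    qed
    then have deg: "Polynomial.degree Q' < Polynomial.degree Q"
      using k \<open>Polynomial.degree P > 0\<close> by linarith
    have in': "coeffs_in V Q'"
      using P(1) less.prems(1) polys_in_mult[OF F] polys_in_diff[OF F] polys_in_0[OF F]
      unfolding coeffs_in_def cf_Q' by simp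
    have "ZP j Q'"
      unfolding ZP_def using P(2)[unfolded ZP_def] less.prems(2)[unfolded ZP_def]
      by eventually_elim (simp add: Q'_def specialise_diff specialise_smult specialise_monom_mult)
    then have "R Q'" using less.hyps[OF deg in'] by blast
    then show ?thesis unfolding Q'_def
      using reduce less.prems(1) unfolding coeffs_in_def by blast
  qed
qed

text \<open>Take \<open>P\<close> of least degree among the polynomials with root \<open>j\<close>
  and some nonvanishing coefficient. If its derivative vanished at the root, pseudo-division would
  pass this on to every polynomial with that root, including \<open>f\<close>.\<close>

lemma step_exists:
  assumes j: "j \<notin> V" and f: "coeffs_in V f" "ZP j f" "\<not> DZP j f"
  obtains P where "step V j P"
proof -
  define G where "G Q \<longleftrightarrow> coeffs_in V Q \<and> ZP j Q \<and> (\<exists>k. \<not> Z (cf Q k))" for Q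
  have all_Z: "DZP j Q" if "\<And>k. Z (cf Q k)" for Q
  proof -
    have "eventually (\<lambda>x. \<forall>k\<in>{..Polynomial.degree Q}. mpoly_eval x (cf Q k) = 0) \<U>"
      using that by (intro eventually_ball_finite) (auto simp: Z_def)
    then show ?thesis unfolding DZP_def
    proof eventually_elim
      case (elim x)
      have "specialise x Q = 0"
      proof (rule poly_eqI)
        show "cf (specialise x Q) k = cf 0 k" for k
          using elim by (cases "k \<le> Polynomial.degree Q") (auto simp: coeff_eq_0)
      qed
      then show ?case by simp
    qed
  qed
  have "G f" using f all_Z unfolding G_def by blast
  then obtain P where P: "G P" "\<And>Q. Polynomial.degree Q < Polynomial.degree P \<Longrightarrow> \<not> G Q"
    using ex_has_least_nat[of G f Polynomial.degree] by (metis linorder_not_less)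
  have P': "coeffs_in V P" "ZP j P" using P(1) by (auto simp: G_def)
  have min: "\<forall>k. Z (cf Q k)" if "coeffs_in V Q" "Polynomial.degree Q < Polynomial.degree P" "ZP j Q" for Q
    using P(2)[OF that(2)] that unfolding G_def by blast
  have lead: "\<not> Z (Polynomial.lead_coeff P)"
  proof
    assume Z: "Z (Polynomial.lead_coeff P)"
    obtain k where k: "\<not> Z (cf P k)" using P(1) by (auto simp: G_def)
    define Q where "Q = P - mnm (Polynomial.lead_coeff P) (Polynomial.degree P)"
    have cf_Q: "cf Q n = (if n = Polynomial.degree P then 0 else cf P n)" for n
      by (simp add: Q_def)
    have kdeg: "k < Polynomial.degree P"
    proof (rule ccontr)
      assume "\<not> k < Polynomial.degree P"
      then have "k = Polynomial.degree P \<or> cf P k = 0"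
        using coeff_eq_0[of P k] by (cases "k = Polynomial.degree P") auto
      then show False using k Z by (auto simp: Z_def)
    qed
    have "Polynomial.degree Q \<le> Polynomial.degree P - 1"
      by (rule degree_le) (auto simp: cf_Q coeff_eq_0)
    then have "Polynomial.degree Q < Polynomial.degree P" using kdeg by linarith
    moreover have "coeffs_in V Q" using P'(1) polys_in_0[OF F] by (simp add: coeffs_in_def cf_Q)
    moreover have "ZP j Q"
      unfolding ZP_def using P'(2)[unfolded ZP_def] Z[unfolded Z_def]
      by eventually_elim (simp add: Q_def specialise_diff specialise_monom)
    ultimately have "Z (cf Q k)" using min by blast
    then show False using k kdeg by (simp add: cf_Q)
  qed
  have "\<not> DZP j P"
  proof
    assume D: "DZP j P"
    \<comment> \<open>Where \<open>P\<close> and its derivative vanish, differentiating the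
      reduction of \<open>Q\<close> leaves only the leading coefficient of \<open>P\<close> times
      the derivative of \<open>Q\<close>.\<close>
    have "DZP j f"
    proof (rule pseudo_division_induct[OF P' lead min f(1,2), of "DZP j"])
      show "DZP j Q" if "\<And>k. Z (cf Q k)" for Q using that by (rule all_Z)
    next
      fix Q a k
      assume *: "DZP j (Polynomial.smult (Polynomial.lead_coeff P) Q - mnm a k * P)"
      show "DZP j Q"
        unfolding DZP_def
        using *[unfolded DZP_def] lead[unfolded not_Z] D[unfolded DZP_def] P'(2)[unfolded ZP_def]
        by eventually_elim
          (simp add: specialise_diff specialise_smult specialise_monom_mult pderiv_diff pderiv_smult pderiv_mult)
    qed
    then show False using f(3) by simp
  qed
  then show thesis using that[of P] j P' lead min unfolding step_def by blast
qed

text \<open>The head of the list lies directly above the basis; each later entry may use the basis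
  and all earlier entries.\<close>

fun tower :: "nat set \<Rightarrow> (nat \<times> 'a mp poly) list \<Rightarrow> bool" where
  "tower V [] \<longleftrightarrow> True"
| "tower V ((j, P) # r) \<longleftrightarrow> step V j P \<and> tower (insert j V) r"

lemma tower_snoc: "tower V (r @ [(j, P)]) \<longleftrightarrow> tower V r \<and> step (V \<union> fst ` set r) j P"
  by (induction V r rule: tower.induct) auto

lemma step_of_relation:
  assumes q: "q \<in> polys_in F W" "Z q" and i: "i \<in> W" "\<not> Z (pdiv i 1 q)" and W: "W \<subseteq> B"
  obtains P where "step (B - {i}) i P"
proof -
  have "coeffs_in (B - {i}) (sep i q)"
    using cf_sep_in_polys_in[OF F q(1)] polys_in_mono W unfolding coeffs_in_def by blast
  moreover have "ZP i (sep i q)" using q(2) by (simp add: ZP_def poly_specialise_sep Z_def)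
  moreover have "\<not> DZP i (sep i q)" using i(2) by (simp add: DZP_def Z_def mpoly_eval_pdiv_1[unfolded One_nat_def])
  ultimately show thesis using step_exists[of i "B - {i}"] that by blast
qed

text \<open>The coordinate \<open>0\<close> is removed from the transcendence basis only as a last resort; this leaves
  it directly after the basis.\<close>

lemma tower_exists:
  assumes "finite B" "0 \<in> B" "tower B r"
  obtains B' r' where "finite B'" "B' \<union> fst ` set r' = B \<union> fst ` set r" "tower B' r'" "indep B'"
    "0 \<in> B' \<or> (\<exists>P r'' d q. r' = (0, P) # r'' \<and> 0 \<notin> B' \<and>
       minimal_relation (insert 0 B') d q \<and> \<not> Z (pdiv 0 1 q))"
  using assms
proof (induction "card B" arbitrary: B r thesis rule: less_induct)
  case less
  note B = less.prems(2-)
  \<comment> \<open>The removed coordinate becomes the new head, after which the old tower continues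
    over \<open>B\<close>.\<close>
  have remove: thesis if W: "W \<subseteq> B" and m: "minimal_relation W d q"
    and i: "i \<in> W" "\<not> Z (pdiv i 1 q)" "i \<noteq> 0" for W d q i
  proof -
    obtain P where P: "step (B - {i}) i P"
      using step_of_relation[OF _ _ i(1,2) W] m unfolding minimal_relation_def by blast
    have iB: "i \<in> B" using i W by blast
    then have "insert i (B - {i}) = B" by blast
    then have tow: "tower (B - {i}) ((i, P) # r)" using P B(3) by simp
    have card: "card (B - {i}) < card B" using B(1) iB by (metis card_Diff1_less)
    show thesis
    proof (rule less.hyps[OF card _ _ _ tow])
      fix B' r'
      assume "finite B'" "B' \<union> fst ` set r' = B - {i} \<union> fst ` set ((i, P) # r)" "tower B' r'"
        "indep B'" and last: "0 \<in> B' \<or> (\<exists>P r'' d q. r' = (0, P) # r'' \<and> 0 \<notin> B' \<and>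
       minimal_relation (insert 0 B') d q \<and> \<not> Z (pdiv 0 1 q))"
      moreover have "B - {i} \<union> fst ` set ((i, P) # r) = B \<union> fst ` set r" using iB by auto
      ultimately show thesis by (intro less.prems(1)[of B' r']) auto
    qed (use B i in auto)
  qed
  show ?case
  proof (cases "indep B")
    case True
    then show ?thesis using less.prems by blast
  next
    case dep: False
    show ?thesis
    proof (cases "indep (B - {0})")
      case False
      obtain d q i where "minimal_relation (B - {0}) d q" "i \<in> B - {0}" "\<not> Z (pdiv i 1 q)"
        using minimal_relation_exists[OF False] by metis
      then show ?thesis using remove[of "B - {0}" d q i] by blast
    next
      case True
      obtain d q i where m: "minimal_relation B d q" "i \<in> B" "\<not> Z (pdiv i 1 q)"
        using minimal_relation_exists[OF dep] by metis
      show ?thesis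
      proof (cases "i = 0")
        case False
        then show ?thesis using remove[of B d q i] m by blast
      next
        case i0: True
        \<comment> \<open>Here \<open>B - {0}\<close> is independent, so the process stops and
          coordinate 0 stays at the head, together with its minimal relation.\<close>
        obtain P where P: "step (B - {0}) 0 P"
          using step_of_relation[of q B 0 B] m i0 unfolding minimal_relation_def by auto
        have eq: "insert 0 (B - {0}) = B" using B(2) by blast
        show ?thesis
        proof (rule less.prems(1)[of "B - {0}" "(0, P) # r"])
          show "0 \<in> B - {0} \<or> (\<exists>P' r'' d q. (0, P) # r = (0, P') # r'' \<and> 0 \<notin> B - {0} \<and>
            minimal_relation (insert 0 (B - {0})) d q \<and> \<not> Z (pdiv 0 1 q))"
            unfolding eq using m i0 by blast
          show "tower (B - {0}) ((0, P) # r)" using P B(3) eq by simp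
        qed (use B True in auto)
      qed
    qed
  qed
qed

end

section \<open>Curves through a generic point\<close>

text \<open>Only the first \<open>N\<close> coordinates are constrained. This avoids the extensional
  functions of the product topology when points are modified in single coordinates.\<close>

definition nhds_point :: "'a topology \<Rightarrow> nat \<Rightarrow> (nat \<Rightarrow> 'a) \<Rightarrow> (nat \<Rightarrow> 'a) filter" where
  "nhds_point \<tau> N e = (INF k\<in>{..<N}. filtercomap (\<lambda>y. y k) (nhdsin \<tau> (e k)))"

lemma filterlim_nhds_point:
  "filterlim y (nhds_point \<tau> N e) G \<longleftrightarrow> (\<forall>k<N. filterlim (\<lambda>s. y s k) (nhdsin \<tau> (e k)) G)"
  by (simp add: nhds_point_def filterlim_INF filterlim_filtercomap_iff o_def Ball_def)

lemma eventually_nhds_point: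
  assumes "k < N" "eventually P (nhdsin \<tau> (e k))"
  shows "eventually (\<lambda>y. P (y k)) (nhds_point \<tau> N e)"
proof -
  have "filterlim (\<lambda>y. y k) (nhdsin \<tau> (e k)) (nhds_point \<tau> N e)"
    using filterlim_nhds_point[of "\<lambda>y. y" \<tau> N e "nhds_point \<tau> N e"] assms(1) filterlim_ident by auto
  then show ?thesis using assms(2) by (auto simp: filterlim_iff)
qed

lemma mpoly_vars_below_iff: "mpoly_vars_below N q \<longleftrightarrow> q \<in> polys_in UNIV {..<N}"
  by (simp add: mpoly_vars_below_def polys_in_def)

lemma polys_in_UNIV: "q \<in> polys_in F V \<Longrightarrow> q \<in> polys_in UNIV V"
  by (simp add: polys_in_def)

lemma specialise_altdef:
  "specialise x f = (\<Sum>k\<le>Polynomial.degree f. mnm (mpoly_eval x (cf f k)) k)"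
  by (subst poly_as_sum_of_monoms[symmetric]) (simp only: specialise_sum specialise_monom)

context field_topology
begin

lemma eventually_open: "openin \<tau> U \<Longrightarrow> a \<in> U \<Longrightarrow> eventually (\<lambda>x. x \<in> U) (nhdsin \<tau> a)"
  by (auto simp: eventually_nhdsin)

lemma eventually_nhdsinE:
  assumes "eventually P (nhdsin \<tau> a)"
  obtains U where "openin \<tau> U" "a \<in> U" "\<And>x. x \<in> U \<Longrightarrow> P x"
  using assms by (auto simp: eventually_nhdsin)

lemma filterlim_mpoly_eval:
  assumes "\<And>k. filterlim (\<lambda>s. y s k) (nhdsin \<tau> (e k)) G"
  shows "filterlim (\<lambda>s. mpoly_eval (y s) q) (nhdsin \<tau> (mpoly_eval e q)) G"
  unfolding mpoly_eval_def
  by (intro filterlim_sum filterlim_times filterlim_const filterlim_prod filterlim_power assms)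

lemma eventually_mpoly_eval_nonzero:
  assumes "\<And>k. filterlim (\<lambda>s. y s k) (nhdsin \<tau> (e k)) G" "mpoly_eval e q \<noteq> 0"
  shows "eventually (\<lambda>s. mpoly_eval (y s) q \<noteq> 0) G"
proof -
  have "filterlim (\<lambda>s. mpoly_eval (y s) q) (nhdsin \<tau> (mpoly_eval e q)) G"
    by (rule filterlim_mpoly_eval) (rule assms(1))
  then show ?thesis using eventually_neq[OF assms(2)] by (auto simp: filterlim_iff)
qed

text \<open>The graph condition says that \<open>h y\<close> is the only root in the fixed open set
  \<open>V\<close>; this uniqueness later makes the graph definable. Restriction to the first
  \<open>N\<close> coordinates does not change the specialised polynomial.\<close>

lemma implicit_function:
  assumes ift: "polynomial_IFT \<tau>"
    and vars: "\<And>k. cf f k \<in> polys_in UNIV {..<N}"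
    and root: "poly (specialise e f) d = 0" and simple: "poly (pderiv (specialise e f)) d \<noteq> 0"
  obtains V h where "openin \<tau> V" "d \<in> V" "filterlim h (nhdsin \<tau> d) (nhds_point \<tau> N e)"
    "eventually (\<lambda>y. h y \<in> V \<and> (\<forall>w\<in>V. poly (specialise y f) w = 0 \<longleftrightarrow> w = h y)) (nhds_point \<tau> N e)"
proof -
  let ?R = "\<lambda>y :: nat \<Rightarrow> 'a. restrict y {..<N}"
  let ?X = "product_topology (\<lambda>_. \<tau>) {..<N}"
  have spec: "specialise (?R y) f = specialise y f" for y
    using vars by (intro specialise_cong) auto
  have "(\<forall>j. mpoly_vars_below N (cf f j)) \<and> ?R e \<in> {..<N} \<rightarrow>\<^sub>E UNIV \<and>
      poly (specialise (?R e) f) d = 0 \<and> poly (pderiv (specialise (?R e) f)) d \<noteq> 0"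
    using vars root simple by (simp add: spec mpoly_vars_below_iff)
  from ift[unfolded polynomial_IFT_def, rule_format, OF this]
  obtain U V h where U: "openin ?X U" "?R e \<in> U" and V: "openin \<tau> V" "d \<in> V"
    and cont: "continuous_map (subtopology ?X U) (subtopology \<tau> V) h"
    and graph: "{(x, y). poly (specialise x f) y = 0} \<inter> U \<times> V = {(x, h x) |x. x \<in> U}"
    by auto
  have ev: "eventually (\<lambda>y. ?R y \<in> W) (nhds_point \<tau> N e)" if W: "openin ?X W" "?R e \<in> W" for W
  proof -
    from bspec[OF W(1)[unfolded openin_product_topology_alt] W(2)]
    obtain B where B: "\<forall>k\<in>{..<N}. openin \<tau> (B k)" "?R e \<in> Pi\<^sub>E {..<N} B" "Pi\<^sub>E {..<N} B \<subseteq> W"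
      by auto
    have "eventually (\<lambda>y. \<forall>k\<in>{..<N}. y k \<in> B k) (nhds_point \<tau> N e)"
    proof (rule eventually_ball_finite)
      show "\<forall>k\<in>{..<N}. eventually (\<lambda>y. y k \<in> B k) (nhds_point \<tau> N e)"
      proof
        fix k assume k: "k \<in> {..<N}"
        then have "e k \<in> B k" using PiE_mem[OF B(2) k] by simp
        then show "eventually (\<lambda>y. y k \<in> B k) (nhds_point \<tau> N e)"
          using B(1) k by (intro eventually_nhds_point eventually_open) auto
      qed
    qed simp
    then show ?thesis
    proof eventually_elim
      case (elim y)
      then have "?R y \<in> Pi\<^sub>E {..<N} B" by auto
      then show ?case using B(3) by blast
    qed
  qed
  have graph': "h x \<in> V \<and> (\<forall>w\<in>V. poly (specialise x f) w = 0 \<longleftrightarrow> w = h x)" if "x \<in> U" for x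
  proof -
    have "(x, h x) \<in> {(x, y). poly (specialise x f) y = 0} \<inter> U \<times> V"
      unfolding graph using that by blast
    moreover have "w = h x" if "poly (specialise x f) w = 0" "w \<in> V" for w
    proof -
      have "(x, w) \<in> {(x, h x) |x. x \<in> U}" unfolding graph[symmetric] using that \<open>x \<in> U\<close> by blast
      then show ?thesis by blast
    qed
    ultimately show ?thesis by auto
  qed
  have d: "h (?R e) = d" using graph'[OF U(2)] V(2) root by (simp add: spec)
  have lim: "filterlim (\<lambda>y. h (?R y)) (nhdsin \<tau> d) (nhds_point \<tau> N e)"
    unfolding filterlim_iff
  proof (intro allI impI)
    fix P assume "eventually P (nhdsin \<tau> d)"
    then obtain S where S: "openin \<tau> S" "d \<in> S" "\<And>x. x \<in> S \<Longrightarrow> P x"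
      by (rule eventually_nhdsinE) (rule that)
    have "openin (subtopology \<tau> V) (V \<inter> S)" using S(1) by (auto simp: openin_subtopology)
    then have "openin (subtopology ?X U) {x \<in> topspace (subtopology ?X U). h x \<in> V \<inter> S}"
      using cont unfolding continuous_map_def by blast
    moreover have "topspace (subtopology ?X U) = U" using openin_subset[OF U(1)] by auto
    ultimately have "openin (subtopology ?X U) {x \<in> U. h x \<in> V \<inter> S}" by (simp only:)
    then have "openin ?X {x \<in> U. h x \<in> V \<inter> S}" using U(1) openin_trans_full by blast
    moreover have "?R e \<in> {x \<in> U. h x \<in> V \<inter> S}" using U(2) V(2) S(2) d by simp
    ultimately have "eventually (\<lambda>y. ?R y \<in> {x \<in> U. h x \<in> V \<inter> S}) (nhds_point \<tau> N e)" by (rule ev)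
    then show "eventually (\<lambda>y. P (h (?R y))) (nhds_point \<tau> N e)"
      by eventually_elim (use S(3) in auto)
  qed
  have "eventually (\<lambda>y. h (?R y) \<in> V \<and> (\<forall>w\<in>V. poly (specialise y f) w = 0 \<longleftrightarrow> w = h (?R y)))
      (nhds_point \<tau> N e)"
    using ev[OF U]
  proof eventually_elim
    case (elim y)
    show ?case using graph'[OF elim] unfolding spec .
  qed
  from that[OF V lim this] show thesis .
qed

end

locale generic_point_topology = generic_point F \<U> + field_topology \<tau>
  for F :: "'a::field set" and \<U> :: "(nat \<Rightarrow> 'a) filter" and \<tau> :: "'a topology" +
  assumes ift: "polynomial_IFT \<tau>"
begin

section \<open>Curves obtained by moving one basis coordinate\<close>

lemma tower_coeffs_in:
  "tower V r \<Longrightarrow> (j, P) \<in> set r \<Longrightarrow> coeffs_in (V \<union> fst ` set r) P"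
proof (induction V r rule: tower.induct)
  case (2 V j' P' r)
  then consider "j = j'" "P = P'" | "(j, P) \<in> set r" by auto
  then show ?case
  proof cases
    case 1
    then have "coeffs_in V P" using 2(2) by (simp add: step_def)
    then show ?thesis using polys_in_mono[of _ F V] unfolding coeffs_in_def by blast
  next
    case 2
    then show ?thesis using "2.IH" "2.prems" by simp
  qed
qed simp

text \<open>\<open>H u\<close> moves basis coordinate \<open>i\<close> to \<open>u\<close>, keeps
  the other basis coordinates, and lets the dependent ones follow continuously. The tower equations
  are only required near \<open>x i\<close>.\<close>

definition curve :: "(nat \<Rightarrow> 'a) \<Rightarrow> nat \<Rightarrow> nat set \<Rightarrow> (nat \<times> 'a mp poly) list \<Rightarrow> ('a \<Rightarrow> nat \<Rightarrow> 'a) \<Rightarrow> bool" where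
  "curve x i B r H \<longleftrightarrow>
     (\<forall>k. filterlim (\<lambda>u. H u k) (nhdsin \<tau> (x k)) (nhdsin \<tau> (x i))) \<and>
     (\<forall>u. H u i = u) \<and> (\<forall>k\<in>B - {i}. \<forall>u. H u k = x k) \<and>
     (\<forall>(j, P)\<in>set r. eventually (\<lambda>u. poly (specialise (H u) P) (H u j) = 0) (nhdsin \<tau> (x i)))"

text \<open>Each tower entry is solved by the implicit function theorem at a simple root. The
  induction appends at the end, so that overwriting the new coordinate leaves all earlier equations
  intact.\<close>

lemma curve_exists:
  assumes "tower B r" "i \<in> B" "B \<union> fst ` set r \<subseteq> {..<N}"
    and "\<forall>(j, P)\<in>set r. poly (specialise x P) (x j) = 0 \<and> poly (pderiv (specialise x P)) (x j) \<noteq> 0"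
  shows "\<exists>H. curve x i B r H"
  using assms
proof (induction r rule: rev_induct)
  case Nil
  have "filterlim (\<lambda>u. (x(i := u)) k) (nhdsin \<tau> (x k)) (nhdsin \<tau> (x i))" for k
    by (cases "k = i") (simp_all add: filterlim_const filterlim_ident)
  then show ?case by (intro exI[of _ "\<lambda>u. x(i := u)"]) (simp add: curve_def)
next
  case (snoc jP r)
  obtain j P where jP: "jP = (j, P)" by fastforce
  let ?V = "B \<union> fst ` set r"
  have tow: "tower B r" and st: "step ?V j P" using snoc.prems(1) by (auto simp: jP tower_snoc)
  obtain H where H: "curve x i B r H"
    using snoc.IH[OF tow] snoc.prems(2-4) by (auto simp: jP)
  have j: "j \<notin> ?V" and cP: "coeffs_in ?V P" using st by (auto simp: step_def)
  have V: "?V \<subseteq> {..<N}" using snoc.prems(3) by auto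
  have vars: "cf P k \<in> polys_in UNIV {..<N}" for k
    using cP V polys_in_UNIV polys_in_mono unfolding coeffs_in_def by blast
  have root: "poly (specialise x P) (x j) = 0" "poly (pderiv (specialise x P)) (x j) \<noteq> 0"
    using snoc.prems(4) by (auto simp: jP)
  obtain W h where W: "openin \<tau> W" "x j \<in> W" "filterlim h (nhdsin \<tau> (x j)) (nhds_point \<tau> N x)"
    "eventually (\<lambda>y. h y \<in> W \<and> (\<forall>w\<in>W. poly (specialise y P) w = 0 \<longleftrightarrow> w = h y)) (nhds_point \<tau> N x)"
    by (rule implicit_function[OF ift vars root]) (rule that)
  define H' where "H' u = (H u)(j := h (H u))" for u
  have limH: "filterlim (\<lambda>u. H u k) (nhdsin \<tau> (x k)) (nhdsin \<tau> (x i))" for k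
    using H by (simp add: curve_def)
  have Hpt: "filterlim H (nhds_point \<tau> N x) (nhdsin \<tau> (x i))"
    using limH by (simp add: filterlim_nhds_point)
  have spec: "specialise (H' u) Q = specialise (H u) Q" if "coeffs_in ?V Q" for Q u
    using that j unfolding coeffs_in_def H'_def by (intro specialise_cong) auto
  have "curve x i B (r @ [jP]) H'"
    unfolding curve_def
  proof (intro conjI allI ballI)
    fix k show "filterlim (\<lambda>u. H' u k) (nhdsin \<tau> (x k)) (nhdsin \<tau> (x i))"
      using limH[of k] filterlim_compose[OF W(3) Hpt] by (cases "k = j") (simp_all add: H'_def)
  next
    fix u show "H' u i = u" using H j snoc.prems(2) by (auto simp: curve_def H'_def)
  next
    fix k u assume "k \<in> B - {i}"
    then show "H' u k = x k" using H j by (auto simp: curve_def H'_def)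
  next
    fix jQ assume jQ: "jQ \<in> set (r @ [jP])"
    obtain l Q where lQ: "jQ = (l, Q)" by fastforce
    show "case jQ of (l, Q) \<Rightarrow> eventually (\<lambda>u. poly (specialise (H' u) Q) (H' u l) = 0) (nhdsin \<tau> (x i))"
    proof (cases "jQ \<in> set r")
      case True
      then have "coeffs_in ?V Q" using tower_coeffs_in[OF tow] by (simp add: lQ)
      moreover have "l \<noteq> j" using True j by (force simp: lQ)
      ultimately have "coeffs_in ?V Q" "l \<noteq> j" by auto
      then have "specialise (H' u) Q = specialise (H u) Q" "H' u l = H u l" for u
        using spec \<open>l \<noteq> j\<close> by (simp_all add: H'_def)
      then show ?thesis using H True by (auto simp: lQ curve_def)
    next
      case False
      then have "jQ = (j, P)" using jQ by (auto simp: jP)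
      moreover have "eventually (\<lambda>u. h (H u) \<in> W \<and> (\<forall>w\<in>W. poly (specialise (H u) P) w = 0 \<longleftrightarrow> w = h (H u)))
          (nhdsin \<tau> (x i))"
        using W(4) Hpt by (auto simp: filterlim_iff)
      then have "eventually (\<lambda>u. poly (specialise (H' u) P) (H' u j) = 0) (nhdsin \<tau> (x i))"
        by eventually_elim (simp add: spec[OF cP], simp add: H'_def)
      ultimately show ?thesis by simp
    qed
  qed
  then show ?case by blast
qed

lemma curve_append: "curve x i B (r @ s) H \<Longrightarrow> curve x i B r H"
  by (auto simp: curve_def)

text \<open>On an independent basis a relation is the zero polynomial. For a further coordinate
  \<open>j\<close>, reduce modulo its polynomial \<open>P\<close>: along the curve \<open>P\<close>
  vanishes, its leading coefficient stays nonzero by continuity, and the coefficients of the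
  remainder vanish by induction.\<close>

lemma eventually_vanishing_on_curve:
  assumes "tower B r" "indep B" "q \<in> polys_in F (B \<union> fst ` set r)" "Z q"
  shows "eventually (\<lambda>x. \<forall>i\<in>B. \<forall>H. curve x i B r H \<longrightarrow>
    eventually (\<lambda>u. mpoly_eval (H u) q = 0) (nhdsin \<tau> (x i))) \<U>"
  using assms(1,3,4)
proof (induction r arbitrary: q rule: rev_induct)
  case Nil
  then have "q = 0" using assms(2) by (simp add: indep_def)
  then show ?case by simp
next
  case (snoc jP r)
  obtain j P where jP: "jP = (j, P)" by fastforce
  let ?V = "B \<union> fst ` set r"
  have tow: "tower B r" and st: "step ?V j P" using snoc.prems(1) by (auto simp: jP tower_snoc)
  have j: "j \<notin> ?V" and cP: "coeffs_in ?V P" and ZP: "ZP j P" and lead: "\<not> Z (Polynomial.lead_coeff P)"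
    and min: "\<And>Q. coeffs_in ?V Q \<Longrightarrow> Polynomial.degree Q < Polynomial.degree P \<Longrightarrow> ZP j Q \<Longrightarrow> \<forall>k. Z (cf Q k)"
    using st by (auto simp: step_def)
  define R where "R f \<longleftrightarrow> eventually (\<lambda>x. \<forall>i\<in>B. \<forall>H. curve x i B (r @ [jP]) H \<longrightarrow>
    eventually (\<lambda>u. poly (specialise (H u) f) (H u j) = 0) (nhdsin \<tau> (x i))) \<U>" for f
  have csep: "coeffs_in ?V (sep j q)"
    unfolding coeffs_in_def
  proof
    fix k
    have "?V \<union> {j} - {j} \<subseteq> ?V" "B \<union> fst ` set (r @ [jP]) = ?V \<union> {j}" by (auto simp: jP)
    then show "cf (sep j q) k \<in> polys_in F ?V"
      using cf_sep_in_polys_in[OF F, of q "?V \<union> {j}" j k] snoc.prems(2) polys_in_mono by metis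
  qed
  have zsep: "ZP j (sep j q)" using snoc.prems(3) by (simp add: ZP_def poly_specialise_sep Z_def)
  have "R (sep j q)"
  proof (rule pseudo_division_induct[OF cP ZP lead min csep zsep, where R = R])
    fix Q assume Q: "coeffs_in ?V Q" "\<And>k. Z (cf Q k)"
    have "eventually (\<lambda>x. \<forall>k\<in>{..Polynomial.degree Q}. \<forall>i\<in>B. \<forall>H. curve x i B r H \<longrightarrow>
      eventually (\<lambda>u. mpoly_eval (H u) (cf Q k) = 0) (nhdsin \<tau> (x i))) \<U>"
      using snoc.IH[OF tow] Q unfolding coeffs_in_def by (intro eventually_ball_finite) auto
    then show "R Q"
      unfolding R_def
    proof eventually_elim
      case (elim x)
      show ?case
      proof (intro ballI allI impI)
        fix i H assume i: "i \<in> B" and "curve x i B (r @ [jP]) H"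
        then have "curve x i B r H" using curve_append by blast
        then have "eventually (\<lambda>u. \<forall>k\<in>{..Polynomial.degree Q}. mpoly_eval (H u) (cf Q k) = 0) (nhdsin \<tau> (x i))"
          using elim i by (intro eventually_ball_finite) auto
        then show "eventually (\<lambda>u. poly (specialise (H u) Q) (H u j) = 0) (nhdsin \<tau> (x i))"
          by eventually_elim (simp add: specialise_altdef)
      qed
    qed
  next
    fix Q a k
    assume "R (Polynomial.smult (Polynomial.lead_coeff P) Q - mnm a k * P)"
    then show "R Q"
      unfolding R_def using lead[unfolded not_Z]
    proof eventually_elim
      case (elim x)
      show ?case
      proof (intro ballI allI impI)
        fix i H assume i: "i \<in> B" and c: "curve x i B (r @ [jP]) H"
        have 1: "eventually (\<lambda>u. poly (specialise (H u) (Polynomial.smult (Polynomial.lead_coeff P) Q - mnm a k * P)) (H u j) = 0) (nhdsin \<tau> (x i))"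
          using elim(1) i c by blast
        have 2: "eventually (\<lambda>u. poly (specialise (H u) P) (H u j) = 0) (nhdsin \<tau> (x i))"
          using c by (simp add: curve_def jP)
        have 3: "eventually (\<lambda>u. mpoly_eval (H u) (Polynomial.lead_coeff P) \<noteq> 0) (nhdsin \<tau> (x i))"
          using c elim(2) by (intro eventually_mpoly_eval_nonzero) (auto simp: curve_def)
        show "eventually (\<lambda>u. poly (specialise (H u) Q) (H u j) = 0) (nhdsin \<tau> (x i))"
          using 1 2 3
          by eventually_elim (simp add: specialise_diff specialise_smult specialise_monom_mult)
      qed
    qed
  qed
  then show ?case by (simp add: R_def poly_specialise_sep)
qed

end

section \<open>Formulas\<close>

primrec mp_of_term :: "'a::field rterm \<Rightarrow> 'a mp" where
  "mp_of_term (TVar i) = sgl (sgl i 1) 1"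
| "mp_of_term (TPar c) = sgl 0 c"
| "mp_of_term TZero = 0"
| "mp_of_term TOne = 1"
| "mp_of_term (TAdd s t) = mp_of_term s + mp_of_term t"
| "mp_of_term (TNeg t) = - mp_of_term t"
| "mp_of_term (TMul s t) = mp_of_term s * mp_of_term t"

lemma mpoly_eval_mp_of_term: "mpoly_eval x (mp_of_term t) = tval x t"
  by (induction t) (simp_all add: mpoly_eval_add mpoly_eval_uminus mpoly_eval_mult)

lemma polys_in_1: "is_subfield F \<Longrightarrow> 1 \<in> polys_in F V"
  using polys_in_single[of F 1 0 V] is_subfieldD(2) by auto

lemma polys_in_uminus: "is_subfield F \<Longrightarrow> q \<in> polys_in F V \<Longrightarrow> - q \<in> polys_in F V"
  using polys_in_diff[OF _ polys_in_0, of F q V] by simp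

lemma mp_of_term_in:
  assumes F: "is_subfield F"
  shows "tparams t \<subseteq> F \<Longrightarrow> tfree t \<subseteq> V \<Longrightarrow> mp_of_term t \<in> polys_in F V"
  by (induction t) (use is_subfieldD[OF F] in
    \<open>auto intro: polys_in_0[OF F] polys_in_add[OF F] polys_in_diff[OF F] polys_in_mult[OF F]
      polys_in_single[OF F] polys_in_1[OF F] polys_in_uminus[OF F]\<close>)

primrec atoms :: "'a::field fm \<Rightarrow> 'a mp set" where
  "atoms (FEq t u) = {mp_of_term t - mp_of_term u}"
| "atoms (FIn t U) = {}"
| "atoms (FNot \<phi>) = atoms \<phi>"
| "atoms (FAnd \<phi> \<psi>) = atoms \<phi> \<union> atoms \<psi>"
| "atoms (FOr \<phi> \<psi>) = atoms \<phi> \<union> atoms \<psi>"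
| "atoms (FEx i \<phi>) = atoms \<phi>"
| "atoms (FExOpen i \<phi>) = atoms \<phi>"

lemma finite_atoms: "finite (atoms \<phi>)"
  by (induction \<phi>) auto

lemma atoms_in:
  assumes F: "is_subfield F"
  shows "ring_qf \<phi> \<Longrightarrow> params \<phi> \<subseteq> F \<Longrightarrow> free_vars \<phi> \<subseteq> V \<Longrightarrow> atoms \<phi> \<subseteq> polys_in F V"
  by (induction \<phi>) (auto intro!: polys_in_diff[OF F] mp_of_term_in[OF F])

lemma sat_atoms_cong:
  "ring_qf \<phi> \<Longrightarrow> (\<And>q. q \<in> atoms \<phi> \<Longrightarrow> mpoly_eval x q = 0 \<longleftrightarrow> mpoly_eval y q = 0) \<Longrightarrow>
    sat \<tau> x s \<phi> \<longleftrightarrow> sat \<tau> y s' \<phi>"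
  by (induction \<phi>) (simp_all add: mpoly_eval_diff mpoly_eval_mp_of_term)

section \<open>Existential formulas as projections\<close>

lemma finite_tfree: "finite (tfree t)"
  by (induction t) auto

lemma finite_free_vars: "finite (free_vars \<phi>)"
  by (induction \<phi>) (auto simp: finite_tfree)

lemma tval_cong: "(\<And>i. i \<in> tfree t \<Longrightarrow> x i = y i) \<Longrightarrow> tval x t = tval y t"
  by (induction t) auto

lemma sat_cong:
  "ring_qf \<phi> \<Longrightarrow> (\<And>i. i \<in> free_vars \<phi> \<Longrightarrow> x i = y i) \<Longrightarrow> sat \<tau> x s \<phi> \<longleftrightarrow> sat \<tau> y s \<phi>"
proof (induction \<phi>)
  case (FEq t u)
  then have "tval x t = tval y t" "tval x u = tval y u" by (auto intro!: tval_cong)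
  then show ?case by simp
qed simp_all

text \<open>A block of existential quantifiers amounts to freedom to change the assignment on the
  set \<open>Q\<close> of quantified variables.\<close>

lemma ring_existential_prenex:
  assumes "ring_existential \<phi>"
  shows "\<exists>Q \<psi>. ring_qf \<psi> \<and> params \<psi> = params \<phi> \<and> free_vars \<phi> = free_vars \<psi> - Q \<and>
    (\<forall>e s. sat \<tau> e s \<phi> \<longleftrightarrow> (\<exists>e'. (\<forall>j. j \<notin> Q \<longrightarrow> e' j = e j) \<and> sat \<tau> e' s \<psi>))"
  using assms
proof induction
  case (1 \<phi>)
  have "(\<exists>e'. (\<forall>j. e' j = e j) \<and> sat \<tau> e' s \<phi>) \<longleftrightarrow> sat \<tau> e s \<phi>" for e s
    by (auto simp flip: fun_eq_iff)
  then show ?case using 1 by (intro exI[of _ "{}"] exI[of _ \<phi>]) simp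
next
  case (2 \<phi> i)
  then obtain Q \<psi> where \<psi>: "ring_qf \<psi>" "params \<psi> = params \<phi>" "free_vars \<phi> = free_vars \<psi> - Q"
    "\<And>e s. sat \<tau> e s \<phi> \<longleftrightarrow> (\<exists>e'. (\<forall>j. j \<notin> Q \<longrightarrow> e' j = e j) \<and> sat \<tau> e' s \<psi>)" by metis
  have "sat \<tau> e s (FEx i \<phi>) \<longleftrightarrow> (\<exists>e'. (\<forall>j. j \<notin> insert i Q \<longrightarrow> e' j = e j) \<and> sat \<tau> e' s \<psi>)" for e s
  proof
    assume "sat \<tau> e s (FEx i \<phi>)"
    then obtain x e' where "\<forall>j. j \<notin> Q \<longrightarrow> e' j = (e(i := x)) j" "sat \<tau> e' s \<psi>" by (auto simp: \<psi>(4))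
    then show "\<exists>e'. (\<forall>j. j \<notin> insert i Q \<longrightarrow> e' j = e j) \<and> sat \<tau> e' s \<psi>" by (intro exI[of _ e']) auto
  next
    assume "\<exists>e'. (\<forall>j. j \<notin> insert i Q \<longrightarrow> e' j = e j) \<and> sat \<tau> e' s \<psi>"
    then obtain e' where e': "\<forall>j. j \<notin> insert i Q \<longrightarrow> e' j = e j" "sat \<tau> e' s \<psi>" by blast
    then have "\<forall>j. j \<notin> Q \<longrightarrow> e' j = (e(i := e' i)) j" by auto
    then have "sat \<tau> (e(i := e' i)) s \<phi>" using e'(2) \<psi>(4) by blast
    then show "sat \<tau> e s (FEx i \<phi>)" by auto
  qed
  then show ?case using \<psi>(1-3) by (intro exI[of _ "insert i Q"] exI[of _ \<psi>]) auto
qed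

text \<open>The witnesses of the quantifiers become further coordinates, which turns
  \<open>A\<close> into the projection of a quantifier-free set to coordinate 0.\<close>

lemma existentially_defined_image:
  assumes "existentially_defined \<tau> C A"
  obtains \<psi> where "ring_qf \<psi>" "params \<psi> \<subseteq> C" "A = {e 0 |e. sat \<tau> e (\<lambda>_. {}) \<psi>}"
proof -
  obtain \<phi> where \<phi>: "ring_existential \<phi>" "params \<phi> \<subseteq> C" "free_vars \<phi> \<subseteq> {0}"
    "A = {x. sat \<tau> ((\<lambda>_. 0)(0 := x)) (\<lambda>_. {}) \<phi>}"
    using assms by (auto simp: existentially_defined_def defines_set_def)
  obtain Q \<psi> where \<psi>: "ring_qf \<psi>" "params \<psi> = params \<phi>" "free_vars \<phi> = free_vars \<psi> - Q"
    "\<And>e s. sat \<tau> e s \<phi> \<longleftrightarrow> (\<exists>e'. (\<forall>j. j \<notin> Q \<longrightarrow> e' j = e j) \<and> sat \<tau> e' s \<psi>)"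
    using ring_existential_prenex[OF \<phi>(1), of \<tau>] by metis
  have A: "x \<in> A \<longleftrightarrow> (\<exists>e'. (\<forall>j. j \<notin> Q \<longrightarrow> e' j = ((\<lambda>_. 0)(0 := x)) j) \<and> sat \<tau> e' (\<lambda>_. {}) \<psi>)" for x
    by (simp only: \<phi>(4) mem_Collect_eq \<psi>(4))
  show thesis
  proof (cases "0 \<in> Q")
    case False
    have "A = {e 0 |e. sat \<tau> e (\<lambda>_. {}) \<psi>}"
    proof (intro Set.set_eqI iffI)
      fix x assume "x \<in> A"
      then show "x \<in> {e 0 |e. sat \<tau> e (\<lambda>_. {}) \<psi>}" unfolding A using False by force
    next
      fix x assume "x \<in> {e 0 |e. sat \<tau> e (\<lambda>_. {}) \<psi>}"
      then obtain e where e: "x = e 0" "sat \<tau> e (\<lambda>_. {}) \<psi>" by blast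
      \<comment> \<open>Variables that are neither quantified nor 0 get the default 0 of
        \<open>defines_set\<close>.\<close>
      define e' where "e' j = (if j \<in> Q then e j else if j = 0 then x else 0)" for j
      have "sat \<tau> e' (\<lambda>_. {}) \<psi> \<longleftrightarrow> sat \<tau> e (\<lambda>_. {}) \<psi>"
        using \<phi>(3) \<psi>(3) e(1) by (intro sat_cong[OF \<psi>(1)]) (auto simp: e'_def)
      then show "x \<in> A" unfolding A using e(2) by (intro exI[of _ e']) (auto simp: e'_def)
    qed
    then show thesis using that[of \<psi>] \<psi> \<phi>(2) by simp
  next
    \<comment> \<open>If variable 0 is itself quantified, the formula ignores \<open>x\<close>, so
      \<open>A\<close> is empty or everything and a constant formula describes it.\<close>
    case True
    then have const: "x \<in> A \<longleftrightarrow> y \<in> A" for x y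
      unfolding A by (intro arg_cong[where f = Ex] ext conj_cong) auto
    show thesis
    proof (cases "A = {}")
      case True
      then show thesis using that[of "FNot (FEq TZero TZero)"] by simp
    next
      case False
      then have "A = UNIV" using const by blast
      moreover have "x \<in> {e 0 |e. True}" for x :: 'a by (auto intro: exI[of _ "\<lambda>_. x"])
      ultimately show thesis using that[of "FEq TZero TZero"] by auto
    qed
  qed
qed

section \<open>Definability of graphs given by polynomials\<close>

lemma term_power: "\<exists>t'. (\<forall>e. tval e t' = tval e t ^ n) \<and> tfree t' \<subseteq> tfree t"
proof (induction n)
  case 0
  show ?case by (intro exI[of _ TOne]) simp
next
  case (Suc n)
  then obtain t' where "\<forall>e. tval e t' = tval e t ^ n" "tfree t' \<subseteq> tfree t" by blast
  then show ?case by (intro exI[of _ "TMul t t'"]) auto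
qed

lemma term_prod:
  assumes "finite I" "\<And>i. i \<in> I \<Longrightarrow> \<exists>t. (\<forall>e. tval e t = f e i) \<and> tfree t \<subseteq> V"
  shows "\<exists>t. (\<forall>e. tval e t = (\<Prod>i\<in>I. f e i)) \<and> tfree t \<subseteq> V"
  using assms
proof induction
  case empty
  show ?case by (intro exI[of _ TOne]) simp
next
  case (insert i I)
  obtain t where "\<forall>e. tval e t = f e i" "tfree t \<subseteq> V" using insert.prems by blast
  moreover obtain t' where "\<forall>e. tval e t' = (\<Prod>i\<in>I. f e i)" "tfree t' \<subseteq> V" using insert by blast
  ultimately show ?case using insert.hyps by (intro exI[of _ "TMul t t'"]) simp
qed

lemma term_sum:
  assumes "finite I" "\<And>i. i \<in> I \<Longrightarrow> \<exists>t. (\<forall>e. tval e t = f e i) \<and> tfree t \<subseteq> V"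
  shows "\<exists>t. (\<forall>e. tval e t = (\<Sum>i\<in>I. f e i)) \<and> tfree t \<subseteq> V"
  using assms
proof induction
  case empty
  show ?case by (intro exI[of _ TZero]) simp
next
  case (insert i I)
  obtain t where "\<forall>e. tval e t = f e i" "tfree t \<subseteq> V" using insert.prems by blast
  moreover obtain t' where "\<forall>e. tval e t' = (\<Sum>i\<in>I. f e i)" "tfree t' \<subseteq> V" using insert by blast
  ultimately show ?case using insert.hyps by (intro exI[of _ "TAdd t t'"]) simp
qed

lemma term_of_mp:
  assumes "\<And>k. tfree (\<rho> k) \<subseteq> V"
  shows "\<exists>t. (\<forall>e. tval e t = mpoly_eval (\<lambda>k. tval e (\<rho> k)) q) \<and> tfree t \<subseteq> V"
  unfolding mpoly_eval_alt mono_eval_def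
proof (rule term_sum)
  fix \<alpha>
  have "\<exists>t. (\<forall>e. tval e t = (\<Prod>i\<in>ks \<alpha>. tval e (\<rho> i) ^ lkp \<alpha> i)) \<and> tfree t \<subseteq> V"
  proof (rule term_prod)
    show "\<exists>t. (\<forall>e. tval e t = tval e (\<rho> i) ^ lkp \<alpha> i) \<and> tfree t \<subseteq> V" for i
      using term_power[of "\<rho> i" "lkp \<alpha> i"] assms[of i] by blast
  qed simp
  then obtain t where "\<forall>e. tval e t = (\<Prod>i\<in>ks \<alpha>. tval e (\<rho> i) ^ lkp \<alpha> i)" "tfree t \<subseteq> V" by blast
  then show "\<exists>t. (\<forall>e. tval e t = lkp q \<alpha> * (\<Prod>i\<in>ks \<alpha>. tval e (\<rho> i) ^ lkp \<alpha> i)) \<and> tfree t \<subseteq> V"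
    by (intro exI[of _ "TMul (TPar (lkp q \<alpha>)) t"]) simp
qed simp

text \<open>Interalgebraicity refers to the parameters occurring in the formula; equations c = c
  place prescribed elements among them.\<close>

lemma true_formula_with_params:
  assumes "finite S"
  shows "\<exists>\<phi>. S \<subseteq> params \<phi> \<and> free_vars \<phi> = {} \<and> free_open_vars \<phi> = {} \<and> open_params \<phi> = {} \<and>
    (\<forall>e s. sat \<tau> e s \<phi>)"
  using assms
proof induction
  case empty
  show ?case by (intro exI[of _ "FEq TZero TZero"]) simp
next
  case (insert c S)
  then obtain \<phi> where "S \<subseteq> params \<phi>" "free_vars \<phi> = {}" "free_open_vars \<phi> = {}" "open_params \<phi> = {}"
    "\<forall>e s. sat \<tau> e s \<phi>" by blast
  then show ?case by (intro exI[of _ "FAnd (FEq (TPar c) (TPar c)) \<phi>"]) auto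
qed

lemma graph_formula:
  assumes "openin \<tau> U" "openin \<tau> V" "finite S" "i \<noteq> 0"
  obtains \<phi> where "S \<subseteq> params \<phi>"
    "defines_relation \<tau> \<phi> {(u, w). u \<in> U \<and> w \<in> V \<and> mpoly_eval (x(i := u, 0 := w)) q = 0}"
proof -
  \<comment> \<open>In the formula the argument is variable 0 and the value variable 1, whereas in
    \<open>q\<close> the argument is X_i and the value X_0. The other variables are frozen at
    \<open>x\<close>.\<close>
  define \<rho> where "\<rho> k = (if k = 0 then TVar 1 else if k = i then TVar 0 else TPar (x k))" for k
  have "\<exists>t. (\<forall>e. tval e t = mpoly_eval (\<lambda>k. tval e (\<rho> k)) q) \<and> tfree t \<subseteq> {0, 1}"
    by (rule term_of_mp) (auto simp: \<rho>_def)
  then obtain t where t: "\<And>e. tval e t = mpoly_eval (\<lambda>k. tval e (\<rho> k)) q" "tfree t \<subseteq> {0, 1}" by blast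
  obtain \<phi> where \<phi>: "S \<subseteq> params \<phi>" "free_vars \<phi> = {}" "free_open_vars \<phi> = {}" "open_params \<phi> = {}"
    "\<And>e s. sat \<tau> e s \<phi>" using true_formula_with_params[OF assms(3), of \<tau>] by blast
  have "(\<lambda>k. tval ((\<lambda>_. 0)(0 := u, 1 := w)) (\<rho> k)) = x(i := u, 0 := w)" for u w
    using assms(4) by (auto simp: \<rho>_def)
  then have "tval ((\<lambda>_. 0)(0 := u, 1 := w)) t = mpoly_eval (x(i := u, 0 := w)) q" for u w
    by (simp only: t(1))
  then have "defines_relation \<tau>
      (FAnd \<phi> (FAnd (FAnd (FIn (TVar 0) (OPar U)) (FIn (TVar 1) (OPar V))) (FEq t TZero)))
      {(u, w). u \<in> U \<and> w \<in> V \<and> mpoly_eval (x(i := u, 0 := w)) q = 0}"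
    using t(2) \<phi> assms by (auto simp: defines_relation_def)
  then show thesis using \<phi>(1) by (intro that) auto
qed

section \<open>The dichotomy\<close>

text \<open>Zorn's lemma on the proper filters below \<open>\<F>\<close>: the infimum of a chain is
  proper because \<open>False\<close> would already hold eventually in some member. If a minimal
  filter does not eventually refute \<open>P\<close>, intersecting it with \<open>P\<close> keeps it
  proper, so \<open>P\<close> already holds eventually.\<close>

lemma ultrafilter_exists:
  assumes "\<F> \<noteq> bot"
  obtains \<U> where "\<U> \<le> \<F>" "\<U> \<noteq> bot" "\<And>P. eventually P \<U> \<or> eventually (\<lambda>x. \<not> P x) \<U>"
proof -
  let ?A = "{\<G>. \<G> \<noteq> bot \<and> \<G> \<le> \<F>}"
  let ?P = "\<lambda>\<G> \<H>. \<H> \<le> (\<G> :: 'a filter)"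
  have "\<exists>\<U>\<in>?A. \<forall>\<G>\<in>?A. ?P \<U> \<G> \<longrightarrow> \<G> = \<U>"
  proof (rule predicate_Zorn)
    show "partial_order_on ?A (relation_of ?P ?A)"
      by (rule partial_order_on_relation_ofI) auto
  next
    fix \<C> assume \<C>: "\<C> \<in> Chains (relation_of ?P ?A)"
    then have sub: "\<C> \<subseteq> ?A" by (auto simp: Chains_def relation_of_def)
    show "\<exists>\<U>\<in>?A. \<forall>\<G>\<in>\<C>. ?P \<G> \<U>"
    proof (cases "\<C> = {}")
      case True
      then show ?thesis using assms by (intro bexI[of _ \<F>]) auto
    next
      case False
      have dir: "\<exists>x\<in>\<C>. x \<le> inf \<G> \<H>" if "\<G> \<in> \<C>" "\<H> \<in> \<C>" for \<G> \<H>
      proof -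
        have "\<H> \<le> \<G> \<or> \<G> \<le> \<H>" using \<C> that by (auto simp: Chains_def relation_of_def)
        then show ?thesis using that by (auto intro: bexI[of _ \<G>] bexI[of _ \<H>])
      qed
      have "\<not> eventually (\<lambda>_. False) (Inf \<C>)"
        using sub by (subst eventually_Inf_base[OF False dir]) (auto simp: eventually_False)
      then have "Inf \<C> \<noteq> bot" by auto
      moreover have "Inf \<C> \<le> \<F>" using False sub by (auto intro: Inf_lower2)
      ultimately show ?thesis by (intro bexI[of _ "Inf \<C>"]) (auto intro: Inf_lower)
    qed
  qed
  then obtain \<U> where \<U>: "\<U> \<noteq> bot" "\<U> \<le> \<F>"
    "\<And>\<G>. \<G> \<noteq> bot \<Longrightarrow> \<G> \<le> \<F> \<Longrightarrow> \<G> \<le> \<U> \<Longrightarrow> \<G> = \<U>" by auto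
  have "eventually P \<U> \<or> eventually (\<lambda>x. \<not> P x) \<U>" for P
  proof (cases "eventually (\<lambda>x. \<not> P x) \<U>")
    case False
    then have "inf \<U> (principal {x. P x}) \<noteq> bot"
      by (simp add: trivial_limit_def eventually_inf_principal)
    then have "inf \<U> (principal {x. P x}) = \<U>"
      using \<U>(2) by (intro \<U>(3)) (auto intro: le_infI1)
    then have "\<U> \<le> principal {x. P x}" by (metis inf_le2)
    then show ?thesis by (simp add: le_principal)
  qed simp
  then show thesis using that \<U> by blast
qed

text \<open>X - a does not divide \<open>S\<close>, so in (X - a)^(n+1) = S Q it divides
  \<open>Q\<close> and can be cancelled.\<close>

lemma dvd_linear_power:
  fixes S :: "'a::field poly"
  assumes "S dvd [:- a, 1:] ^ n" "poly S a \<noteq> 0"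
  shows "Polynomial.degree S = 0"
  using assms(1)
proof (induction n)
  case 0
  then show ?case using assms(2) by (subst (asm) power_0) (auto simp: is_unit_poly_iff)
next
  case (Suc n)
  then obtain Q where Q: "[:- a, 1:] ^ Suc n = S * Q" by (auto elim: dvdE)
  have "poly (S * Q) a = 0" by (simp flip: Q)
  then have "[:- a, 1:] dvd Q" using assms(2) by (simp add: poly_eq_0_iff_dvd[symmetric])
  then obtain Q' where "Q = [:- a, 1:] * Q'" by (auto elim: dvdE)
  have "[:- a, 1:] * [:- a, 1:] ^ n = S * Q" using Q by (simp only: power_Suc)
  also have "\<dots> = [:- a, 1:] * (S * Q')" by (simp only: \<open>Q = _\<close> mult.left_commute)
  finally have "[:- a, 1:] * [:- a, 1:] ^ n = [:- a, 1:] * (S * Q')" .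
  then have "[:- a, 1:] ^ n = S * Q'" by (subst (asm) mult_cancel_left) auto
  then show ?case by (intro Suc.IH) simp
qed

text \<open>Over the field $E = K^{p^m}$, an element \<open>a\<close> is a root of $Y^{p^m} - a^{p^m} = (Y - a)^{p^m}$,
  so its minimal polynomial is a power of $Y - a$; separability makes it linear.\<close>

lemma simple_root_in_frob_range:
  fixes p :: "'a::field poly"
  assumes coeffs: "\<And>k. cf p k \<in> range (frob m)" and root: "poly p a = 0"
    and simple: "poly (pderiv p) a \<noteq> 0"
  shows "a \<in> range (frob m)"
proof -
  let ?E = "range (frob m) :: 'a set"
  have E: "is_subfield ?E" by (simp add: is_subfield_frob)
  note E' = is_subfieldD[OF E]
  define G where "G R \<longleftrightarrow> R \<noteq> 0 \<and> (\<forall>k. cf R k \<in> ?E) \<and> poly R a = 0" for R :: "'a poly"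
  have "G p" using assms unfolding G_def by auto
  then obtain R where R: "G R" "\<And>Q. Polynomial.degree Q < Polynomial.degree R \<Longrightarrow> \<not> G Q"
    using ex_has_least_nat[of G p Polynomial.degree] by (metis linorder_not_less)
  have R': "R \<noteq> 0" "\<And>k. cf R k \<in> ?E" "poly R a = 0" using R(1) by (auto simp: G_def)
  \<comment> \<open>Division with remainder over \<open>?E\<close>: by minimality of
    \<open>R\<close> the remainder is 0.\<close>
  have dvd: "R dvd h" if "\<forall>k. cf h k \<in> ?E" "poly h a = 0" for h
    using that
  proof (induction "Polynomial.degree h" arbitrary: h rule: less_induct)
    case less
    show ?case
    proof (cases "Polynomial.degree h < Polynomial.degree R")
      case True
      then have "h = 0" using R(2) less.prems unfolding G_def by blast
      then show ?thesis by simp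
    next
      case False
      define c where "c = Polynomial.lead_coeff h / Polynomial.lead_coeff R"
      define k where "k = Polynomial.degree h - Polynomial.degree R"
      define h' where "h' = h - mnm c k * R"
      have cf_h': "cf h' n = cf h n - (if n < k then 0 else c * cf R (n - k))" for n
        by (simp add: h'_def coeff_monom_mult)
      have in': "\<forall>n. cf h' n \<in> ?E"
        unfolding cf_h' c_def using less.prems(1) R'(2) E' by auto
      have "poly h' a = 0" using less.prems R' by (simp add: h'_def)
      have k: "Polynomial.degree h = k + Polynomial.degree R" using False by (simp add: k_def)
      have "Polynomial.degree R > 0"
      proof (rule ccontr)
        assume "\<not> Polynomial.degree R > 0"
        then obtain c where "R = [:c:]" by (metis degree_eq_zeroE not_gr_zero)
        then show False using R' by simp
      qed
      have "Polynomial.degree h' \<le> Polynomial.degree h - 1"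
      proof (rule degree_le, intro allI impI)
        fix n assume n: "Polynomial.degree h - 1 < n"
        show "cf h' n = 0"
        proof (cases "n = Polynomial.degree h")
          case True
          then show ?thesis using k R'(1) by (simp add: cf_h' c_def)
        next
          case False
          then have "n > Polynomial.degree h" "n - k > Polynomial.degree R" using n k by auto
          then show ?thesis by (simp add: cf_h' coeff_eq_0)
        qed
      qed
      then have "Polynomial.degree h' < Polynomial.degree h"
        using k \<open>Polynomial.degree R > 0\<close> by linarith
      then have "R dvd h'" using less.hyps in' \<open>poly h' a = 0\<close> by blast
      moreover have "h = h' + mnm c k * R" by (simp add: h'_def)
      ultimately show ?thesis by simp
    qed
  qed
  have "R dvd p" using dvd coeffs root by blast
  then obtain Q where Q: "p = R * Q" by (rule dvdE)
  \<comment> \<open>A simple root of \<open>p\<close> is a simple root of its divisor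
    \<open>R\<close>, hence the cofactor \<open>S\<close> of X - a does not vanish at
    \<open>a\<close>.\<close>
  have R'a: "poly (pderiv R) a \<noteq> 0" using simple R'(3) by (auto simp: Q pderiv_mult)
  obtain S where S: "R = [:- a, 1:] * S" using R'(3) by (auto simp: poly_eq_0_iff_dvd elim: dvdE)
  have "pderiv R = [:- a, 1:] * pderiv S + S * pderiv [:- a, 1:]" unfolding S by (rule pderiv_mult)
  then have Sa: "poly S a \<noteq> 0" using R'a by (auto simp: pderiv_pCons)
  define n where "n = char_exponent TYPE('a) ^ m"
  have n: "n > 0" using char_exponent_pos[where 'a='a] by (simp add: n_def)
  have "[:- a, 1:] ^ n = mnm 1 n - [:frob m a:]"
  proof -
    have "[:- a, 1:] = mnm 1 1 + [:- a:]" by (simp add: monom_altdef)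
    then have "[:- a, 1:] ^ n = (mnm 1 1 + [:- a:]) ^ n" by simp
    also have "\<dots> = mnm 1 1 ^ n + [:- a:] ^ n"
    proof (cases "CHAR('a) = 0")
      case False
      then have "Factorial_Ring.prime CHAR('a poly)" using CHAR_cases[where 'a='a] by simp
      then show ?thesis by (rule freshmans_dream') (use False in \<open>simp add: n_def char_exponent_def\<close>)
    qed (simp add: n_def char_exponent_def)
    also have "[:- a:] ^ n = [:frob m (- a):]" by (simp add: poly_const_pow frob_def n_def)
    finally show ?thesis by (simp add: monom_power frob_uminus)
  qed
  moreover have "R dvd mnm 1 n - [:frob m a:]"
  proof (rule dvd)
    have "frob m a \<in> ?E" by blast
    then show "\<forall>k. cf (mnm 1 n - [:frob m a:]) k \<in> ?E"
      using E' n by (auto simp: coeff_pCons split: nat.split)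
    show "poly (mnm 1 n - [:frob m a:]) a = 0" by (simp add: poly_monom frob_def n_def)
  qed
  \<comment> \<open>As a divisor of a power of X - a that is nonzero at \<open>a\<close>,
    \<open>S\<close> is constant; so \<open>R\<close> is linear and \<open>a\<close> is a quotient
    of its coefficients.\<close>
  ultimately have "S dvd [:- a, 1:] ^ n" using S by (metis dvd_mult_right)
  then have "Polynomial.degree S = 0" using dvd_linear_power Sa by blast
  then obtain c where c: "S = [:c:]" by (metis degree_eq_zeroE)
  have "c \<noteq> 0" using Sa c by simp
  have "cf R 1 = c" "cf R 0 = - a * c" by (simp_all add: S c)
  then have "a = - cf R 0 / cf R 1" using \<open>c \<noteq> 0\<close> by simp
  also have "\<dots> \<in> ?E" by (intro E'(7,8) R'(2))
  finally show ?thesis .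
qed

lemma mono_eval_in:
  assumes "is_subfield E" "\<And>k. k \<in> ks \<alpha> \<Longrightarrow> x k \<in> E"
  shows "mono_eval x \<alpha> \<in> E"
  unfolding mono_eval_def using assms by (intro is_subfield_prod is_subfield_power)

lemma mpoly_eval_in:
  assumes E: "is_subfield E" and q: "q \<in> polys_in E V" and x: "\<And>k. k \<in> V \<Longrightarrow> x k \<in> E"
  shows "mpoly_eval x q \<in> E"
  unfolding mpoly_eval_alt
  by (intro is_subfield_sum[OF E] is_subfieldD(5)[OF E] polys_inD[OF q] mono_eval_in[OF E] x)
    (use polys_inD(2)[OF q] in blast)

lemma zariski_open_UNIV: "zariski_open UNIV"
  unfolding zariski_open_def by (intro exI[of _ "{1}"]) auto

context field_topology
begin

lemma infinite_with_injection_of_open: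
  assumes "openin \<tau> U" "U \<noteq> {}" "U \<subseteq> A"
  shows "infinite_with_injection \<tau> C A"
proof -
  let ?\<phi> = "FAnd (FEq (TVar 0) (TVar 1)) (FIn (TVar 0) (OPar U))"
  have "infinite A" using infinite_open[OF assms(1,2)] assms(3) finite_subset by blast
  moreover have "defines_relation \<tau> ?\<phi> {(u, id u) |u. u \<in> U \<inter> UNIV}"
    using assms(1) by (auto simp: defines_relation_def)
  moreover have "algebraic_over (generated_subfield (E \<union> {u})) u" for E :: "'a set" and u
  proof -
    have *: "is_subfield (generated_subfield (E \<union> {u}))" by (rule is_subfield_generated)
    have "u \<in> generated_subfield (E \<union> {u})" by (rule hull_inc) simp
    then have "cf [:- u, 1:] k \<in> generated_subfield (E \<union> {u})" for k
      using is_subfieldD[OF *] by (auto simp: coeff_pCons split: nat.split)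
    then show ?thesis unfolding algebraic_over_def by (intro exI[of _ "[:- u, 1:]"]) auto
  qed
  then have "interalgebraic E u (id u)" for E and u :: 'a by (simp add: interalgebraic_def)
  ultimately show ?thesis
    unfolding infinite_with_injection_def using assms zariski_open_UNIV
    by (intro conjI exI[of _ U] exI[of _ UNIV] exI[of _ id] exI[of _ ?\<phi>]) auto
qed

lemma contains_open_powers_of_open:
  assumes "openin \<tau> U" "U \<noteq> {}" "U \<subseteq> A"
  shows "contains_open_powers \<tau> A"
  unfolding contains_open_powers_def
  using assms by (intro exI[of _ 0] exI[of _ U]) (auto simp: K_pow_def)

text \<open>Pulling the open set back along Frobenius gives a nonempty open set, which is infinite
  and embeds into \<open>A\<close>. This excludes (i) and (ii') holding together.\<close>

lemma infinite_of_contains_open_powers: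
  assumes "contains_open_powers \<tau> A"
  shows "infinite A"
proof -
  obtain m S where S: "openin \<tau> S" "S \<inter> K_pow m \<noteq> {}" "S \<inter> K_pow m \<subseteq> A"
    using assms by (auto simp: contains_open_powers_def)
  then obtain w where w: "frob m w \<in> S" by (auto simp: K_pow_eq)
  have "filterlim (\<lambda>z. frob m z) (nhdsin \<tau> (frob m w)) (nhdsin \<tau> w)"
    unfolding frob_def by (intro filterlim_power filterlim_ident)
  then have "eventually (\<lambda>z. frob m z \<in> S) (nhdsin \<tau> w)"
    using eventually_open[OF S(1) w] by (auto simp: filterlim_iff)
  then obtain U where U: "openin \<tau> U" "w \<in> U" "\<And>z. z \<in> U \<Longrightarrow> frob m z \<in> S"
    by (rule eventually_nhdsinE) (rule that)
  have "infinite U" using infinite_open U by blast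
  then have "infinite (frob m ` U)" using inj_frob by (metis finite_imageD inj_on_subset subset_UNIV)
  moreover have "frob m ` U \<subseteq> A" using U(3) S(3) by (auto simp: K_pow_eq)
  ultimately show ?thesis using finite_subset by blast
qed

end

context generic_point_topology
begin

lemma tower_roots: "tower V r \<Longrightarrow> (j, P) \<in> set r \<Longrightarrow> ZP j P \<and> \<not> DZP j P"
  by (induction V r rule: tower.induct) (auto simp: step_def)

lemma eventually_curve_exists:
  assumes "tower B r" "B \<union> fst ` set r \<subseteq> {..<N}"
  shows "eventually (\<lambda>x. \<forall>i\<in>B. \<exists>H. curve x i B r H) \<U>"
proof -
  have "eventually (\<lambda>x. \<forall>jP\<in>set r. poly (specialise x (snd jP)) (x (fst jP)) = 0 \<and>
      poly (pderiv (specialise x (snd jP))) (x (fst jP)) \<noteq> 0) \<U>"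
  proof (intro eventually_ball_finite ballI)
    fix jP assume "jP \<in> set r"
    then have "ZP (fst jP) (snd jP)" "\<not> DZP (fst jP) (snd jP)"
      using tower_roots[OF assms(1), of "fst jP" "snd jP"] by auto
    then show "eventually (\<lambda>x. poly (specialise x (snd jP)) (x (fst jP)) = 0 \<and>
      poly (pderiv (specialise x (snd jP))) (x (fst jP)) \<noteq> 0) \<U>"
      using not_DZP by (auto simp: ZP_def intro: eventually_conj)
  qed simp
  then show ?thesis
    by eventually_elim (use curve_exists[OF assms(1) _ assms(2)] in \<open>fastforce simp: case_prod_beta\<close>)
qed

text \<open>Each atom either is a generic relation, which persists along the curve, or is nonzero at
  \<open>x\<close>, which persists by continuity. Finitely many atoms decide the formula.\<close>

lemma eventually_sat_on_curve:
  assumes tow: "tower B r" and ind: "indep B"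
    and \<psi>: "ring_qf \<psi>" "params \<psi> \<subseteq> F" "free_vars \<psi> \<subseteq> B \<union> fst ` set r"
    and sat: "eventually (\<lambda>x. sat \<tau> x (\<lambda>_. {}) \<psi>) \<U>"
  shows "eventually (\<lambda>x. \<forall>i\<in>B. \<forall>H. curve x i B r H \<longrightarrow>
    eventually (\<lambda>u. sat \<tau> (H u) (\<lambda>_. {}) \<psi>) (nhdsin \<tau> (x i))) \<U>"
proof -
  have "eventually (\<lambda>x. \<forall>q\<in>atoms \<psi>. \<forall>i\<in>B. \<forall>H. curve x i B r H \<longrightarrow>
    eventually (\<lambda>u. mpoly_eval (H u) q = 0 \<longleftrightarrow> mpoly_eval x q = 0) (nhdsin \<tau> (x i))) \<U>"
  proof (rule eventually_ball_finite[OF finite_atoms], rule ballI)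
    fix q assume "q \<in> atoms \<psi>"
    then have q: "q \<in> polys_in F (B \<union> fst ` set r)" using atoms_in[OF F \<psi>] by blast
    show "eventually (\<lambda>x. \<forall>i\<in>B. \<forall>H. curve x i B r H \<longrightarrow>
      eventually (\<lambda>u. mpoly_eval (H u) q = 0 \<longleftrightarrow> mpoly_eval x q = 0) (nhdsin \<tau> (x i))) \<U>"
    proof (cases "Z q")
      case True
      show ?thesis
        using eventually_vanishing_on_curve[OF tow ind q True] True[unfolded Z_def]
        by eventually_elim (auto elim: eventually_mono)
    next
      case False
      show ?thesis
        using False[unfolded not_Z]
      proof eventually_elim
        case (elim x)
        show ?case
        proof (intro ballI allI impI)
          fix i H assume "curve x i B r H"
          then have "eventually (\<lambda>u. mpoly_eval (H u) q \<noteq> 0) (nhdsin \<tau> (x i))"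
            using elim by (intro eventually_mpoly_eval_nonzero) (auto simp: curve_def)
          then show "eventually (\<lambda>u. mpoly_eval (H u) q = 0 \<longleftrightarrow> mpoly_eval x q = 0) (nhdsin \<tau> (x i))"
            by eventually_elim (use elim in auto)
        qed
      qed
    qed
  qed
  then show ?thesis
    using sat
  proof eventually_elim
    case (elim x)
    show ?case
    proof (intro ballI allI impI)
      fix i H assume "i \<in> B" "curve x i B r H"
      then have "eventually (\<lambda>u. \<forall>q\<in>atoms \<psi>. mpoly_eval (H u) q = 0 \<longleftrightarrow> mpoly_eval x q = 0) (nhdsin \<tau> (x i))"
        using elim(1) by (intro eventually_ball_finite finite_atoms) auto
      then show "eventually (\<lambda>u. sat \<tau> (H u) (\<lambda>_. {}) \<psi>) (nhdsin \<tau> (x i))"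
      proof eventually_elim
        case (elim u)
        then have "sat \<tau> (H u) (\<lambda>_. {}) \<psi> \<longleftrightarrow> sat \<tau> x (\<lambda>_. {}) \<psi>"
          by (intro sat_atoms_cong[OF \<psi>(1)]) blast
        then show ?case using \<open>sat \<tau> x (\<lambda>_. {}) \<psi>\<close> by simp
      qed
    qed
  qed
qed

text \<open>Choose \<open>m\<close> maximal such that the m-th power of the characteristic exponent
  divides all exponents of variables in \<open>B\<close>; an exponent violating divisibility by the
  next power gives \<open>i\<close> and \<open>\<beta>\<close>. In characteristic 0 the power is 1
  and any positive exponent works.\<close>

lemma exact_power:
  assumes "\<alpha> \<in> ks q" "j \<in> B" "lkp \<alpha> j \<noteq> 0"
  obtains m i \<beta> where "i \<in> B" "\<beta> \<in> ks (q :: 'a mp)"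
    "\<And>\<gamma> k. \<gamma> \<in> ks q \<Longrightarrow> k \<in> B \<Longrightarrow> char_exponent TYPE('a) ^ m dvd lkp \<gamma> k"
    "of_nat (lkp \<beta> i div char_exponent TYPE('a) ^ m) \<noteq> (0 :: 'a)"
proof (cases "CHAR('a) = 0")
  case True
  then have "of_nat (lkp \<alpha> j) \<noteq> (0 :: 'a)" using assms(3) by (simp add: of_nat_eq_0_iff_char_dvd)
  then show thesis using that[of j \<alpha> 0] assms by simp
next
  case False
  define p where "p = CHAR('a)"
  have p: "char_exponent TYPE('a) = p" "p \<ge> 2"
    using False CHAR_cases[where 'a='a] prime_ge_2_nat by (auto simp: char_exponent_def p_def)
  define P where "P m \<longleftrightarrow> (\<forall>\<gamma>\<in>ks q. \<forall>k\<in>B. p ^ m dvd lkp \<gamma> k)" for m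
  \<comment> \<open>A maximal \<open>m\<close> exists because p^k exceeds the positive exponent k =
    \<open>lkp \<alpha> j\<close>.\<close>
  have "\<not> P (lkp \<alpha> j)"
  proof
    assume "P (lkp \<alpha> j)"
    then have "p ^ lkp \<alpha> j \<le> lkp \<alpha> j" using assms unfolding P_def by (auto intro: dvd_imp_le)
    moreover have "lkp \<alpha> j < 2 ^ lkp \<alpha> j" by (rule less_exp)
    moreover have "(2 :: nat) ^ lkp \<alpha> j \<le> p ^ lkp \<alpha> j" using p(2) by (rule power_mono) simp
    ultimately show False by linarith
  qed
  moreover have "P 0" by (simp add: P_def)
  ultimately obtain m where m: "P m" "\<not> P (Suc m)"
    by (metis nat_induct)
  then obtain \<beta> i where \<beta>: "\<beta> \<in> ks q" "i \<in> B" "\<not> p ^ Suc m dvd lkp \<beta> i" by (auto simp: P_def)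
  have "p ^ m dvd lkp \<beta> i" using m(1) \<beta> by (auto simp: P_def)
  then obtain c where c: "lkp \<beta> i = p ^ m * c" by (auto elim: dvdE)
  have "\<not> p dvd c" using \<beta>(3) c by (auto simp: mult.commute[of p])
  then have "of_nat (lkp \<beta> i div p ^ m) \<noteq> (0 :: 'a)"
    using c p(2) by (simp add: of_nat_eq_0_iff_char_dvd p_def[symmetric])
  then show thesis using that[of i \<beta> m] \<beta> m(1) unfolding p(1) P_def by blast
qed

end

lemma mpoly_eval_contract_frob:
  assumes "\<And>\<alpha>. \<alpha> \<in> ks q \<Longrightarrow> n dvd lkp \<alpha> i" "i \<noteq> 0"
  shows "mpoly_eval (x(i := u ^ n, 0 := w)) (contract i n q) = mpoly_eval (x(i := u, 0 := w)) q"
  using mpoly_eval_contract[OF assms(1), where x = "x(i := u, 0 := w)"] assms(2)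
  by (simp add: fun_upd_twist)

text \<open>Only X_0 and X_i can occur with exponents not divisible by \<open>n\<close> after
  contraction, and their values are assumed in \<open>E\<close>; the other variables contribute n-th
  powers.\<close>

lemma coeffs_specialise_contract_in:
  assumes E: "is_subfield E" and q: "q \<in> polys_in F (insert 0 B)" and FE: "F \<subseteq> E"
    and dvd: "\<And>\<alpha> k. \<alpha> \<in> ks q \<Longrightarrow> k \<in> B \<Longrightarrow> n dvd lkp \<alpha> k"
    and powers: "\<And>z. z ^ n \<in> E" and i: "z i \<in> E" and "z 0 \<in> E"
    and j: "j \<in> {0, i}"
  shows "cf (specialise z (sep j (contract i n q))) k \<in> E"
proof -
  have mono: "mono_eval (z(j := 1)) (upd i (lkp \<alpha> i div n) \<alpha>) \<in> E" if \<alpha>: "\<alpha> \<in> ks q" for \<alpha>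
    unfolding mono_eval_def
  proof (rule is_subfield_prod[OF E])
    fix l assume l: "l \<in> ks (upd i (lkp \<alpha> i div n) \<alpha>)"
    show "(z(j := 1)) l ^ lkp (upd i (lkp \<alpha> i div n) \<alpha>) l \<in> E"
    proof (cases "l = i \<or> l = 0")
      case True
      then have "(z(j := 1)) l \<in> E" using i assms(7) is_subfieldD(2)[OF E] by auto
      then show ?thesis by (rule is_subfield_power[OF E])
    next
      case False
      then have "l \<in> ks \<alpha>" using subsetD[OF keys_upd l] by simp
      then have "l \<in> B" using polys_inD(2)[OF q \<alpha>] False by blast
      then obtain c where c: "lkp \<alpha> l = n * c" using dvd[OF \<alpha>] by (auto elim: dvdE)
      have "(z l ^ n) ^ c \<in> E" using powers by (rule is_subfield_power[OF E])
      then show ?thesis using False j c by (auto simp: lookup_upd simp flip: power_mult)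
    qed
  qed
  have "cf (specialise z (sep j (contract i n q))) k = (\<Sum>\<alpha>\<in>ks q. if lkp (upd i (lkp \<alpha> i div n) \<alpha>) j = k
      then lkp q \<alpha> * mono_eval (z(j := 1)) (upd i (lkp \<alpha> i div n) \<alpha>) else 0)"
    by (simp add: contract_def sep_sum sep_single specialise_sum specialise_monom mono_eval_upd[of _ j]
        coeff_sum cong: if_cong)
  also have "\<dots> \<in> E"
  proof (rule is_subfield_sum[OF E])
    fix \<alpha> assume \<alpha>: "\<alpha> \<in> ks q"
    have "lkp q \<alpha> \<in> E" using polys_inD(1)[OF q] FE by blast
    then have "lkp q \<alpha> * mono_eval (z(j := 1)) (upd i (lkp \<alpha> i div n) \<alpha>) \<in> E"
      using mono[OF \<alpha>] by (rule is_subfieldD(5)[OF E])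
    then show "(if lkp (upd i (lkp \<alpha> i div n) \<alpha>) j = k
      then lkp q \<alpha> * mono_eval (z(j := 1)) (upd i (lkp \<alpha> i div n) \<alpha>) else 0) \<in> E"
      using is_subfieldD(1)[OF E] by simp
  qed
  finally show ?thesis .
qed

context generic_point_topology
begin

text \<open>With a separating transcendence basis in the coordinates, one basis coordinate \<open>i\<close> is varied
  and the others are kept. If the coordinate \<open>0\<close> is not itself in the basis, its relation \<open>q\<close> to the
  basis may be inseparable over the \<open>i\<close>-th coordinate, but it is separable over a power $X_i^{p^m}$,
  and the implicit function theorem applies in both directions.\<close>

lemma dichotomy_at_generic_point:
  assumes \<psi>: "ring_qf \<psi>" "params \<psi> \<subseteq> F"
    and sat: "eventually (\<lambda>x. sat \<tau> x (\<lambda>_. {}) \<psi>) \<U>"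
    and A: "A = {e 0 |e. sat \<tau> e (\<lambda>_. {}) \<psi>}"
    and trans: "\<And>p :: 'a poly. p \<noteq> 0 \<Longrightarrow> (\<forall>k. cf p k \<in> F) \<Longrightarrow> eventually (\<lambda>x. poly p (x 0) \<noteq> 0) \<U>"
  shows "infinite_with_injection \<tau> C A \<and> (F \<subseteq> K_pow_inf \<longrightarrow> contains_open_powers \<tau> A)"
proof -
  \<comment> \<open>Including 0 makes coordinate 0 available even when it is not free in
    \<open>\<psi>\<close>.\<close>
  define N where "N = Suc (Max (insert 0 (free_vars \<psi>)))"
  have N: "free_vars \<psi> \<subseteq> {..<N}"
    using Max_ge[of "insert 0 (free_vars \<psi>)"] finite_free_vars[of \<psi>] by (auto simp: N_def less_Suc_eq_le)
  have start: "finite {..<N}" "0 \<in> {..<N}" "tower {..<N} []" by (auto simp: N_def)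
  obtain B r where finB: "finite B" and union0: "B \<union> fst ` set r = {..<N} \<union> fst ` set ([] :: (nat \<times> 'a mp poly) list)"
    and tow: "tower B r" and ind: "indep B"
    and last: "0 \<in> B \<or> (\<exists>P r'' d q. r = (0, P) # r'' \<and> 0 \<notin> B \<and>
       minimal_relation (insert 0 B) d q \<and> \<not> Z (pdiv 0 1 q))"
    by (rule tower_exists[OF start]) (rule that)
  have union: "B \<union> fst ` set r = {..<N}" using union0 by simp
  have curves: "eventually (\<lambda>x. \<forall>i\<in>B. \<exists>H. curve x i B r H) \<U>"
    using eventually_curve_exists[OF tow, of N] union by simp
  have sat_curve: "eventually (\<lambda>x. \<forall>i\<in>B. \<forall>H. curve x i B r H \<longrightarrow>
      eventually (\<lambda>u. sat \<tau> (H u) (\<lambda>_. {}) \<psi>) (nhdsin \<tau> (x i))) \<U>"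
    using eventually_sat_on_curve[OF tow ind \<psi> _ sat] N union by simp
  show ?thesis
  proof (cases "0 \<in> B")
    case True
    \<comment> \<open>With 0 in the basis, the curve is parametrised by its own first coordinate, so
      \<open>A\<close> contains a neighbourhood of \<open>x 0\<close>.\<close>
    from eventually_happens[OF eventually_conj[OF curves sat_curve]] proper True
    obtain x H where H: "curve x 0 B r H"
      and ev: "eventually (\<lambda>u. sat \<tau> (H u) (\<lambda>_. {}) \<psi>) (nhdsin \<tau> (x 0))"
      by blast
    from ev obtain U where U: "openin \<tau> U" "x 0 \<in> U" "\<And>u. u \<in> U \<Longrightarrow> sat \<tau> (H u) (\<lambda>_. {}) \<psi>"
      by (rule eventually_nhdsinE) (rule that)
    have "H u 0 = u" for u using H by (simp add: curve_def)
    then have "U \<subseteq> A" unfolding A using U(3) by (metis (mono_tags, lifting) mem_Collect_eq subsetI)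
    then show ?thesis
      using infinite_with_injection_of_open contains_open_powers_of_open U by blast
  next
    case False
    obtain P r'' d q where r: "r = (0, P) # r''" and 0: "0 \<notin> B"
      and q: "minimal_relation (insert 0 B) d q" and D0: "\<not> Z (pdiv 0 1 q)"
      using last False by blast
    let ?W = "insert 0 B"
    have W: "?W \<subseteq> {..<N}" using union r by auto
    have q_in: "q \<in> polys_in F ?W" and Zq: "Z q" and degq: "deg_less d q"
      and min: "\<And>r. r \<in> polys_in F ?W \<Longrightarrow> deg_less (d - 1) r \<Longrightarrow> Z r \<Longrightarrow> r = 0"
      using q by (auto simp: minimal_relation_def)
    \<comment> \<open>A relation in X_0 alone would contradict \<open>trans\<close>, so some basis
      variable occurs in \<open>q\<close>.\<close>
    have q_F0: "q \<notin> polys_in F {0}"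
    proof
      assume q0: "q \<in> polys_in F {0}"
      define p where "p = specialise (\<lambda>_. 1) (sep 0 q)"
      have spec: "specialise x (sep 0 q) = p" for x
        unfolding p_def by (rule specialise_sep_cong[OF q0]) auto
      have "cf p k \<in> F" for k
        unfolding p_def cf_specialise
        by (rule mpoly_eval_in[OF F cf_sep_in_polys_in[OF F q0]]) (simp add: is_subfieldD[OF F])
      moreover have "p \<noteq> 0"
      proof
        assume "p = 0"
        then have "mpoly_eval x (pdiv 0 1 q) = 0" for x
          using mpoly_eval_pdiv_1[of x 0 q] spec[of x] by simp
        then show False using D0 by (simp add: Z_def)
      qed
      ultimately have ne: "eventually (\<lambda>x. poly p (x 0) \<noteq> 0) \<U>" using trans by blast
      have eq: "poly p (x 0) = mpoly_eval x q" for x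
        using poly_specialise_sep[of x 0 q "x 0"] spec[of x] by simp
      have "eventually (\<lambda>x. False) \<U>"
        using ne Zq[unfolded Z_def] by eventually_elim (simp add: eq)
      then show False using proper by simp
    qed
    have "\<exists>\<alpha>\<in>ks q. \<exists>j\<in>B. lkp \<alpha> j \<noteq> 0"
    proof (rule ccontr)
      assume *: "\<not> ?thesis"
      have "ks \<alpha> \<subseteq> {0}" if "\<alpha> \<in> ks q" for \<alpha>
        using polys_inD(2)[OF q_in that] * that by (auto simp: in_keys_iff)
      then show False using q_in q_F0 by (simp add: polys_in_def)
    qed
    then obtain \<alpha> j where \<alpha>: "\<alpha> \<in> ks q" "j \<in> B" "lkp \<alpha> j \<noteq> 0" by blast
    obtain m i \<beta> where i: "i \<in> B" and \<beta>: "\<beta> \<in> ks q"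
      and dvd: "\<And>\<gamma> k. \<gamma> \<in> ks q \<Longrightarrow> k \<in> B \<Longrightarrow> char_exponent TYPE('a) ^ m dvd lkp \<gamma> k"
      and nz: "of_nat (lkp \<beta> i div char_exponent TYPE('a) ^ m) \<noteq> (0 :: 'a)"
      by (rule exact_power[OF \<alpha>]) (rule that)
    define n where "n = char_exponent TYPE('a) ^ m"
    have n0: "n > 0" using char_exponent_pos[where 'a='a] by (simp add: n_def)
    have frob: "frob m z = z ^ n" for z :: 'a by (simp add: frob_def n_def)
    have i0: "i \<noteq> 0" using i 0 by metis
    note dvd = dvd[folded n_def] and nz = nz[folded n_def]
    have dvd_i: "n dvd lkp \<gamma> i" if "\<gamma> \<in> ks q" for \<gamma> using dvd that i by blast
    \<comment> \<open>\<open>c\<close> is \<open>q\<close> written in T = X_i^n. It has a nonzero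
      derivative by T, even where \<open>q\<close> is inseparable in X_i.\<close>
    define c where "c = contract i n q"
    have c_in: "c \<in> polys_in F ?W" unfolding c_def by (rule contract_in_polys_in[OF F q_in])
    have cf_c: "cf (sep k c) l \<in> polys_in UNIV {..<N}" for k l
      using cf_sep_in_polys_in[OF F c_in] W polys_in_mono polys_in_UNIV by (meson Diff_subset order_trans)
    \<comment> \<open>The choice of \<open>i\<close> and \<open>n\<close> makes this derivative a
      nonzero polynomial, and its degree is too small for a relation.\<close>
    have G: "\<not> Z (pdiv i n q)"
      using min[OF pdiv_in_polys_in[OF F q_in] deg_less_pdiv[OF degq n0]] pdiv_nonzero[OF \<beta> nz] by blast
    have qB: "q \<in> polys_in F (B \<union> fst ` set r)" using polys_in_mono[OF q_in, of "B \<union> fst ` set r"] r by auto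
    have "eventually (\<lambda>x. \<exists>H. curve x i B r H \<and>
        eventually (\<lambda>u. sat \<tau> (H u) (\<lambda>_. {}) \<psi>) (nhdsin \<tau> (x i)) \<and>
        eventually (\<lambda>u. mpoly_eval (H u) q = 0) (nhdsin \<tau> (x i)) \<and>
        mpoly_eval x q = 0 \<and> mpoly_eval x (pdiv i n q) \<noteq> 0 \<and> mpoly_eval x (pdiv 0 1 q) \<noteq> 0) \<U>"
      using curves sat_curve eventually_vanishing_on_curve[OF tow ind qB Zq] Zq[unfolded Z_def]
        G[unfolded not_Z] D0[unfolded not_Z]
      by eventually_elim (use i in blast)
    from eventually_happens[OF this] proper
    obtain x H where H: "curve x i B r H"
      and satH: "eventually (\<lambda>u. sat \<tau> (H u) (\<lambda>_. {}) \<psi>) (nhdsin \<tau> (x i))"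
      and qH: "eventually (\<lambda>u. mpoly_eval (H u) q = 0) (nhdsin \<tau> (x i))"
      and qx: "mpoly_eval x q = 0" and Gx: "mpoly_eval x (pdiv i n q) \<noteq> 0"
      and D0x: "mpoly_eval x (pdiv 0 1 q) \<noteq> 0"
      by blast
    \<comment> \<open>Position \<open>i\<close> of \<open>x'\<close> holds the value of T; this is
      the base point for solving c = 0.\<close>
    define t0 where "t0 = x i ^ n"
    define x' where "x' = x(i := t0)"
    have limH: "filterlim (\<lambda>u. H u k) (nhdsin \<tau> (x k)) (nhdsin \<tau> (x i))" for k
      using H by (simp add: curve_def)
    have onH: "mpoly_eval (H u) s = mpoly_eval (x(i := u, 0 := H u 0)) s" if "s \<in> polys_in F ?W" for s u
      by (rule mpoly_eval_cong[OF that]) (use H in \<open>auto simp: curve_def\<close>)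
    have contr: "mpoly_eval (x(i := u ^ n, 0 := w)) c = mpoly_eval (x(i := u, 0 := w)) q" for u w
      unfolding c_def by (rule mpoly_eval_contract_frob[OF dvd_i i0])

    have c_x': "mpoly_eval x' c = 0"
      using contr[of "x i" "x 0"] qx i0 by (simp add: x'_def t0_def fun_upd_idem)
    have root1: "poly (specialise x' (sep 0 c)) (x 0) = 0"
      using c_x' i0 by (simp add: poly_specialise_sep x'_def fun_upd_idem)
    have simple1: "poly (pderiv (specialise x' (sep 0 c))) (x 0) \<noteq> 0"
      using specialise_sep_contract[of q n i 0 x] dvd_i i0 D0x mpoly_eval_pdiv_1[of x 0 q]
      by (simp add: x'_def t0_def c_def)
    have root2: "poly (specialise x' (sep i c)) t0 = 0"
      using c_x' by (simp add: poly_specialise_sep x'_def)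
    have simple2: "poly (pderiv (specialise x' (sep i c))) t0 \<noteq> 0"
      using Gx mpoly_eval_pdiv[of q n i x t0] dvd_i by (simp add: x'_def t0_def c_def)
    obtain V1 h1 where V1: "openin \<tau> V1" "x 0 \<in> V1" "filterlim h1 (nhdsin \<tau> (x 0)) (nhds_point \<tau> N x')"
      "eventually (\<lambda>y. h1 y \<in> V1 \<and> (\<forall>w\<in>V1. poly (specialise y (sep 0 c)) w = 0 \<longleftrightarrow> w = h1 y)) (nhds_point \<tau> N x')"
      by (rule implicit_function[OF ift cf_c root1 simple1]) (rule that)
    obtain V2 h2 where V2: "openin \<tau> V2" "t0 \<in> V2" "filterlim h2 (nhdsin \<tau> t0) (nhds_point \<tau> N x')"
      "eventually (\<lambda>y. h2 y \<in> V2 \<and> (\<forall>T\<in>V2. poly (specialise y (sep i c)) T = 0 \<longleftrightarrow> T = h2 y)) (nhds_point \<tau> N x')"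
      by (rule implicit_function[OF ift cf_c root2 simple2]) (rule that)
    \<comment> \<open>\<open>H1\<close> solves for coordinate 0 in terms of T, and \<open>H2\<close>
      for T in terms of coordinate 0, with the other coordinates frozen.\<close>
    define H1 where "H1 T = h1 (x(i := T))" for T
    define H2 where "H2 w = h2 (x'(0 := w))" for w
    have lim1: "filterlim (\<lambda>T. x(i := T)) (nhds_point \<tau> N x') (nhdsin \<tau> t0)"
      unfolding filterlim_nhds_point by (auto simp: x'_def filterlim_const filterlim_ident)
    have lim2: "filterlim (\<lambda>w. x'(0 := w)) (nhds_point \<tau> N x') (nhdsin \<tau> (x 0))"
      unfolding filterlim_nhds_point
    proof (intro allI impI)
      show "filterlim (\<lambda>w. (x'(0 := w)) k) (nhdsin \<tau> (x' k)) (nhdsin \<tau> (x 0))" for k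
        using i0 by (cases "k = 0") (auto simp: x'_def filterlim_const filterlim_ident)
    qed
    have ev1: "eventually (\<lambda>T. \<forall>w\<in>V1. mpoly_eval (x(i := T, 0 := w)) c = 0 \<longrightarrow> w = H1 T) (nhdsin \<tau> t0)"
    proof -
      have "eventually (\<lambda>T. h1 (x(i := T)) \<in> V1 \<and> (\<forall>w\<in>V1. poly (specialise (x(i := T)) (sep 0 c)) w = 0 \<longleftrightarrow>
          w = h1 (x(i := T)))) (nhdsin \<tau> t0)"
        using V1(4) lim1 by (auto simp: filterlim_iff)
      then show ?thesis by eventually_elim (simp add: poly_specialise_sep H1_def)
    qed
    have ev2: "eventually (\<lambda>w. H2 w \<in> V2 \<and> (\<forall>T\<in>V2. mpoly_eval (x(i := T, 0 := w)) c = 0 \<longleftrightarrow> T = H2 w)) (nhdsin \<tau> (x 0))"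
    proof -
      have "eventually (\<lambda>w. h2 (x'(0 := w)) \<in> V2 \<and> (\<forall>T\<in>V2. poly (specialise (x'(0 := w)) (sep i c)) T = 0 \<longleftrightarrow>
          T = h2 (x'(0 := w)))) (nhdsin \<tau> (x 0))"
        using V2(4) lim2 by (auto simp: filterlim_iff)
      moreover have "x'(0 := w, i := T) = x(i := T, 0 := w)" for w T using i0 by (auto simp: x'_def)
      ultimately show ?thesis by (simp add: poly_specialise_sep H2_def)
    qed
    have limH2: "filterlim H2 (nhdsin \<tau> t0) (nhdsin \<tau> (x 0))"
      unfolding H2_def by (rule filterlim_compose[OF V2(3) lim2])
    have lim_pow: "filterlim (\<lambda>u. u ^ n) (nhdsin \<tau> t0) (nhdsin \<tau> (x i))"
      unfolding t0_def by (intro filterlim_power filterlim_ident)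

    \<comment> \<open>The clause with \<open>H1\<close> makes the graph of \<open>g\<close>
      definable, the one with \<open>H2\<close> makes \<open>g\<close> injective, and the two
      \<open>pdiv\<close> conditions give interalgebraicity.\<close>
    define good where "good u \<longleftrightarrow> sat \<tau> (H u) (\<lambda>_. {}) \<psi> \<and> mpoly_eval (H u) q = 0 \<and> H u 0 \<in> V1 \<and> u ^ n \<in> V2 \<and>
      (\<forall>w\<in>V1. mpoly_eval (x(i := u ^ n, 0 := w)) c = 0 \<longrightarrow> w = H1 (u ^ n)) \<and>
      (\<forall>T\<in>V2. mpoly_eval (x(i := T, 0 := H u 0)) c = 0 \<longleftrightarrow> T = H2 (H u 0)) \<and>
      mpoly_eval (H u) (pdiv i n q) \<noteq> 0 \<and> mpoly_eval (H u) (pdiv 0 1 q) \<noteq> 0" for u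
    have "eventually good (nhdsin \<tau> (x i))"
    proof -
      have "eventually (\<lambda>u. H u 0 \<in> V1) (nhdsin \<tau> (x i))"
        using limH[of 0] eventually_open[OF V1(1,2)] by (auto simp: filterlim_iff)
      moreover have "eventually (\<lambda>u. u ^ n \<in> V2) (nhdsin \<tau> (x i))"
        using lim_pow eventually_open[OF V2(1,2)] by (auto simp: filterlim_iff)
      moreover have "eventually (\<lambda>u. \<forall>w\<in>V1. mpoly_eval (x(i := u ^ n, 0 := w)) c = 0 \<longrightarrow> w = H1 (u ^ n)) (nhdsin \<tau> (x i))"
        using lim_pow ev1 by (auto simp: filterlim_iff)
      moreover have "eventually (\<lambda>u. H2 (H u 0) \<in> V2 \<and> (\<forall>T\<in>V2. mpoly_eval (x(i := T, 0 := H u 0)) c = 0 \<longleftrightarrow> T = H2 (H u 0))) (nhdsin \<tau> (x i))"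
        using limH[of 0] ev2 by (auto simp: filterlim_iff)
      moreover have "eventually (\<lambda>u. mpoly_eval (H u) (pdiv i n q) \<noteq> 0) (nhdsin \<tau> (x i))"
        using limH Gx by (rule eventually_mpoly_eval_nonzero)
      moreover have "eventually (\<lambda>u. mpoly_eval (H u) (pdiv 0 1 q) \<noteq> 0) (nhdsin \<tau> (x i))"
        using limH D0x by (rule eventually_mpoly_eval_nonzero)
      ultimately show ?thesis
        using satH qH by eventually_elim (simp add: good_def)
    qed
    then obtain U where U: "openin \<tau> U" "x i \<in> U" "\<And>u. u \<in> U \<Longrightarrow> good u"
      by (rule eventually_nhdsinE) (rule that)
    define g where "g u = H u 0" for u
    have unique: "w = g u" if "u \<in> U" "w \<in> V1" "mpoly_eval (x(i := u, 0 := w)) q = 0" for u w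
    proof -
      have "g u \<in> V1" "mpoly_eval (x(i := u, 0 := g u)) q = 0"
        using U(3)[OF that(1)] onH[OF q_in, of u] by (auto simp: good_def g_def)
      then show ?thesis using U(3)[OF that(1)] that unfolding good_def contr by metis
    qed
    have graph: "{(u, g u) |u. u \<in> U \<inter> UNIV} = {(u, w). u \<in> U \<and> w \<in> V1 \<and> mpoly_eval (x(i := u, 0 := w)) q = 0}"
      using unique U(3) onH[OF q_in] by (auto simp: good_def g_def)
    have gA: "g ` U \<subseteq> A" unfolding A g_def using U(3) by (auto simp: good_def)
    \<comment> \<open>\<open>H2\<close> recovers u^n from \<open>g u\<close>, and u^n determines
      \<open>u\<close> because it is a Frobenius power.\<close>
    have inj: "inj_on g U"
    proof (rule inj_onI)
      fix u v assume uv: "u \<in> U" "v \<in> U" "g u = g v"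
      have "u ^ n = H2 (g u)" if "u \<in> U" for u
        using U(3)[OF that] onH[OF q_in, of u] contr[of u "H u 0"] unfolding good_def g_def by metis
      then have "frob m u = frob m v" using uv by (simp add: frob)
      then show "u = v" using inj_frob by (auto dest: injD)
    qed
    have "infinite U" using infinite_open U by blast
    then have infA: "infinite A" using gA inj by (metis finite_imageD finite_subset)
    \<comment> \<open>With these parameters, specialising \<open>q\<close> at all coordinates but
      one gives coefficients in the base field extended by \<open>u\<close> or by
      \<open>g u\<close>.\<close>
    define S where "S = lkp q ` ks q \<union> x ` ?W"
    have finS: "finite S" using finB by (simp add: S_def)
    obtain \<phi> where \<phi>: "S \<subseteq> params \<phi>"
      "defines_relation \<tau> \<phi> {(u, w). u \<in> U \<and> w \<in> V1 \<and> mpoly_eval (x(i := u, 0 := w)) q = 0}"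
      by (rule graph_formula[OF U(1) V1(1) finS i0, of x q]) (rule that)
    have inter: "interalgebraic (generated_subfield (C \<union> params \<phi>)) u (g u)" if u: "u \<in> U" for u
    proof -
      let ?E = "generated_subfield (C \<union> params \<phi>)"
      have SE: "S \<subseteq> ?E" using \<phi>(1) hull_subset[of "C \<union> params \<phi>" is_subfield] by auto
      have coeffs: "cf (specialise y (sep k q)) l \<in> generated_subfield (?E \<union> {t})"
        if y: "\<And>b. b \<in> ?W - {k} \<Longrightarrow> y b \<in> insert t S" for y k l t
      proof -
        let ?L = "generated_subfield (?E \<union> {t})"
        have L: "is_subfield ?L" by (rule is_subfield_generated)
        have EL: "?E \<union> {t} \<subseteq> ?L" by (rule hull_subset)
        have "lkp q \<gamma> \<in> ?L" for \<gamma>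
        proof (cases "\<gamma> \<in> ks q")
          case True
          then have "lkp q \<gamma> \<in> S" by (simp add: S_def)
          then show ?thesis using SE EL by blast
        qed (use is_subfieldD(1)[OF L] in \<open>simp add: in_keys_iff\<close>)
        then have qL: "q \<in> polys_in ?L ?W" using q_in by (simp add: polys_in_def)
        show ?thesis unfolding cf_specialise
          using y SE EL by (intro mpoly_eval_in[OF L cf_sep_in_polys_in[OF L qL]]) blast
      qed
      have gu: "mpoly_eval (x(i := u, 0 := g u)) q = 0" "mpoly_eval (x(i := u, 0 := g u)) (pdiv i n q) \<noteq> 0"
        "mpoly_eval (x(i := u, 0 := g u)) (pdiv 0 1 q) \<noteq> 0"
        using U(3)[OF u] onH[OF q_in, of u] onH[OF pdiv_in_polys_in[OF F q_in], of u]
        by (simp_all add: good_def g_def)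
      let ?y = "x(i := u, 0 := g u)"
      have "algebraic_over (generated_subfield (?E \<union> {g u})) u"
        unfolding algebraic_over_def
      proof (intro exI conjI allI)
        show "cf (specialise ?y (sep i q)) l \<in> generated_subfield (?E \<union> {g u})" for l
          by (rule coeffs) (auto simp: S_def)
        have idem: "?y(i := u) = ?y" using i0 by auto
        then show "poly (specialise ?y (sep i q)) u = 0"
          using gu(1) by (simp add: poly_specialise_sep del: fun_upd_apply)
        show "specialise ?y (sep i q) \<noteq> 0"
        proof
          \<comment> \<open>Then \<open>c\<close> would vanish at all n-th powers in place of T.
            There are infinitely many of them, so \<open>c\<close> and its derivative by T would
            vanish identically.\<close>
          assume zero: "specialise ?y (sep i q) = 0"
          have "poly (specialise ?y (sep i c)) (v ^ n) = 0" for v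
          proof -
            have "mpoly_eval (?y(i := v)) q = 0"
              using zero poly_specialise_sep[of ?y i q v] by simp
            moreover have "?y(i := v) = x(i := v, 0 := g u)" "?y(i := v ^ n) = x(i := v ^ n, 0 := g u)"
              using i0 by auto
            ultimately show ?thesis using contr[of v "g u"] by (simp only: poly_specialise_sep)
          qed
          then have "range (frob m) \<subseteq> {t. poly (specialise ?y (sep i c)) t = 0}" by (auto simp: frob)
          moreover have "infinite (range (frob m) :: 'a set)"
            using infinite_open[of UNIV] openin_topspace[of \<tau>] inj_frob[of m, where 'a='a]
            by (auto dest: finite_imageD)
          ultimately have "specialise ?y (sep i c) = 0"
            using poly_roots_finite finite_subset by blast
          then show False
            using gu(2) mpoly_eval_pdiv[of q n i ?y u] dvd_i idem by (simp add: c_def del: fun_upd_apply)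
        qed
      qed
      moreover have "algebraic_over (generated_subfield (?E \<union> {u})) (g u)"
        unfolding algebraic_over_def
      proof (intro exI conjI allI)
        show "cf (specialise ?y (sep 0 q)) l \<in> generated_subfield (?E \<union> {u})" for l
          by (rule coeffs) (auto simp: S_def)
        show "poly (specialise ?y (sep 0 q)) (g u) = 0"
          using gu(1) by (simp add: poly_specialise_sep)
        show "specialise ?y (sep 0 q) \<noteq> 0"
        proof
          assume "specialise ?y (sep 0 q) = 0"
          then show False using gu(3) mpoly_eval_pdiv_1[of ?y 0 q] by simp
        qed
      qed
      ultimately show ?thesis by (simp add: interalgebraic_def)
    qed
    have "infinite_with_injection \<tau> C A"
      unfolding infinite_with_injection_def
    proof (intro conjI exI)
      show "infinite A" by fact
      show "openin \<tau> U" "x i \<in> U" "U \<subseteq> U" using U by auto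
      show "zariski_open UNIV" by (rule zariski_open_UNIV)
      show "U \<inter> UNIV \<noteq> {}" "inj_on g (U \<inter> UNIV)" "g ` (U \<inter> UNIV) \<subseteq> A"
        using U inj gA by auto
      show "defines_relation \<tau> \<phi> {(u, g u) |u. u \<in> U \<inter> UNIV}" unfolding graph by (rule \<phi>(2))
      show "\<forall>u\<in>U \<inter> UNIV. interalgebraic (generated_subfield (C \<union> params \<phi>)) u (g u)"
        using inter by simp
    qed
    moreover have "contains_open_powers \<tau> A" if perfect: "F \<subseteq> K_pow_inf"
    proof -
      let ?E = "range (frob m) :: 'a set"
      have E: "is_subfield ?E" by (simp add: is_subfield_frob)
      have FE: "F \<subseteq> ?E" using perfect unfolding K_pow_inf_def K_pow_eq by blast
      have powE: "z ^ n \<in> ?E" for z using frob[of z, symmetric] by simp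
      note coeffs_E = coeffs_specialise_contract_in[OF E q_in FE dvd powE, of _ i, folded c_def]
      \<comment> \<open>\<open>x 0\<close> is a simple root of a polynomial over K^(p^m). Its
        coefficients do not involve coordinate 0, which is set to 1 because its membership is yet to
        be shown.\<close>
      have x0: "x 0 \<in> ?E"
      proof -
        have "specialise x' (sep 0 c) = specialise (x'(0 := 1)) (sep 0 c)"
          by (rule specialise_sep_cong[OF c_in]) auto
        then have "cf (specialise x' (sep 0 c)) k \<in> ?E" for k
          using coeffs_E[of "x'(0 := 1)" 0 k] powE[of "x i"] is_subfieldD(2)[OF E] i0
          by (simp add: x'_def t0_def)
        then show ?thesis using simple_root_in_frob_range root1 simple1 by blast
      qed
      \<comment> \<open>\<open>H2 w\<close> is close to t0, the p^m-th power of \<open>x i\<close>,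
        so each of its roots is close to \<open>x i\<close>.\<close>
      have rootU: "eventually (\<lambda>w. \<forall>u. frob m u = H2 w \<longrightarrow> u \<in> U) (nhdsin \<tau> (x 0))"
        using eventually_frob_inverse[OF eventually_open[OF U(1,2)], of m] limH2
        by (auto simp: filterlim_iff frob t0_def)
      have simple: "eventually (\<lambda>w. mpoly_eval (x(i := H2 w, 0 := w)) (pdiv i 1 c) \<noteq> 0) (nhdsin \<tau> (x 0))"
      proof (rule eventually_mpoly_eval_nonzero)
        show "filterlim (\<lambda>w. (x(i := H2 w, 0 := w)) k) (nhdsin \<tau> (x' k)) (nhdsin \<tau> (x 0))" for k
          using limH2 i0 by (cases "k = 0") (auto simp: x'_def filterlim_const filterlim_ident)
        show "mpoly_eval x' (pdiv i 1 c) \<noteq> 0"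
          using simple2 by (simp add: mpoly_eval_pdiv_1[unfolded One_nat_def] x'_def)
      qed
      \<comment> \<open>For \<open>w\<close> in K^(p^m) the value \<open>H2 w\<close> is a simple
        root over that field, hence the p^m-th power of some \<open>u\<close> in \<open>U\<close>;
        uniqueness then gives w = g u.\<close>
      have "eventually (\<lambda>w. w \<in> ?E \<longrightarrow> w \<in> A) (nhdsin \<tau> (x 0))"
        using ev2 rootU simple eventually_open[OF V1(1,2)]
      proof eventually_elim
        case (elim w)
        show ?case
        proof
          assume w: "w \<in> ?E"
          let ?z = "x(i := H2 w, 0 := w)"
          have root: "poly (specialise ?z (sep i c)) (H2 w) = 0"
            using elim(1) i0 by (simp add: poly_specialise_sep fun_upd_idem fun_upd_twist)
          have spec: "specialise ?z (sep i c) = specialise (?z(i := 1)) (sep i c)"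
            by (rule specialise_sep_cong[OF c_in]) auto
          have "cf (specialise ?z (sep i c)) k \<in> ?E" for k
            unfolding spec using w is_subfieldD(2)[OF E] i0 by (intro coeffs_E) auto
          moreover have "poly (pderiv (specialise ?z (sep i c))) (H2 w) \<noteq> 0"
            using elim(3) i0 mpoly_eval_pdiv_1[of ?z i c] by simp
          ultimately have "H2 w \<in> ?E" using simple_root_in_frob_range root by blast
          then obtain u where u: "frob m u = H2 w" by auto
          then have "u \<in> U" using elim(2) by blast
          moreover have "mpoly_eval (x(i := H2 w, 0 := w)) c = 0" using elim(1) by blast
          then have "mpoly_eval (x(i := u, 0 := w)) q = 0"
            using contr[of u w] u by (simp add: frob)
          ultimately have "w = g u" using unique elim(4) by blast
          then show "w \<in> A" using gA \<open>u \<in> U\<close> by blast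
        qed
      qed
      then obtain S where S: "openin \<tau> S" "x 0 \<in> S" "\<And>w. w \<in> S \<Longrightarrow> w \<in> ?E \<longrightarrow> w \<in> A"
        by (rule eventually_nhdsinE) (rule that)
      then show ?thesis
        unfolding contains_open_powers_def K_pow_eq using x0
        by (intro exI[of _ m] exI[of _ S]) auto
    qed
    ultimately show ?thesis by blast
  qed
qed

end

text \<open>A witness whose first coordinate is transcendental over \<open>F\<close> gives a
  principal ultrafilter. Otherwise \<open>A\<close> is infinite, and an ultrafilter whose first
  coordinate avoids every finite set also avoids the roots of each nonzero polynomial. The base
  field is left open so that two different ones can be used.\<close>

lemma dichotomy_over_subfield:
  assumes top: "field_topology \<tau>" and ift: "polynomial_IFT \<tau>"
    and F: "is_subfield F" "p_disjoint F"
    and \<psi>: "ring_qf \<psi>" "params \<psi> \<subseteq> F" and A: "A = {e 0 |e. sat \<tau> e (\<lambda>_. {}) \<psi>}"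
    and not_fin: "\<not> (finite A \<and> A \<subseteq> {x. algebraic_over F x})"
  shows "infinite_with_injection \<tau> C A \<and> (F \<subseteq> K_pow_inf \<longrightarrow> contains_open_powers \<tau> A)"
proof -
  have *: "infinite_with_injection \<tau> C A \<and> (F \<subseteq> K_pow_inf \<longrightarrow> contains_open_powers \<tau> A)"
    if "\<U> \<noteq> bot" "\<And>P. eventually P \<U> \<or> eventually (\<lambda>x. \<not> P x) \<U>"
      "eventually (\<lambda>x. sat \<tau> x (\<lambda>_. {}) \<psi>) \<U>"
      "\<And>p :: 'a poly. p \<noteq> 0 \<Longrightarrow> (\<forall>k. cf p k \<in> F) \<Longrightarrow> eventually (\<lambda>x. poly p (x 0) \<noteq> 0) \<U>" for \<U>
  proof -
    interpret field_topology \<tau> by fact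
    interpret generic_point_topology F \<U> \<tau>
      by unfold_locales (use F ift that in auto)
    show ?thesis using dichotomy_at_generic_point[OF \<psi> that(3) A that(4)] .
  qed
  show ?thesis
  proof (cases "A \<subseteq> {x. algebraic_over F x}")
    case False
    then obtain e where e: "sat \<tau> e (\<lambda>_. {}) \<psi>" "\<not> algebraic_over F (e 0)" unfolding A by blast
    show ?thesis
      by (rule *[of "principal {e}"])
        (use e in \<open>auto simp: eventually_principal principal_eq_bot_iff algebraic_over_def\<close>)
  next
    case True
    then have inf: "infinite A" using not_fin by blast
    define \<P> where "\<P> S = principal {e. sat \<tau> e (\<lambda>_. {}) \<psi> \<and> e 0 \<notin> S}" for S :: "'a set"
    define \<F> where "\<F> = (INF S\<in>{S. finite S}. \<P> S)"
    have ev: "eventually P \<F> \<longleftrightarrow> (\<exists>S. finite S \<and> (\<forall>e. sat \<tau> e (\<lambda>_. {}) \<psi> \<and> e 0 \<notin> S \<longrightarrow> P e))" for P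
    proof -
      have "eventually P \<F> \<longleftrightarrow> (\<exists>S\<in>{S. finite S}. eventually P (\<P> S))"
        unfolding \<F>_def
      proof (rule eventually_INF_base)
        fix S T :: "'a set" assume "S \<in> {S. finite S}" "T \<in> {S. finite S}"
        then show "\<exists>R\<in>{S. finite S}. \<P> R \<le> inf (\<P> S) (\<P> T)"
          by (intro bexI[of _ "S \<union> T"]) (auto simp: \<P>_def)
      qed auto
      then show ?thesis by (simp add: \<P>_def eventually_principal)
    qed
    have "\<not> eventually (\<lambda>_. False) \<F>"
    proof
      assume "eventually (\<lambda>_. False) \<F>"
      then obtain S where S: "finite S" "\<And>e. sat \<tau> e (\<lambda>_. {}) \<psi> \<Longrightarrow> e 0 \<in> S" unfolding ev by blast
      then have "A \<subseteq> S" unfolding A by blast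
      then show False using S(1) inf finite_subset by blast
    qed
    then have "\<F> \<noteq> bot" by auto
    then obtain \<U> where \<U>: "\<U> \<le> \<F>" "\<U> \<noteq> bot" "\<And>P. eventually P \<U> \<or> eventually (\<lambda>x. \<not> P x) \<U>"
      by (rule ultrafilter_exists) (rule that)
    show ?thesis
    proof (rule *[OF \<U>(2,3)])
      have "eventually (\<lambda>x. sat \<tau> x (\<lambda>_. {}) \<psi>) \<F>" unfolding ev by blast
      then show "eventually (\<lambda>x. sat \<tau> x (\<lambda>_. {}) \<psi>) \<U>" using \<U>(1) by (auto simp: le_filter_def)
      fix p :: "'a poly" assume "p \<noteq> 0"
      then have "eventually (\<lambda>x. poly p (x 0) \<noteq> 0) \<F>"
        unfolding ev using poly_roots_finite[of p] by (intro exI[of _ "{z. poly p z = 0}"]) auto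
      then show "eventually (\<lambda>x. poly p (x 0) \<noteq> 0) \<U>" using \<U>(1) by (auto simp: le_filter_def)
    qed
  qed
qed

theorem theorem3p12:
  fixes \<tau> :: "'a::field topology"
    and C A :: "'a set"
  assumes "henselian_topology TYPE('g::linordered_ab_group_add) \<tau>"
    and "is_subfield C"
    and "existentially_defined \<tau> C A"
  shows "exactly_one (finite_algebraic C A) (infinite_with_injection \<tau> C A) \<and>
    (C \<subseteq> K_pow_inf \<longrightarrow> exactly_one (finite_algebraic C A) (contains_open_powers \<tau> A))"
proof -
  have top: "field_topology \<tau>" and ift: "polynomial_IFT \<tau>"
    using field_topology_henselian assms(1) by (auto simp: henselian_topology_def)
  obtain \<psi> where \<psi>: "ring_qf \<psi>" "params \<psi> \<subseteq> C" and A: "A = {e 0 |e. sat \<tau> e (\<lambda>_. {}) \<psi>}"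
    by (rule existentially_defined_image[OF assms(3)]) (rule that)
  note \<Lambda> = Lambda_UNIV[OF assms(2)]
  have "infinite_with_injection \<tau> C A" if "\<not> finite_algebraic C A"
    using dichotomy_over_subfield[OF top ift \<Lambda>(1,3) \<psi>(1) _ A] \<psi>(2) \<Lambda>(2) that
    by (auto simp: finite_algebraic_def)
  moreover have "\<not> finite_algebraic C A" if "infinite_with_injection \<tau> C A"
    using that by (simp add: finite_algebraic_def infinite_with_injection_def)
  moreover have "contains_open_powers \<tau> A" if C: "C \<subseteq> K_pow_inf" and nf: "\<not> finite_algebraic C A"
  proof -
    \<comment> \<open>The perfect closure lies in every K^(p^m), and algebraicity over it descends
      to \<open>C\<close>, so (i) is still the alternative to be refuted.\<close>
    let ?D = "perfect_closure_in C"
    note D = perfect_closure_in_props[OF assms(2) C]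
    have "\<not> (finite A \<and> A \<subseteq> {x. algebraic_over ?D x})"
    proof
      assume "finite A \<and> A \<subseteq> {x. algebraic_over ?D x}"
      then have "finite_algebraic C A"
        using algebraic_over_perfect_closure_in[OF assms(2)] algebraic_over_mono[OF _ \<Lambda>(2)]
        unfolding finite_algebraic_def by blast
      then show False using nf by blast
    qed
    moreover have "?D \<subseteq> K_pow_inf" using D(4) by (auto simp: K_pow_inf_def)
    ultimately show ?thesis
      using dichotomy_over_subfield[OF top ift D(1,3) \<psi>(1) _ A] \<psi>(2) D(2) by blast
  qed
  moreover have "\<not> finite_algebraic C A" if "contains_open_powers \<tau> A"
    using field_topology.infinite_of_contains_open_powers[OF top that] by (simp add: finite_algebraic_def)
  ultimately show ?thesis unfolding exactly_one_def by blast
qed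

end
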